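(* For every nonnegative integer $n$ and each $t\in\{62,161\}$, $$p_2(297n+t)\equiv 0\pmod{11},$$ where $p_2(n)$ denotes the number of cubic partitions of $n$.
   Context: For $|q|<1$ write $(a;q)_\infty=\prod_{n\ge 0}(1-aq^n)$. The number $p_2(n)$ of cubic partitions of a nonnegative integer $n$ is defined by the generating function $$\sum_{n\ge 0}p_2(n)q^n=\frac{1}{(q;q)_\infty(q^2;q^2)_\infty}=\prod_{j\ge 1}\frac{1}{(1-q^j)(1-q^{2j})},\quad |q|<1.$$ *)

theory Defs
  imports "HOL-Complex_Analysis.Complex_Analysis" "HOL-Number_Theory.Cong"
begin

text \<open>The \<open>q\<close>-Pochhammer symbol \<open>(a; q)\<^sub>\<infinity>\<close>; only meaningful for \<open>norm q < 1\<close>.\<close>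

definition qpoch_inf :: "complex \<Rightarrow> complex \<Rightarrow> complex" where
  "qpoch_inf a q = (\<Prod>n. 1 - a * q ^ n)"

definition is_cubic_partition_seq :: "(nat \<Rightarrow> nat) \<Rightarrow> bool" where
  "is_cubic_partition_seq p \<longleftrightarrow>
     (\<forall>q::complex. norm q < 1 \<longrightarrow>
        (\<lambda>n. of_nat (p n) * q ^ n) sums (1 / (qpoch_inf q q * qpoch_inf (q\<^sup>2) (q\<^sup>2))))"

text \<open>The description below is proper: existence and uniqueness of the coefficient sequence
  are shown in \<open>ex1_cubic_partition_seq\<close>.\<close>

definition cubic_partitions :: "nat \<Rightarrow> nat" where
  "cubic_partitions = (THE p. is_cubic_partition_seq p)"

lemma qpoch_inf_factor_nonzero:
  fixes q :: complex
  assumes "norm q < 1"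
  shows "1 - q ^ Suc n \<noteq> 0"
proof
  assume "1 - q ^ Suc n = 0"
  hence "norm q ^ Suc n = 1" by (metis eq_iff_diff_eq_0 norm_one norm_power)
  moreover have "norm q ^ Suc n < 1" using assms by (metis norm_ge_zero power_Suc_less_one power_less_one_iff zero_less_Suc)
  ultimately show False by simp
qed

lemma convergent_qpoch_inf:
  fixes q :: complex
  assumes "norm q < 1"
  shows "convergent_prod (\<lambda>n. 1 - q * q ^ n)"
proof -
  have "summable (\<lambda>n. norm (- (q * q ^ n)))"
    using assms by (auto simp: norm_mult norm_power intro!: summable_mult summable_geometric)
  moreover have "- (q * q ^ n) \<noteq> - 1" for n
    using qpoch_inf_factor_nonzero[OF assms, of n] by auto
  ultimately have "convergent_prod (\<lambda>n. 1 + - (q * q ^ n))"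
    by (rule summable_imp_convergent_prod_complex)
  thus ?thesis by simp
qed

lemma qpoch_inf_nonzero:
  fixes q :: complex
  assumes "norm q < 1"
  shows "qpoch_inf q q \<noteq> 0"
  unfolding qpoch_inf_def
  using prodinf_nonzero[OF convergent_qpoch_inf[OF assms]] qpoch_inf_factor_nonzero[OF assms]
  by simp

lemma qpoch_inf_LIMSEQ:
  fixes q :: complex
  assumes "norm q < 1"
  shows "(\<lambda>N. \<Prod>j<N. 1 - q ^ Suc j) \<longlonglongrightarrow> qpoch_inf q q"
  using convergent_prod_LIMSEQ[OF convergent_qpoch_inf[OF assms]]
  unfolding qpoch_inf_def by (simp add: LIMSEQ_lessThan_iff_atMost)

definition mult_geom :: "nat \<Rightarrow> (nat \<Rightarrow> nat) \<Rightarrow> nat \<Rightarrow> nat" where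
  "mult_geom d f n = (\<Sum>i\<le>n. f i * (if d dvd (n - i) then 1 else 0))"

lemma mult_geom_ge: "f n \<le> mult_geom d f n"
proof -
  have "f n = (\<Sum>i\<in>{n}. f i * (if d dvd (n - i) then 1 else 0))" by simp
  also have "\<dots> \<le> mult_geom d f n" unfolding mult_geom_def by (rule sum_mono2) auto
  finally show ?thesis .
qed

lemma mult_geom_eq:
  assumes "n < d"
  shows "mult_geom d f n = f n"
proof -
  have "mult_geom d f n = (\<Sum>i\<in>{n}. f i * (if d dvd (n - i) then 1 else 0))"
    unfolding mult_geom_def
  proof (rule sum.mono_neutral_right; (simp; fail)?)
    have "\<not> d dvd (n - i)" if "i \<le> n" "i \<noteq> n" for i
      using that assms by (auto dest!: dvd_imp_le)
    thus "\<forall>i\<in>{..n} - {n}. f i * (if d dvd (n - i) then 1 else 0) = 0" by auto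
  qed
  thus ?thesis by simp
qed

lemma summable_norm_of_nat_powser:
  fixes q :: complex
  assumes "\<And>q::complex. norm q < 1 \<Longrightarrow> summable (\<lambda>n. of_nat (f n) * q ^ n)"
  assumes "norm q < 1"
  shows "summable (\<lambda>n. norm (of_nat (f n) * q ^ n))"
proof -
  have "summable (\<lambda>n. complex_of_real (real (f n) * norm q ^ n))"
    using assms(1)[of "of_real (norm q)"] assms(2) by simp
  thus ?thesis by (subst (asm) summable_complex_of_real) (simp add: norm_mult norm_power)
qed

lemma sums_dvd_geometric:
  fixes q :: complex
  assumes "d > 0" "norm q < 1"
  shows "(\<lambda>n. of_nat (if d dvd n then 1 else 0) * q ^ n) sums (1 / (1 - q ^ d))"
proof -
  have "norm (q ^ d) < 1"
    using assms by (simp add: norm_power power_less_one_iff)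
  hence "(\<lambda>n. (q ^ d) ^ n) sums (1 / (1 - q ^ d))"
    by (rule geometric_sums)
  hence "(\<lambda>n. (\<lambda>m. of_nat (if d dvd m then 1 else 0) * q ^ m) (d * n)) sums (1 / (1 - q ^ d))"
    by (simp add: power_mult)
  moreover have "strict_mono (\<lambda>n. d * n)" using assms by (auto simp: strict_mono_def)
  ultimately show ?thesis
    by (subst (asm) sums_mono_reindex) (auto elim!: dvdE)
qed

lemma sums_mult_geom:
  assumes "\<And>q::complex. norm q < 1 \<Longrightarrow> (\<lambda>n. of_nat (f n) * q ^ n) sums U q"
  assumes "d > 0" "norm q < 1"
  shows "(\<lambda>n. of_nat (mult_geom d f n) * q ^ n) sums (U q / (1 - q ^ d))"
proof -
  define g :: "nat \<Rightarrow> nat" where "g n = (if d dvd n then 1 else 0)" for n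
  have g: "(\<lambda>n. of_nat (g n) * q ^ n) sums (1 / (1 - q ^ d))" if "norm q < 1" for q :: complex
    using sums_dvd_geometric[OF assms(2) that] by (simp add: g_def)
  have "(\<lambda>n. \<Sum>i\<le>n. (of_nat (f i) * q ^ i) * (of_nat (g (n - i)) * q ^ (n - i))) sums
          ((\<Sum>n. of_nat (f n) * q ^ n) * (\<Sum>n. of_nat (g n) * q ^ n))"
    by (intro Cauchy_product_sums summable_norm_of_nat_powser assms(3))
       (use assms(1) g in \<open>auto simp: sums_iff\<close>)
  also have "(\<Sum>n. of_nat (f n) * q ^ n) * (\<Sum>n. of_nat (g n) * q ^ n) = U q / (1 - q ^ d)"
    using assms(1)[OF assms(3)] g[OF assms(3)] by (simp add: sums_iff)
  also have "(\<lambda>n. \<Sum>i\<le>n. (of_nat (f i) * q ^ i) * (of_nat (g (n - i)) * q ^ (n - i))) =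
             (\<lambda>n. of_nat (mult_geom d f n) * q ^ n)"
  proof
    fix n
    have "(of_nat (f i) * q ^ i) * (of_nat (g (n - i)) * q ^ (n - i)) =
          of_nat (f i * g (n - i)) * q ^ n" if "i \<le> n" for i
    proof -
      have "q ^ n = q ^ i * q ^ (n - i)" using that by (simp flip: power_add)
      thus ?thesis by simp
    qed
    hence "(\<Sum>i\<le>n. (of_nat (f i) * q ^ i) * (of_nat (g (n - i)) * q ^ (n - i))) =
           (\<Sum>i\<le>n. of_nat (f i * g (n - i)) * q ^ n)"
      by (intro sum.cong refl) (metis atMost_iff)
    also have "\<dots> = of_nat (mult_geom d f n) * q ^ n"
      unfolding mult_geom_def g_def of_nat_sum sum_distrib_right ..
    finally show "(\<Sum>i\<le>n. (of_nat (f i) * q ^ i) * (of_nat (g (n - i)) * q ^ (n - i))) =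
                  of_nat (mult_geom d f n) * q ^ n" .
  qed
  finally show ?thesis .
qed

text \<open>Coefficients of the product over \<open>j \<le> N\<close> only.\<close>

fun cubic_partitions_upto :: "nat \<Rightarrow> nat \<Rightarrow> nat" where
  "cubic_partitions_upto 0 = (\<lambda>n. if n = 0 then 1 else 0)"
| "cubic_partitions_upto (Suc N) =
     mult_geom (2 * Suc N) (mult_geom (Suc N) (cubic_partitions_upto N))"

lemma cubic_partitions_upto_sums:
  fixes q :: complex
  assumes "norm q < 1"
  shows "(\<lambda>n. of_nat (cubic_partitions_upto N n) * q ^ n) sums
           (1 / ((\<Prod>j<N. 1 - q ^ Suc j) * (\<Prod>j<N. 1 - (q\<^sup>2) ^ Suc j)))"
  using assms
proof (induction N arbitrary: q)
  case 0
  have "(\<lambda>n. of_nat (cubic_partitions_upto 0 n) * q ^ n) = (\<lambda>n. if n = 0 then 1 else 0)"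
    by auto
  thus ?case using sums_single[of 0 "\<lambda>_. 1 :: complex"] by simp
next
  case (Suc N)
  have "(\<lambda>n. of_nat (cubic_partitions_upto (Suc N) n) * q ^ n) sums
     (1 / ((\<Prod>j<N. 1 - q ^ Suc j) * (\<Prod>j<N. 1 - (q\<^sup>2) ^ Suc j)) / (1 - q ^ Suc N)
        / (1 - q ^ (2 * Suc N)))"
    unfolding cubic_partitions_upto.simps
    by (intro sums_mult_geom Suc) auto
  also have "q ^ (2 * Suc N) = (q\<^sup>2) ^ Suc N" by (rule power_mult)
  finally show ?case by (simp add: mult_ac)
qed

lemma cubic_partitions_upto_mono:
  "M \<le> N \<Longrightarrow> cubic_partitions_upto M n \<le> cubic_partitions_upto N n"
proof (induction rule: dec_induct)
  case (step N)
  thus ?case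
    using mult_geom_ge order_trans by (metis cubic_partitions_upto.simps(2))
qed simp

lemma cubic_partitions_upto_stable:
  "n \<le> N \<Longrightarrow> cubic_partitions_upto N n = cubic_partitions_upto n n"
  by (induction rule: dec_induct) (auto simp: mult_geom_eq)

lemma is_cubic_partition_seq_upto:
  "is_cubic_partition_seq (\<lambda>n. cubic_partitions_upto n n)"
  unfolding is_cubic_partition_seq_def
proof (intro allI impI)
  fix q :: complex
  assume q: "norm q < 1"
  define f where "f = (\<lambda>n. cubic_partitions_upto n n)"
  define G where "G N q = 1 / ((\<Prod>j<N. 1 - q ^ Suc j) * (\<Prod>j<N. 1 - (q\<^sup>2) ^ Suc j))"
    for N and q :: complex
  have G_lim: "(\<lambda>N. G N q) \<longlonglongrightarrow> 1 / (qpoch_inf q q * qpoch_inf (q\<^sup>2) (q\<^sup>2))"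
    if "norm q < 1" for q
  proof -
    have q2: "norm (q\<^sup>2) < 1" using that by (simp add: norm_power power_less_one_iff)
    have "qpoch_inf q q * qpoch_inf (q\<^sup>2) (q\<^sup>2) \<noteq> 0"
      using qpoch_inf_nonzero[OF that] qpoch_inf_nonzero[OF q2] by (metis mult_eq_0_iff)
    thus ?thesis unfolding G_def
      by (intro tendsto_divide tendsto_mult tendsto_const qpoch_inf_LIMSEQ that q2)
  qed
  have G_sums: "(\<lambda>n. of_nat (cubic_partitions_upto N n) * q ^ n) sums G N q" if "norm q < 1" for N q
    unfolding G_def by (rule cubic_partitions_upto_sums[OF that])
  have le: "cubic_partitions_upto N n \<le> f n" for N n
    using cubic_partitions_upto_mono[of N "max N n" n] cubic_partitions_upto_stable[of n "max N n"]
    by (simp add: f_def)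
  define r where "r = norm q"
  have r: "0 \<le> r" "r < 1" using q by (auto simp: r_def)
  have "Bseq (\<lambda>N. G N (of_real r))"
    using G_lim[of "of_real r"] r by (intro convergent_imp_Bseq) (auto simp: convergent_def)
  then obtain K where K: "\<And>N. norm (G N (of_real r)) \<le> K"
    unfolding Bseq_def by blast
  have summ: "summable (\<lambda>n. real (f n) * r ^ n)"
  proof (rule summableI_nonneg_bounded)
    fix M
    have eq: "G M (of_real r) = of_real (\<Sum>n. real (cubic_partitions_upto M n) * r ^ n)"
      and s: "summable (\<lambda>n. real (cubic_partitions_upto M n) * r ^ n)"
    proof -
      have *: "(\<lambda>n. complex_of_real (real (cubic_partitions_upto M n) * r ^ n)) sums G M (of_real r)"
        using G_sums[of "of_real r" M] r by simp
      thus s: "summable (\<lambda>n. real (cubic_partitions_upto M n) * r ^ n)"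
        by (metis sums_summable summable_complex_of_real)
      show "G M (of_real r) = of_real (\<Sum>n. real (cubic_partitions_upto M n) * r ^ n)"
        using * sums_of_real[OF summable_sums[OF s], where ?'a = complex] sums_unique2 by blast
    qed
    have "(\<Sum>n<M. real (f n) * r ^ n) = (\<Sum>n<M. real (cubic_partitions_upto M n) * r ^ n)"
      unfolding f_def
      by (intro sum.cong refl) (metis cubic_partitions_upto_stable lessThan_iff less_imp_le)
    also have "\<dots> \<le> (\<Sum>n. real (cubic_partitions_upto M n) * r ^ n)"
      by (intro sum_le_suminf s) (use r in auto)
    also have "\<dots> \<le> norm (G M (of_real r))" unfolding eq by simp
    also have "\<dots> \<le> K" by (rule K)
    finally show "(\<Sum>n<M. real (f n) * r ^ n) \<le> K" .
  qed (use r in auto)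
  have summ': "summable (\<lambda>n. of_nat (f n) * q ^ n)"
    by (rule summable_norm_cancel) (use summ in \<open>simp add: norm_mult norm_power r_def\<close>)
  have "(\<lambda>N. \<Sum>n. of_nat (cubic_partitions_upto N n) * q ^ n) \<longlonglongrightarrow> (\<Sum>n. of_nat (f n) * q ^ n)"
  proof (rule tannerys_theorem[THEN conjunct2, THEN conjunct2])
    fix n
    have "eventually (\<lambda>N. of_nat (cubic_partitions_upto N n) * q ^ n = of_nat (f n) * q ^ n) sequentially"
      using eventually_ge_at_top[of n]
      by eventually_elim (metis f_def cubic_partitions_upto_stable)
    thus "(\<lambda>N. of_nat (cubic_partitions_upto N n) * q ^ n) \<longlonglongrightarrow> of_nat (f n) * q ^ n"
      by (rule tendsto_eventually)
  next
    show "summable (\<lambda>n. real (f n) * r ^ n)" by (rule summ)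
  next
    have "norm (of_nat (cubic_partitions_upto N n) * q ^ n) \<le> real (f n) * r ^ n" for n N
      using le[of N n] r by (simp add: norm_mult norm_power r_def mult_right_mono)
    thus "\<forall>\<^sub>F (n, N) in at_top \<times>\<^sub>F sequentially.
            norm (of_nat (cubic_partitions_upto N n) * q ^ n) \<le> real (f n) * r ^ n"
      by (auto simp: case_prod_unfold)
  qed auto
  moreover have "(\<Sum>n. of_nat (cubic_partitions_upto N n) * q ^ n) = G N q" for N
    using G_sums[OF q] by (simp add: sums_iff)
  ultimately have "(\<Sum>n. of_nat (f n) * q ^ n) = 1 / (qpoch_inf q q * qpoch_inf (q\<^sup>2) (q\<^sup>2))"
    using G_lim[OF q] LIMSEQ_unique by auto
  with summ' show "(\<lambda>n. of_nat (cubic_partitions_upto n n) * q ^ n) sums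
                     (1 / (qpoch_inf q q * qpoch_inf (q\<^sup>2) (q\<^sup>2)))"
    by (simp add: sums_iff f_def)
qed

lemma is_cubic_partition_seq_unique:
  assumes "is_cubic_partition_seq f" "is_cubic_partition_seq g"
  shows "f = g"
proof -
  define H where "H = (\<lambda>q::complex. 1 / (qpoch_inf q q * qpoch_inf (q\<^sup>2) (q\<^sup>2)))"
  have *: "H has_fps_expansion Abs_fps (\<lambda>n. of_nat (p n))" if "is_cubic_partition_seq p" for p
  proof (rule has_fps_expansionI)
    have "eventually (\<lambda>q. q \<in> ball (0::complex) 1) (nhds 0)"
      by (intro eventually_nhds_in_open) auto
    thus "\<forall>\<^sub>F q in nhds 0. (\<lambda>n. fps_nth (Abs_fps (\<lambda>n. of_nat (p n))) n * q ^ n) sums H q"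
      by eventually_elim (use that in \<open>auto simp: is_cubic_partition_seq_def H_def\<close>)
  qed
  show ?thesis
    using fps_expansion_unique_complex[OF *[OF assms(1)] *[OF assms(2)]]
    by (auto simp: fps_eq_iff)
qed

theorem ex1_cubic_partition_seq: "\<exists>!p. is_cubic_partition_seq p"
  using is_cubic_partition_seq_upto is_cubic_partition_seq_unique by blast

theorem cubic_partitions_sums:
  fixes q :: complex
  assumes "norm q < 1"
  shows "(\<lambda>n. of_nat (cubic_partitions n) * q ^ n) sums
           (1 / (qpoch_inf q q * qpoch_inf (q\<^sup>2) (q\<^sup>2)))"
  using theI'[OF ex1_cubic_partition_seq] assms
  unfolding cubic_partitions_def is_cubic_partition_seq_def by blast

end

theory Submission
  imports Defs
begin

text \<open>
Write \<open>E\<^sub>k = (q\<^sup>k; q\<^sup>k)\<^sub>\<infinity>\<close>, so that the generating function of the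
cubic partitions is \<open>C = 1 / (E\<^sub>1 E\<^sub>2)\<close>. In terms of Gauss's theta series \<open>\<phi>(-q) =
E\<^sub>1\<^sup>2 / E\<^sub>2\<close> and \<open>\<psi>(q) = E\<^sub>2\<^sup>2 / E\<^sub>1\<close> this reads \<open>C
= 1 / (\<phi>(-q) \<psi>(q))\<close>. The congruence is a statement about \<open>297 = 11 \<cdot> 27\<close>, and the
two factors are treated one after the other.

The prime 11. Put \<open>H = 9 F + 4 G\<close> with \<open>F = \<phi>(-q)\<^sup>1\<^sup>3 \<psi>(q)\<^sup>5\<close>
and \<open>G = q \<phi>(-q)\<^sup>5 \<psi>(q)\<^sup>1\<^sup>3\<close>; up to a power of \<open>q\<close> these are
modular forms of weight 9. The claim is that \<open>p\<^sub>2(11 j + 7)\<close> is congruent to the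
\<open>j\<close>-th coefficient of \<open>H\<close>. With \<open>\<theta> = q d/dq\<close> and \<open>f = q\<^sup>4
C\<close>, Fermat's theorem shows that modulo 11 the series \<open>f - \<theta>\<^sup>1\<^sup>0 f\<close> retains
exactly the exponents of \<open>f\<close> that are divisible by 11, so it has to be compared with
\<open>q\<^sup>1\<^sup>1 H(q\<^sup>1\<^sup>1)\<close>, which is \<open>q\<^sup>1\<^sup>1 H(q)\<^sup>1\<^sup>1\<close>
modulo 11. All derivatives of \<open>f\<close> lie in \<open>f\<close> times the ring generated by two modular forms
of level 2, \<open>A\<close> of weight 2 and \<open>Q = q \<psi>(q)\<^sup>8\<close> of weight 4, and by the
quasimodular logarithmic derivative \<open>\<alpha>\<close> of \<open>\<phi>(-q)\<close>. Modulo 11 there are two more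
relations: a form \<open>E\<close> of weight 10 is congruent to 1, and \<open>\<alpha>\<close> is congruent to a form
of weight 12. Hence both sides of the comparison are \<open>f\<close> times a form of weight 120, that is, times a
linear combination of the 31 monomials \<open>A\<^sup>6\<^sup>0\<^sup>-\<^sup>2\<^sup>i Q\<^sup>i = q\<^sup>i +
\<dots>\<close>. Such a form is determined by its first 31 coefficients, and the comparison reduces to the values of
\<open>p\<^sub>2\<close> at 7, 18 and 29 (\<open>projection_shifted_gf\<close>).

The prime 3. The operator that extracts the exponents congruent to 2 modulo 3 sends \<open>F\<close> and
\<open>G\<close> to a multiple of a single series \<open>B = (\<phi>(-q) \<psi>(q))\<^sup>7 A\<close>, up to the term
\<open>- 3\<^sup>8 q F(q\<^sup>3)\<close> or \<open>- 3\<^sup>8 q G(q\<^sup>3)\<close>, and the extraction of the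
residue 1 sends \<open>B\<close> back to a combination of \<open>F\<close> and \<open>G\<close> up to \<open>-
3\<^sup>8 q\<^sup>2 B(q\<^sup>3)\<close>; these are exact identities and express the action of the Hecke operator
\<open>T\<^sub>3\<close>. For the particular combination \<open>H\<close> the composition of both extractions is
\<open>11 (\<dots>) - c q\<^sup>2 B(q\<^sup>3)\<close> (\<open>hecke_mod_11\<close>), so the coefficient of
\<open>H\<close> at \<open>9 i + 5\<close> is divisible by 11 unless \<open>i \<equiv> 2 (mod 3)\<close>. The
arguments \<open>297 n + 62\<close> and \<open>297 n + 161\<close> are \<open>11 (9 i + 5) + 7\<close> with \<open>i =
3 n\<close> and \<open>i = 3 n + 1\<close>.

The tools are elementary identities of formal power series. Jacobi's triple product identifies the theta series with
products. The differential equations of \<open>\<alpha>\<close>, \<open>A\<close>, \<open>Q\<close> follow from the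
behaviour of \<open>\<phi>\<close> under \<open>q \<mapsto> q\<^sup>2\<close> (the arithmetic-geometric mean): a
series that is \<open>m\<close> times its image under \<open>q \<mapsto> q\<^sup>2\<close> is constant, and it is zero
if \<open>m \<noteq> 1\<close>. The cubic modular equations needed for the prime 3 follow by the same kind of descent
along \<open>q \<mapsto> q\<^sup>3\<close>. The congruence \<open>E \<equiv> 1\<close> comes from Bol's identity: the
eleventh derivative of a form of weight \<open>-10\<close> is a form of weight 12, while modulo 11 the eleventh
derivative is the first one.
\<close>

unbundle no vec_syntax
unbundle fps_syntax

section \<open>Dilation and truncated equality of power series\<close>

text \<open>
The substitution \<open>q \<mapsto> q\<^sup>k\<close>.
\<close>

definition fps_dilate :: "nat \<Rightarrow> 'a::comm_ring_1 fps \<Rightarrow> 'a fps" where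
  "fps_dilate k f = Abs_fps (\<lambda>n. if k dvd n then f $ (n div k) else 0)"

lemma fps_dilate_nth: "fps_dilate k f $ n = (if k dvd n then f $ (n div k) else 0)"
  by (simp add: fps_dilate_def)

lemma fps_dilate_nth_0 [simp]: "fps_dilate k f $ 0 = f $ 0"
  by (simp add: fps_dilate_nth)

lemma fps_dilate_add [simp]: "fps_dilate k (f + g) = fps_dilate k f + fps_dilate k g"
  by (simp add: fps_eq_iff fps_dilate_nth)

lemma fps_dilate_diff [simp]: "fps_dilate k (f - g) = fps_dilate k f - fps_dilate k g"
  by (simp add: fps_eq_iff fps_dilate_nth)

lemma fps_dilate_const [simp]: "k > 0 \<Longrightarrow> fps_dilate k (fps_const c) = fps_const c"
  by (auto simp add: fps_eq_iff fps_dilate_nth dvd_def)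

lemma fps_dilate_1 [simp]: "k > 0 \<Longrightarrow> fps_dilate k 1 = 1"
  using fps_dilate_const[of k 1] by simp

lemma fps_dilate_numeral [simp]: "k > 0 \<Longrightarrow> fps_dilate k (numeral m) = numeral m"
  using fps_dilate_const[of k "numeral m"] by (simp add: numeral_fps_const)

lemma fps_dilate_X [simp]: "k > 0 \<Longrightarrow> fps_dilate k fps_X = fps_X ^ k"
  by (auto simp add: fps_eq_iff fps_dilate_nth dvd_def)

lemma fps_dilate_mult [simp]:
  assumes "k > 0"
  shows "fps_dilate k (f * g) = fps_dilate k f * fps_dilate k g"
proof (rule fps_ext)
  fix n
  have *: "(fps_dilate k f * fps_dilate k g) $ n =
        (\<Sum>i\<in>{i. i \<le> n \<and> k dvd i \<and> k dvd n}. f $ (i div k) * g $ ((n - i) div k))"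
    unfolding fps_mult_nth
    by (rule sum.mono_neutral_cong_right) (auto simp: fps_dilate_nth dvd_diff_nat dest: dvd_diffD)
  show "fps_dilate k (f * g) $ n = (fps_dilate k f * fps_dilate k g) $ n"
  proof (cases "k dvd n")
    case True
    then obtain m where m: "n = k * m" by auto
    show ?thesis unfolding * using assms m
      by (auto simp: fps_dilate_nth fps_mult_nth simp flip: right_diff_distrib'
               intro!: sum.reindex_bij_witness[of _ "\<lambda>i. i div k" "\<lambda>i. k * i"])
  next
    case False
    then show ?thesis unfolding * by (simp add: fps_dilate_nth)
  qed
qed

lemma fps_dilate_power [simp]: "k > 0 \<Longrightarrow> fps_dilate k (f ^ n) = fps_dilate k f ^ n"
  by (induction n) auto

lemma fps_dilate_dilate: 
  assumes "k > 0" "l > 0"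
  shows "fps_dilate k (fps_dilate l f) = fps_dilate (k * l) f"
proof (rule fps_ext)
  fix n
  have "k * l dvd n" if "k dvd n" "l dvd n div k" using that assms
    by (metis dvd_mult_div_cancel mult_dvd_mono dvd_refl)
  moreover have "k dvd n" "l dvd n div k" if "k * l dvd n" using that assms by auto
  ultimately show "fps_dilate k (fps_dilate l f) $ n = fps_dilate (k * l) f $ n"
    by (auto simp: fps_dilate_nth div_mult2_eq)
qed

text \<open>
Equality up to and including the term of degree \<open>N\<close>. All limits of products and sums below are taken in
this sense, which avoids any topology on power series.
\<close>

definition agree :: "nat \<Rightarrow> 'a::comm_ring_1 fps \<Rightarrow> 'a fps \<Rightarrow> bool" where
  "agree N f g \<longleftrightarrow> (\<forall>n\<le>N. f $ n = g $ n)"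

lemma agree_refl [simp]: "agree N f f" by (simp add: agree_def)
lemma agree_sym: "agree N f g \<Longrightarrow> agree N g f" by (simp add: agree_def)
lemma agree_trans [trans]: "agree N f g \<Longrightarrow> agree N g h \<Longrightarrow> agree N f h" by (simp add: agree_def)
lemma agree_eq [trans]: "agree N f g \<Longrightarrow> g = h \<Longrightarrow> agree N f h" by simp
lemma eq_agree [trans]: "f = g \<Longrightarrow> agree N g h \<Longrightarrow> agree N f h" by simp
lemma agree_mono: "agree N f g \<Longrightarrow> M \<le> N \<Longrightarrow> agree M f g" by (simp add: agree_def)
lemma agree_all: "(\<And>N. agree N f g) \<Longrightarrow> f = g" by (auto simp: agree_def fps_eq_iff)
lemma agree_mult: "agree N f g \<Longrightarrow> agree N f' g' \<Longrightarrow> agree N (f * f') (g * g')"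
  by (auto simp: agree_def fps_mult_nth intro!: sum.cong)
lemma agree_add: "agree N f g \<Longrightarrow> agree N f' g' \<Longrightarrow> agree N (f + f') (g + g')"
  by (auto simp: agree_def)
lemma agree_prod: "(\<And>i. i \<in> S \<Longrightarrow> agree N (f i) (g i)) \<Longrightarrow> agree N (prod f S)
        (prod g S)"
  by (induction S rule: infinite_finite_induct) (auto intro: agree_mult)
lemma agree_sum: "(\<And>i. i \<in> S \<Longrightarrow> agree N (f i) (g i)) \<Longrightarrow> agree N (sum f S) (sum g S)"
  by (induction S rule: infinite_finite_induct) (auto intro: agree_add)

lemma agree_X_mult:
  assumes "agree N f g"
  shows "agree (N + m) (fps_X ^ m * f) (fps_X ^ m * g)"
  using assms by (auto simp: agree_def fps_X_power_mult_nth)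

text \<open>
Over the integers and over the residues modulo 11 no division is available on coefficients, but series with constant
term 1 can be inverted and hence cancelled.
\<close>

lemma fps_ex_inverse:
  fixes f :: "'a::comm_ring_1 fps"
  assumes "f $ 0 = 1"
  shows "\<exists>g. f * g = 1 \<and> g $ 0 = 1"
proof -
  have *: "f * fps_right_inverse f 1 = 1" by (rule fps_right_inverse) (use assms in simp)
  show ?thesis using * by (intro exI[of _ "fps_right_inverse f 1"]) simp
qed

lemma agree_cancel:
  assumes "agree N (f * h) (g * h)" "h $ 0 = 1"
  shows "agree N f g"
proof -
  obtain k where k: "h * k = 1" using fps_ex_inverse assms(2) by blast
  have "agree N (f * h * k) (g * h * k)" by (rule agree_mult[OF assms(1) agree_refl])
  moreover have "f * h * k = f" "g * h * k = g" using k by (simp_all add: mult.assoc)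
  ultimately show ?thesis by simp
qed

section \<open>Infinite products\<close>

text \<open>
The product \<open>\<Prod>\<^bsub>i \<in> S, i > 0\<^esub> (1 + e q\<^sup>i)\<close>: factors with \<open>i >
n\<close> do not influence the coefficient of \<open>q\<^sup>n\<close>, so that coefficient is read off a finite
product.
\<close>

definition qprod :: "int \<Rightarrow> nat set \<Rightarrow> int fps" where
  "qprod e S = Abs_fps (\<lambda>n. (\<Prod>i\<in>S \<inter> {1..n}. 1 + fps_const e * fps_X ^ i) $ n)"

lemma agree_factor:
  assumes "N < i"
  shows "agree N (1 + fps_const e * fps_X ^ i) 1"
  using assms by (auto simp: agree_def)

lemma agree_qprod:
  assumes "M \<ge> N"
  shows "agree N (qprod e S) (\<Prod>i\<in>S \<inter> {1..M}. 1 + fps_const e * fps_X ^ i)"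
  unfolding agree_def
proof (intro allI impI)
  fix n assume n: "n \<le> N"
  have "S \<inter> {1..M} = (S \<inter> {1..n}) \<union> (S \<inter> {n<..M})" using n assms by auto
  hence "(\<Prod>i\<in>S \<inter> {1..M}. 1 + fps_const e * fps_X ^ i) =
    (\<Prod>i\<in>S \<inter> {1..n}. 1 + fps_const e * fps_X ^ i) * (\<Prod>i\<in>S \<inter> {n<..M}. 1 + fps_const e
        * fps_X ^ i)"
    by (simp only:) (subst prod.union_disjoint; auto)
  moreover have "agree n (\<Prod>i\<in>S \<inter> {n<..M}. 1 + fps_const e * fps_X ^ i) (\<Prod>i\<in>S \<inter> {n<..M}. 1)"
    by (intro agree_prod agree_factor) auto
  ultimately have "agree n (\<Prod>i\<in>S \<inter> {1..M}. 1 + fps_const e * fps_X ^ i)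
      ((\<Prod>i\<in>S \<inter> {1..n}. 1 + fps_const e * fps_X ^ i) * 1)"
    by (simp only: prod.neutral_const) (intro agree_mult agree_refl)
  thus "qprod e S $ n = (\<Prod>i\<in>S \<inter> {1..M}. 1 + fps_const e * fps_X ^ i) $ n"
    by (simp add: agree_def qprod_def)
qed

lemma qprod_nth_0 [simp]: "qprod e S $ 0 = 1"
  by (simp add: qprod_def)

lemma qprod_Un:
  assumes "S \<inter> T = {}"
  shows "qprod e (S \<union> T) = qprod e S * qprod e T"
proof (rule agree_all)
  fix N
  have "(S \<union> T) \<inter> {1..N} = (S \<inter> {1..N}) \<union> (T \<inter> {1..N})" by auto
  hence *: "(\<Prod>i\<in>(S \<union> T) \<inter> {1..N}. 1 + fps_const e * fps_X ^ i) =
    (\<Prod>i\<in>S \<inter> {1..N}. 1 + fps_const e * fps_X ^ i) * (\<Prod>i\<in>T \<inter> {1..N}. 1 + fps_const e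
        * fps_X ^ i)"
    using assms by (simp only:) (subst prod.union_disjoint; auto)
  have "agree N (qprod e (S \<union> T)) (\<Prod>i\<in>(S \<union> T) \<inter> {1..N}. 1 + fps_const e * fps_X ^ i)"
    by (rule agree_qprod) simp
  also note *
  also have "agree N ((\<Prod>i\<in>S \<inter> {1..N}. 1 + fps_const e * fps_X ^ i) * (\<Prod>i\<in>T \<inter>
        {1..N}. 1 + fps_const e * fps_X ^ i))
     (qprod e S * qprod e T)"
    by (intro agree_mult agree_sym[OF agree_qprod]) auto
  finally show "agree N (qprod e (S \<union> T)) (qprod e S * qprod e T)" .
qed

lemma qprod_dilate:
  assumes "k > 0"
  shows "fps_dilate k (qprod e S) = qprod e ((\<lambda>i. k * i) ` S)"
proof (rule agree_all)
  fix N
  have "agree (k * N) (fps_dilate k (qprod e S)) (fps_dilate k (\<Prod>i\<in>S \<inter> {1..N}. 1 + fps_const e *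
        fps_X ^ i))"
    using agree_qprod[of N N e S] assms
    by (auto simp: agree_def fps_dilate_nth less_eq_div_iff_mult_less_eq elim!: dvdE)
  also have "fps_dilate k (\<Prod>i\<in>S \<inter> {1..N}. 1 + fps_const e * fps_X ^ i)
     = (\<Prod>i\<in>S \<inter> {1..N}. 1 + fps_const e * fps_X ^ (k * i))" (is "?L = _")
  proof -
    have "fps_dilate k (prod f A) = prod (\<lambda>i. fps_dilate k (f i)) A" for f :: "nat \<Rightarrow> int fps" and A
      using assms by (induction A rule: infinite_finite_induct) auto
    thus ?thesis using assms by (simp add: power_mult)
  qed
  also have "\<dots> = (\<Prod>i\<in>(\<lambda>i. k * i) ` S \<inter> {1..k * N}. 1 + fps_const e * fps_X ^ i)"
    using assms
    by (intro prod.reindex_bij_witness[of _ "\<lambda>i. i div k" "\<lambda>i. k * i"]) auto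
  also have "agree (k * N) \<dots> (qprod e ((\<lambda>i. k * i) ` S))"
    by (rule agree_sym[OF agree_qprod]) simp
  finally show "agree N (fps_dilate k (qprod e S)) (qprod e ((\<lambda>i. k * i) ` S))"
    by (rule agree_mono) (use assms in simp)
qed

text \<open>
Difference of squares in every factor.
\<close>

lemma qprod_minus_plus:
  "qprod (-1) S * qprod 1 S = qprod (-1) ((\<lambda>i. 2 * i) ` S)"
proof (rule agree_all)
  fix N
  have "agree N (qprod (-1) S * qprod 1 S)
     ((\<Prod>i\<in>S \<inter> {1..N}. 1 + fps_const (-1) * fps_X ^ i) * (\<Prod>i\<in>S \<inter> {1..N}. 1 +
        fps_const 1 * fps_X ^ i))"
    by (intro agree_mult agree_qprod) auto
  also have "\<dots> = (\<Prod>i\<in>S \<inter> {1..N}. 1 + fps_const (-1) * fps_X ^ (2 * i))"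
    unfolding prod.distrib [symmetric]
  proof (intro prod.cong refl)
    fix i
    have "fps_X ^ (2 * i) = (fps_X ^ i * fps_X ^ i :: int fps)" by (simp add: mult_2 power_add)
    thus "(1 + fps_const (-1) * fps_X ^ i) * (1 + fps_const 1 * fps_X ^ i) =
          1 + fps_const (- 1) * (fps_X ^ (2 * i) :: int fps)"
      by (simp add: algebra_simps flip: fps_const_neg)
  qed
  also have "\<dots> = (\<Prod>i\<in>(\<lambda>i. 2 * i) ` S \<inter> {1..2 * N}. 1 + fps_const (-1) * fps_X ^ i)"
    by (intro prod.reindex_bij_witness[of _ "\<lambda>i. i div 2" "\<lambda>i. 2 * i"]) auto
  also have "agree N \<dots> (qprod (-1) ((\<lambda>i. 2 * i) ` S))"
    by (rule agree_sym[OF agree_qprod]) simp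
  finally show "agree N (qprod (-1) S * qprod 1 S) (qprod (-1) ((\<lambda>i. 2 * i) ` S))" .
qed

section \<open>Series indexed by the integers\<close>

text \<open>
The series \<open>\<Sum>\<^bsub>j \<in> \<int>\<^esub> s(j) q\<^bsup>e(j)\<^esup>\<close>. Splitting the index by
residue classes is the source of all dissections below. The definition gives this series only if \<open>e\<close> is
nonnegative and takes every value finitely often.
\<close>

definition int_series :: "(int \<Rightarrow> int) \<Rightarrow> (int \<Rightarrow> int) \<Rightarrow> int fps" where
  "int_series e s = Abs_fps (\<lambda>n. \<Sum>j | e j = int n. s j)"

lemma int_series_split:
  assumes "m > 0" "finite R" "\<And>j. \<exists>!r. r \<in> R \<and> m dvd j - r"
  assumes fin: "\<And>n. finite {j. e j = int n}"
  shows "int_series e s = (\<Sum>r\<in>R. int_series (\<lambda>i. e (m * i + r)) (\<lambda>i. s (m * i + r)))"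
proof (rule fps_ext)
  fix n
  define A where "A = (\<lambda>r. {i. e (m * i + r) = int n})"
  have finA: "finite (A r)" for r
  proof -
    have "inj (\<lambda>i. m * i + r)" using assms(1) by (auto simp: inj_def)
    hence "finite ((\<lambda>i. m * i + r) -` {j. e j = int n})" by (intro finite_vimageI fin)
    thus ?thesis by (simp add: A_def vimage_def)
  qed
  define rr where "rr = (\<lambda>j. THE r. r \<in> R \<and> m dvd j - r)"
  have rr: "rr j \<in> R \<and> m dvd j - rr j" for j
    unfolding rr_def by (rule theI') (rule assms(3))
  have rr_eq: "rr (m * i + r) = r" if "r \<in> R" for i r
    using assms(3)[of "m * i + r"] rr[of "m * i + r"] that by auto
  have "(\<Sum>r\<in>R. int_series (\<lambda>i. e (m * i + r)) (\<lambda>i. s (m * i + r))) $ n =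
        (\<Sum>r\<in>R. \<Sum>i\<in>A r. s (m * i + r))"
    by (simp add: fps_sum_nth int_series_def A_def)
  also have "\<dots> = (\<Sum>(r, i)\<in>Sigma R A. s (m * i + r))"
    by (rule sum.Sigma) (use assms finA in auto)
  also have "\<dots> = (\<Sum>j | e j = int n. s j)"
  proof (rule sum.reindex_bij_witness[of _ "\<lambda>j. (rr j, (j - rr j) div m)" "\<lambda>(r, i). m * i + r"])
    fix j assume j: "j \<in> {j. e j = int n}"
    have eq: "m * ((j - rr j) div m) + rr j = j" using rr[of j] by simp
    show "(case (rr j, (j - rr j) div m) of (r, i) \<Rightarrow> m * i + r) = j" using eq by simp
    show "(rr j, (j - rr j) div m) \<in> Sigma R A" using eq rr[of j] j by (simp add: A_def)
  qed (use assms(1) in \<open>auto simp: A_def rr_eq\<close>)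
  finally show "int_series e s $ n =
    (\<Sum>r\<in>R. int_series (\<lambda>i. e (m * i + r)) (\<lambda>i. s (m * i + r))) $ n" by (simp add: int_series_def)
qed

lemma int_series_shift_dilate:
  assumes "k > 0" "\<And>i. e i \<ge> 0"
  shows "int_series (\<lambda>i. int c + int k * e i) s = fps_X ^ c * fps_dilate k (int_series e s)"
proof (rule fps_ext)
  fix n
  have "{j. int c + int k * e j = int n} = 
     (if c \<le> n \<and> k dvd n - c then {j. e j = int ((n - c) div k)} else {})"
  proof -
    have "c \<le> n \<and> k dvd n - c \<and> e j = int ((n - c) div k)" if "int c + int k * e j = int n" for j
    proof -
      obtain t where t: "e j = int t" using assms(2)[of j] zero_le_imp_eq_int by blast
      have "int (c + k * t) = int n" using that t by simp
      hence "n = c + k * t" by linarith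
      thus ?thesis using t assms(1) by simp
    qed
    moreover have "int c + int k * e j = int n"
      if "c \<le> n" "k dvd n - c" "e j = int ((n - c) div k)" for j
    proof -
      have "n = c + k * ((n - c) div k)" using that by simp
      thus ?thesis using that(3) by (metis of_nat_add of_nat_mult)
    qed
    ultimately show ?thesis by auto
  qed
  thus "int_series (\<lambda>i. int c + int k * e i) s $ n = (fps_X ^ c * fps_dilate k (int_series e s)) $ n"
    by (auto simp: int_series_def fps_X_power_mult_nth fps_dilate_nth)
qed

lemma int_series_reflect: "int_series (\<lambda>i. e (- i)) (\<lambda>i. s (- i)) = int_series e s"
  unfolding int_series_def
  by (intro arg_cong[of _ _ Abs_fps] ext sum.reindex_bij_witness[of _ uminus uminus]) auto

section \<open>The q-binomial theorem and its finite triple product\<close>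

text \<open>
Gaussian binomial coefficients, by the Pascal rule that matches multiplication by the last factor \<open>u + v
q\<^sup>n\<close> in the \<open>q\<close>-binomial theorem.
\<close>

fun qbinom :: "'a::comm_ring_1 \<Rightarrow> nat \<Rightarrow> nat \<Rightarrow> 'a" where
  "qbinom q n 0 = 1"
| "qbinom q 0 (Suc m) = 0"
| "qbinom q (Suc n) (Suc m) = qbinom q n (Suc m) + q ^ (n - m) * qbinom q n m"

lemma qbinom_eq_0: "n < m \<Longrightarrow> qbinom q n m = 0"
  by (induction q n m rule: qbinom.induct) auto

text \<open>
The exponents \<open>m (m - 1) / 2\<close> of the \<open>q\<close>-binomial theorem are written with natural number
division; this is the step from \<open>m\<close> to \<open>m + 1\<close>.
\<close>

lemma triangle_Suc: "Suc m * m div 2 = m * (m - 1) div 2 + (m::nat)"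
  by (cases m) (auto simp: algebra_simps)

lemma q_binomial_theorem:
  fixes q u v :: "'a::comm_ring_1"
  shows "(\<Prod>i<n. u + v * q ^ i) =
         (\<Sum>m\<le>n. q ^ (m * (m - 1) div 2) * qbinom q n m * v ^ m * u ^ (n - m))"
proof (induction n)
  case (Suc n)
  define T where "T = (\<lambda>m. q ^ (m * (m - 1) div 2) * qbinom q n m * v ^ m * u ^ (n - m))"
  have "(\<Sum>m\<le>Suc n. q ^ (m * (m - 1) div 2) * qbinom q (Suc n) m * v ^ m * u ^ (Suc n - m)) =
    u ^ Suc n + (\<Sum>m\<le>n. q ^ (Suc m * m div 2) * qbinom q (Suc n) (Suc m) * v ^ Suc m * u ^ (n - m))"
    by (subst sum.atMost_Suc_shift) simp
  also have "(\<Sum>m\<le>n. q ^ (Suc m * m div 2) * qbinom q (Suc n) (Suc m) * v ^ Suc m * u ^ (n - m)) =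
    (\<Sum>m\<le>n. q ^ (Suc m * m div 2) * qbinom q n (Suc m) * v ^ Suc m * u ^ (n - m)) +
    (\<Sum>m\<le>n. v * q ^ n * T m)"
    unfolding sum.distrib [symmetric]
  proof (intro sum.cong refl)
    fix m assume "m \<in> {..n}"
    hence "m * (m - 1) div 2 + m + (n - m) = n + m * (m - 1) div 2" by simp
    hence "q ^ (m * (m - 1) div 2) * q ^ m * q ^ (n - m) = q ^ n * q ^ (m * (m - 1) div 2)"
      by (metis power_add)
    hence "q ^ (Suc m * m div 2) * q ^ (n - m) = q ^ n * q ^ (m * (m - 1) div 2)"
      unfolding triangle_Suc power_add .
    hence "v * q ^ n * T m =
        (q ^ (Suc m * m div 2) * q ^ (n - m)) * qbinom q n m * v ^ Suc m * u ^ (n - m)"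
      by (simp add: T_def mult_ac)
    thus "q ^ (Suc m * m div 2) * qbinom q (Suc n) (Suc m) * v ^ Suc m * u ^ (n - m) =
       q ^ (Suc m * m div 2) * qbinom q n (Suc m) * v ^ Suc m * u ^ (n - m) + v * q ^ n * T m"
      by (simp add: distrib_left distrib_right mult_ac)
  qed
  also have "u ^ Suc n + ((\<Sum>m\<le>n. q ^ (Suc m * m div 2) * qbinom q n (Suc m) * v ^ Suc m * u ^ (n - m)) +
    (\<Sum>m\<le>n. v * q ^ n * T m)) = u * (\<Sum>m\<le>n. T m) + v * q ^ n * (\<Sum>m\<le>n. T m)"
  proof -
    have "u * (\<Sum>m\<le>n. T m) = (\<Sum>m\<le>Suc n. q ^ (m * (m - 1) div 2) * qbinom q n m * v ^ m * u ^ (Suc n - m))"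
      unfolding T_def sum_distrib_left
      by (simp add: qbinom_eq_0 Suc_diff_le mult_ac)
    also have "\<dots> = u ^ Suc n + (\<Sum>m\<le>n. q ^ (Suc m * m div 2) * qbinom q n (Suc m) * v ^ Suc m * u ^ (n - m))"
      by (subst sum.atMost_Suc_shift) simp
    finally show ?thesis by (simp add: sum_distrib_left)
  qed
  also have "\<dots> = (\<Prod>i<Suc n. u + v * q ^ i)"
    using Suc by (simp add: T_def algebra_simps)
  finally show ?case ..
qed auto

text \<open>
The quotient formula for Gaussian binomials, multiplied out so that it makes sense in every commutative ring.
\<close>

lemma qbinom_qfact:
  fixes q :: "'a::comm_ring_1"
  assumes "m \<le> n"
  shows "qbinom q n m * (\<Prod>i=1..m. 1 - q ^ i) * (\<Prod>i=1..n-m. 1 - q ^ i) = (\<Prod>i=1..n. 1 - q ^ i)"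
  using assms
proof (induction n arbitrary: m)
  case (Suc n)
  define P where "P = (\<lambda>m. \<Prod>i=1..m. 1 - q ^ i)"
  have P_Suc: "P (Suc m) = P m * (1 - q ^ Suc m)" for m by (simp add: P_def)
  have IH: "qbinom q n m * P m * P (n - m) = P n" if "m \<le> n" for m
    using Suc.IH[OF that] by (simp add: P_def)
  show ?case
  proof (cases m)
    case (Suc l)
    show ?thesis
    proof (cases "l = n")
      case True
      thus ?thesis using IH[of n] Suc by (simp add: P_def qbinom_eq_0 flip: mult.assoc)
    next
      case False
      hence l: "l < n" using Suc Suc.prems by simp
      then obtain d where d: "n = l + Suc d" using less_imp_Suc_add by auto
      have 1: "qbinom q n (Suc l) * P (Suc l) * P d = P n" using IH[of "Suc l"] l d by simp
      have 2: "qbinom q n l * P l * P (Suc d) = P n" using IH[of l] l d by simp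
      have q: "q ^ Suc n = q ^ Suc l * q ^ Suc d" 
      proof -
        have "Suc n = Suc l + Suc d" using d by simp
        thus ?thesis by (metis power_add)
      qed
      have "qbinom q (Suc n) (Suc l) * P (Suc l) * P (Suc d) =
        qbinom q n (Suc l) * P (Suc l) * P d * (1 - q ^ Suc d) +
        q ^ Suc d * (qbinom q n l * P l * P (Suc d) * (1 - q ^ Suc l))"
        using d by (simp add: P_Suc algebra_simps)
      also have "\<dots> = P (Suc n)" unfolding 1 2 by (simp only: P_Suc q) (simp add: algebra_simps)
      finally show ?thesis using Suc d by (simp add: P_def)
    qed
  qed auto
qed auto

text \<open>
The exponents \<open>k j (j - 1) / 2 + r j\<close> of the theta series in Jacobi's triple product. They are at least
\<open>\<bar>j\<bar>\<close> for \<open>0 < r < k\<close>, which makes all sums over \<open>j\<close> finite in each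
degree.
\<close>

definition jexp :: "nat \<Rightarrow> nat \<Rightarrow> int \<Rightarrow> int" where
  "jexp k r j = int k * (j * (j - 1) div 2) + int r * j"

lemma two_jexp: "2 * jexp k r j = int k * (j * (j - 1)) + 2 * int r * j"
proof -
  have "2 * (j * (j - 1) div 2) = j * (j - 1)" by simp
  thus ?thesis unfolding jexp_def by (metis distrib_left mult.assoc mult.left_commute)
qed

lemma jexp_ge:
  assumes "0 < r" "r < k"
  shows "2 * jexp k r j \<ge> 2 * \<bar>j\<bar> + int k * (\<bar>j\<bar> * (\<bar>j\<bar> - 1))"
proof (cases "j \<ge> 0")
  case True
  have "int r * j \<ge> 1 * j" using assms True by (intro mult_right_mono) auto
  thus ?thesis using True by (simp add: two_jexp)
next
  case False
  have "(int k - int r) * (-j) \<ge> 1 * (-j)" using assms False by (intro mult_right_mono) auto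
  thus ?thesis using False by (simp add: two_jexp algebra_simps)
qed

lemma jexp_ge_abs:
  assumes "0 < r" "r < k"
  shows "jexp k r j \<ge> \<bar>j\<bar>"
proof -
  have "\<bar>j\<bar> * (\<bar>j\<bar> - 1) \<ge> 0" by (cases "j = 0") auto
  hence "int k * (\<bar>j\<bar> * (\<bar>j\<bar> - 1)) \<ge> 0" by simp
  thus ?thesis using jexp_ge[OF assms, of j] by linarith
qed

lemma finite_jexp:
  assumes "0 < r" "r < k"
  shows "finite {j. jexp k r j = int n}"
proof (rule finite_subset)
  have "\<bar>j\<bar> \<le> int n" if "jexp k r j = int n" for j
    using jexp_ge_abs[OF assms, of j] that by simp
  thus "{j. jexp k r j = int n} \<subseteq> {- int n..int n}" by (force simp: abs_le_iff)
qed simp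

definition sgn_pow :: "int \<Rightarrow> int \<Rightarrow> int" where
  "sgn_pow e j = e ^ nat \<bar>j\<bar>"

text \<open>
The case \<open>u = q\<^bsup>kN\<^esup>\<close>, \<open>v = e q\<^sup>r\<close> of the \<open>q\<close>-binomial
theorem with \<open>2N\<close> factors in base \<open>q\<^sup>k\<close>. The first \<open>N\<close> factors
\<open>q\<^bsup>kN\<^esup> + e q\<^bsup>r + ki\<^esup>\<close> have the smaller exponent in the second summand;
pulling it out turns them into the factors with exponents \<open>k i - r\<close>. After the common power of
\<open>q\<close> is cancelled, the index \<open>m\<close> on the right corresponds to \<open>j = m - N\<close>.
\<close>

lemma finite_triple_product:
  fixes e :: int
  assumes e: "e * e = 1" and r: "0 < r" "r < k"
  shows "(\<Prod>i<N. 1 + fps_const e * fps_X ^ (k * i + (k - r))) * (\<Prod>i<N. 1 + fps_const e * fps_X ^ (k * i + r))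
    = (\<Sum>m\<le>2*N. fps_const (sgn_pow e (int m - int N)) * fps_X ^ nat (jexp k r (int m - int N))
                   * qbinom (fps_X ^ k) (2 * N) m)"
    (is "?A * ?B = ?S")
proof -
  define X where "X = (fps_X :: int fps)"
  define E where "E = fps_const e"
  have EE: "E * E = 1" using e by (simp add: E_def)
  \<comment> \<open>the power of \<open>q\<close> that both sides of the \<open>q\<close>-binomial theorem have in
        common\<close>
  define M where "M = (\<Sum>i<N. r + k * i) + k * N * N"
  have twoM: "2 * int M = 2 * int r * int N + int k * (int N * (int N - 1)) + 2 * int k * int N * int N"
  proof -
    have "2 * int (\<Sum>i<N. r + k * i) = 2 * int r * int N + int k * (int N * (int N - 1))"
      by (induction N) (auto simp: algebra_simps)
    thus ?thesis by (simp add: M_def algebra_simps)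
  qed
  have "(\<Prod>i<2*N. X ^ (k * N) + (E * X ^ r) * (X ^ k) ^ i) =
        (\<Prod>i<N. X ^ (k * N) + (E * X ^ r) * (X ^ k) ^ i) * (\<Prod>i<N. X ^ (k * N) + (E * X ^ r) * (X ^ k) ^ (N + i))"
    by (simp add: mult_2 prod.lessThan_Suc_shift lessThan_atLeast0 prod.atLeastLessThan_concat[of 0 N "N + N",
        symmetric] prod.atLeastLessThan_shift_0[of _ N])
  also have "(\<Prod>i<N. X ^ (k * N) + (E * X ^ r) * (X ^ k) ^ (N + i)) = (\<Prod>i<N. X ^ (k * N) * (1 + E * X ^ (k
        * i + r)))"
  proof (intro prod.cong refl)
    fix i
    have *: "(X ^ k) ^ (N + i) = X ^ (k * N) * X ^ (k * i)" by (simp only: power_add power_mult)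
    show "X ^ (k * N) + E * X ^ r * (X ^ k) ^ (N + i) = X ^ (k * N) * (1 + E * X ^ (k * i + r))"
      unfolding * power_add[of X "k * i" r] by (simp only: distrib_left mult_1_right mult_1_left mult_ac)
  qed
  also have "\<dots> = X ^ (k * N * N) * ?B"
    by (simp add: prod.distrib X_def E_def flip: power_mult)
  also have "(\<Prod>i<N. X ^ (k * N) + (E * X ^ r) * (X ^ k) ^ i) =
      (\<Prod>i<N. E * X ^ (r + k * i) * (1 + E * X ^ (k * (N - Suc i) + (k - r))))"
  proof (intro prod.cong refl)
    fix i assume "i \<in> {..<N}"
    then obtain d where d: "N = Suc i + d" using less_imp_Suc_add by auto
    have "r + k * i + (k * d + (k - r)) = k * N" using r d by (simp add: algebra_simps)
    hence *: "X ^ (r + k * i) * X ^ (k * d + (k - r)) = X ^ (k * N)" by (metis power_add)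
    have "E * X ^ (r + k * i) * (1 + E * X ^ (k * d + (k - r))) =
          E * X ^ (r + k * i) + (E * E) * (X ^ (r + k * i) * X ^ (k * d + (k - r)))"
      by (simp add: algebra_simps)
    also have "\<dots> = X ^ (k * N) + (E * X ^ r) * (X ^ k) ^ i"
      unfolding * EE by (simp only: power_add power_mult mult_1_left) (simp add: mult_ac add_ac)
    finally show "X ^ (k * N) + (E * X ^ r) * (X ^ k) ^ i =
      E * X ^ (r + k * i) * (1 + E * X ^ (k * (N - Suc i) + (k - r)))" using d by simp
  qed
  also have "\<dots> = E ^ N * X ^ (\<Sum>i<N. r + k * i) * (\<Prod>i<N. 1 + E * X ^ (k * (N - Suc i) + (k - r)))"
    by (simp add: prod.distrib power_sum)
  also have "(\<Prod>i<N. 1 + E * X ^ (k * (N - Suc i) + (k - r))) = ?A"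
    unfolding X_def E_def by (rule prod.nat_diff_reindex)
  finally have L: "(\<Prod>i<2*N. X ^ (k * N) + (E * X ^ r) * (X ^ k) ^ i) = E ^ N * X ^ M * (?A * ?B)"
    by (simp add: M_def power_add mult_ac)
  have "(\<Prod>i<2*N. X ^ (k * N) + (E * X ^ r) * (X ^ k) ^ i) =
     (\<Sum>m\<le>2*N. (X ^ k) ^ (m * (m - 1) div 2) * qbinom (X ^ k) (2 * N) m * (E * X ^ r) ^ m * (X ^ (k * N)) ^
        (2 * N - m))"
    by (rule q_binomial_theorem)
  also have "\<dots> = (\<Sum>m\<le>2*N. E ^ N * X ^ M * (fps_const (sgn_pow e (int m - int N)) * 
       X ^ nat (jexp k r (int m - int N)) * qbinom (X ^ k) (2 * N) m))"
  proof (intro sum.cong refl)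
    fix m assume "m \<in> {..2*N}"
    hence m: "m \<le> 2 * N" by simp
    define j where "j = int m - int N"
    have j0: "jexp k r j \<ge> 0" using jexp_ge_abs[OF r, of j] by simp
    have tri: "2 * int (m * (m - 1) div 2) = int m * (int m - 1)"
      by (cases m) (auto simp: zdiv_int algebra_simps)
    have "2 * int (k * (m * (m - 1) div 2) + r * m + k * N * (2 * N - m)) = 
      int k * (2 * int (m * (m - 1) div 2)) + 2 * int r * int m + 2 * int k * int N * (2 * int N - int m)"
      using m by (simp add: of_nat_diff)
    also have "\<dots> = 2 * int M + 2 * jexp k r j"
      unfolding tri twoM two_jexp j_def by (simp add: algebra_simps)
    finally have "int (k * (m * (m - 1) div 2) + r * m + k * N * (2 * N - m)) = int (M + nat (jexp k r j))"
      using j0 by (simp only: of_nat_add int_nat_eq) simp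
    hence "k * (m * (m - 1) div 2) + r * m + k * N * (2 * N - m) = M + nat (jexp k r j)"
      by (simp only: of_nat_eq_iff)
    hence X: "(X ^ k) ^ (m * (m - 1) div 2) * (X ^ r) ^ m * (X ^ (k * N)) ^ (2 * N - m) = X ^ M * X ^ nat (jexp k r j)"
      by (simp flip: power_mult power_add)
    have E2: "E ^ (2 * i) = 1" for i using EE by (simp add: power_mult power2_eq_square)
    have "E ^ m = E ^ N * E ^ nat \<bar>j\<bar>"
    proof (cases "m \<ge> N")
      case True
      hence "N + nat \<bar>j\<bar> = m" by (auto simp: j_def)
      thus ?thesis by (metis power_add)
    next
      case False
      hence "N + nat \<bar>j\<bar> = m + 2 * nat \<bar>j\<bar>" by (auto simp: j_def)
      thus ?thesis by (metis E2 mult.right_neutral power_add)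
    qed
    hence E: "E ^ m = E ^ N * fps_const (sgn_pow e j)"
      by (simp add: E_def sgn_pow_def)
    have "(X ^ k) ^ (m * (m - 1) div 2) * qbinom (X ^ k) (2 * N) m * (E * X ^ r) ^ m * (X ^ (k * N)) ^ (2 * N - m)
       = E ^ m * qbinom (X ^ k) (2 * N) m * ((X ^ k) ^ (m * (m - 1) div 2) * (X ^ r) ^ m * (X ^ (k * N)) ^ (2 * N - m))"
      by (simp add: power_mult_distrib mult_ac)
    thus "(X ^ k) ^ (m * (m - 1) div 2) * qbinom (X ^ k) (2 * N) m * (E * X ^ r) ^ m * (X ^ (k * N)) ^ (2 * N - m) =
       E ^ N * X ^ M * (fps_const (sgn_pow e (int m - int N)) * 
       X ^ nat (jexp k r (int m - int N)) * qbinom (X ^ k) (2 * N) m)"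
      unfolding X E j_def by (simp add: mult_ac)
  qed
  also have "\<dots> = E ^ N * X ^ M * ?S" unfolding X_def by (rule sum_distrib_left [symmetric])
  finally have "E ^ N * X ^ M * (?A * ?B) = E ^ N * X ^ M * ?S" using L by simp
  moreover have "E ^ N * X ^ M \<noteq> 0" using e by (auto simp: E_def X_def)
  ultimately show ?thesis by (simp only: mult_cancel_left) blast
qed

section \<open>Jacobi's triple product\<close>

definition theta :: "nat \<Rightarrow> nat \<Rightarrow> int \<Rightarrow> int fps" where
  "theta k r e = int_series (jexp k r) (sgn_pow e)"

text \<open>
The central Gaussian binomials tend to \<open>1 / P\<close> with \<open>P = (q\<^sup>k;
q\<^sup>k)\<^sub>\<infinity>\<close>: in the quotient formula each of the three finite products may be replaced by
\<open>P\<close> in low degrees.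
\<close>

lemma qbinom_agree:
  assumes k: "k > 0" and m: "m \<le> 2 * N" 
  defines "P \<equiv> qprod (-1) ((\<lambda>i. k * i) ` {1..})"
  shows "agree (k * (Suc (min m (2 * N - m))) - 1) (qbinom (fps_X ^ k) (2 * N) m * P) 1"
proof -
  define F where "F = (\<lambda>m. \<Prod>i=1..m. 1 - (fps_X ^ k) ^ i :: int fps)"
  have F: "agree (k * Suc m - 1) (F m) P" for m
  proof -
    have "F m = (\<Prod>i\<in>(\<lambda>i. k * i) ` {1..} \<inter> {1..k * Suc m - 1}. 1 + fps_const (-1) * fps_X ^ i)"
      unfolding F_def
    proof (rule prod.reindex_bij_witness[of _ "\<lambda>i. i div k" "\<lambda>i. k * i"])
      fix i assume "i \<in> (\<lambda>i. k * i) ` {1..} \<inter> {1..k * Suc m - 1}"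
      then obtain j where j: "i = k * j" "1 \<le> j" "k * j \<le> k * Suc m - 1" by auto
      hence "k * j < k * Suc m" using k by (intro le_less_trans[OF j(3)]) (simp add: Suc_le_lessD)
      hence "j < Suc m" by (simp only: mult_less_cancel1)
      thus "i div k \<in> {1..m}" using j k by simp
    next
      fix i assume i: "i \<in> {1..m}"
      hence "k * i \<le> k * m" by simp
      also have "k * m \<le> k * Suc m - 1" using k by simp
      finally show "k * i \<in> (\<lambda>i. k * i) ` {1..} \<inter> {1..k * Suc m - 1}" using i k by auto
    qed (use k in \<open>auto simp: power_mult simp flip: fps_const_neg\<close>)
    thus ?thesis unfolding P_def by (metis agree_qprod agree_sym order_refl)
  qed
  let ?K = "k * (Suc (min m (2 * N - m))) - 1"
  have le: "?K \<le> k * Suc i - 1" if "min m (2 * N - m) \<le> i" for i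
    using that by (intro diff_le_mono mult_le_mono2) simp
  have Fm: "agree ?K (F m) P" "agree ?K (F (2 * N - m)) P" "agree ?K (F (2 * N)) P"
    by (rule agree_mono[OF F], rule le, use m in simp)+
  let ?b = "qbinom (fps_X ^ k :: int fps) (2 * N) m"
  have "agree ?K (?b * P * P) (?b * F m * F (2 * N - m))"
    by (intro agree_mult agree_refl agree_sym[OF Fm(1)] agree_sym[OF Fm(2)])
  also have "?b * F m * F (2 * N - m) = F (2 * N)"
    unfolding F_def by (rule qbinom_qfact[OF m])
  also have "agree ?K (F (2 * N)) P" by (rule Fm)
  also have "P = 1 * P" by simp
  finally show ?thesis by (rule agree_cancel) (simp add: P_def)
qed

text \<open>
The limit of the finite triple product. In the term with index \<open>j\<close> the replacement of the Gaussian
binomial by its limit costs an error of order \<open>k (N - \<bar>j\<bar> + 1)\<close>, and together with the exponent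
of that term this exceeds \<open>N\<close>.
\<close>

theorem jacobi_triple_product:
  assumes e: "e * e = 1" and r: "0 < r" "r < k"
  shows "theta k r e = qprod (-1) ((\<lambda>i. k * i) ` {1..}) *
     (qprod e ((\<lambda>i. k * i + (k - r)) ` UNIV) * qprod e ((\<lambda>i. k * i + r) ` UNIV))"
proof (rule agree_all)
  fix N
  define P where "P = qprod (-1) ((\<lambda>i. k * i) ` {1..})"
  have fin: "agree N (qprod e ((\<lambda>i. k * i + s) ` UNIV)) (\<Prod>i<N. 1 + fps_const e * fps_X ^ (k * i + s))"
    if "0 < s" "s < k" for s
  proof -
    have "(\<Prod>i<N. 1 + fps_const e * fps_X ^ (k * i + s)) =
      (\<Prod>i\<in>range (\<lambda>i. k * i + s) \<inter> {1..k * N}. 1 + fps_const e * fps_X ^ i)"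
    proof (rule prod.reindex_bij_witness[of _ "\<lambda>i. i div k" "\<lambda>i. k * i + s"])
      fix i assume "i \<in> range (\<lambda>i. k * i + s) \<inter> {1..k * N}"
      then obtain j where j: "i = k * j + s" "k * j + s \<le> k * N" by auto
      hence "k * j < k * N" using that by linarith
      thus "i div k \<in> {..<N}" using j that by simp
    next
      fix i assume i: "i \<in> {..<N}"
      hence "k * Suc i \<le> k * N" by (intro mult_le_mono2) auto
      thus "k * i + s \<in> range (\<lambda>i. k * i + s) \<inter> {1..k * N}" using that by auto
    qed (use that in auto)
    moreover have "N \<le> k * N" using that by simp
    ultimately show ?thesis by (simp only: agree_qprod)
  qed
  have "agree N (P * (qprod e ((\<lambda>i. k * i + (k - r)) ` UNIV) * qprod e ((\<lambda>i. k * i + r) ` UNIV)))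
    (P * ((\<Prod>i<N. 1 + fps_const e * fps_X ^ (k * i + (k - r))) * (\<Prod>i<N. 1 + fps_const e * fps_X ^ (k * i + r))))"
    using r by (intro agree_mult agree_refl fin) auto
  also have "\<dots> = (\<Sum>m\<le>2*N. fps_const (sgn_pow e (int m - int N)) * (fps_X ^ nat (jexp k r (int m - int N))
                   * (qbinom (fps_X ^ k) (2 * N) m * P)))"
    unfolding finite_triple_product[OF e r] by (simp add: sum_distrib_left mult_ac)
  also have "agree N \<dots> (\<Sum>m\<le>2*N. fps_const (sgn_pow e (int m - int N)) * (fps_X ^ nat (jexp k r (int m
        - int N)) * 1))"
  proof (rule agree_sum, rule agree_mult[OF agree_refl])
    fix m assume "m \<in> {..2*N}"
    hence m: "m \<le> 2 * N" by simp
    define j where "j = int m - int N"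
    define K where "K = k * (Suc (min m (2 * N - m))) - 1"
    have "int (min m (2 * N - m)) = int N - \<bar>j\<bar>" using m by (auto simp: j_def min_def of_nat_diff)
    moreover have "k * (Suc (min m (2 * N - m))) \<ge> 1" using r by simp
    moreover from this have "int K = int k * (int (min m (2 * N - m)) + 1) - 1"
      unfolding K_def by (simp add: of_nat_diff algebra_simps)
    ultimately have K: "int K = int k * (int N - \<bar>j\<bar> + 1) - 1" by simp
    have nonneg: "jexp k r j \<ge> 0" using jexp_ge_abs[OF r, of j] by simp
    have "N \<le> K + nat (jexp k r j)"
    proof -
      have "2 * (int K + jexp k r j) \<ge> 2 * (int k * (int N - \<bar>j\<bar> + 1) - 1) + (2 * \<bar>j\<bar> + int k
        * (\<bar>j\<bar> * (\<bar>j\<bar> - 1)))"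
        using jexp_ge[OF r, of j] K by simp
      also have "2 * (int k * (int N - \<bar>j\<bar> + 1) - 1) + (2 * \<bar>j\<bar> + int k * (\<bar>j\<bar> *
        (\<bar>j\<bar> - 1))) =
         2 * (int k * int N) + int k * ((\<bar>j\<bar> - 1) * (\<bar>j\<bar> - 2)) + 2 * \<bar>j\<bar> - 2"
        by (simp add: algebra_simps)
      finally have *: "2 * (int K + jexp k r j) \<ge> 2 * (int k * int N) + int k * ((\<bar>j\<bar> - 1) *
        (\<bar>j\<bar> - 2)) + 2 * \<bar>j\<bar> - 2" .
      have arith: "2 * n - 1 \<le> d" if "0 \<le> a" "2 * n \<le> b" "2 * b + a + 2 * c - 2 \<le> 2 * d" "0 \<le> c"
        for a b c d n :: int using that by linarith
      have "(\<bar>j\<bar> - 1) * (\<bar>j\<bar> - 2) \<ge> 0"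
        by (cases "\<bar>j\<bar> \<le> 1") (auto intro: mult_nonneg_nonneg mult_nonpos_nonpos)
      hence "int k * ((\<bar>j\<bar> - 1) * (\<bar>j\<bar> - 2)) \<ge> 0" by simp
      moreover have "int k * int N \<ge> 2 * int N" using r by (intro mult_right_mono) auto
      ultimately have "int K + jexp k r j \<ge> 2 * int N - 1" 
        using * abs_ge_zero[of j] by (rule arith)
      hence "int K + jexp k r j \<ge> int N" using nonneg by linarith
      thus ?thesis using nonneg by linarith
    qed
    moreover have "agree (K + nat (jexp k r j)) (fps_X ^ nat (jexp k r j) * (qbinom (fps_X ^ k) (2 * N) m * P))
        (fps_X ^ nat (jexp k r j) * 1)"
      unfolding K_def P_def using qbinom_agree[OF _ m] r by (intro agree_X_mult) auto
    ultimately show "agree N (fps_X ^ nat (jexp k r (int m - int N)) * (qbinom (fps_X ^ k) (2 * N) m * P)) 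
        (fps_X ^ nat (jexp k r (int m - int N)) * 1)"
      unfolding j_def by (rule agree_mono[rotated])
  qed
  also have "agree N \<dots> (theta k r e)"
    unfolding agree_def
  proof (intro allI impI)
    fix n assume n: "n \<le> N"
    have "(\<Sum>m\<le>2*N. fps_const (sgn_pow e (int m - int N)) * (fps_X ^ nat (jexp k r (int m - int N)) * 1)) $ n =
      (\<Sum>m\<le>2*N. if n = nat (jexp k r (int m - int N)) then sgn_pow e (int m - int N) else 0)"
      by (simp add: fps_sum_nth if_distrib cong: if_cong)
    also have "\<dots> = (\<Sum>m | m \<le> 2 * N \<and> jexp k r (int m - int N) = int n. sgn_pow e (int m - int N))"
    proof -
      have "n = nat (jexp k r j) \<longleftrightarrow> jexp k r j = int n" for j
        using jexp_ge_abs[OF r, of j] by auto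
      thus ?thesis by (simp add: sum.If_cases Int_def)
    qed
    also have "\<dots> = (\<Sum>j | jexp k r j = int n. sgn_pow e j)"
    proof (rule sum.reindex_bij_witness[of _ "\<lambda>j. nat (j + int N)" "\<lambda>m. int m - int N"])
      fix j assume j: "j \<in> {j. jexp k r j = int n}"
      hence "\<bar>j\<bar> \<le> int N" using jexp_ge_abs[OF r, of j] n by simp
      thus "int (nat (j + int N)) - int N = j"
        "nat (j + int N) \<in> {m. m \<le> 2 * N \<and> jexp k r (int m - int N) = int n}" using j by auto
    qed auto
    also have "\<dots> = theta k r e $ n" by (simp add: theta_def int_series_def)
    finally show "(\<Sum>m\<le>2*N. fps_const (sgn_pow e (int m - int N)) * (fps_X ^ nat (jexp k r (int m - int N)) *
        1)) $ n = theta k r e $ n" .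
  qed
  finally show "agree N (theta k r e) (qprod (-1) ((\<lambda>i. k * i) ` {1..}) *
     (qprod e ((\<lambda>i. k * i + (k - r)) ` UNIV) * qprod e ((\<lambda>i. k * i + r) ` UNIV)))"
    unfolding P_def by (rule agree_sym)
qed

section \<open>Dissections of theta series\<close>

lemma sgn_pow_1 [simp]: "sgn_pow 1 j = 1"
  by (simp add: sgn_pow_def)

lemma sgn_pow_minus_1: "sgn_pow (-1) j = (if even j then 1 else -1)"
  by (simp add: sgn_pow_def minus_one_power_iff even_nat_iff)

lemma theta_reflect:
  assumes "r \<le> k"
  shows "theta k (k - r) e = theta k r e"
proof -
  have "2 * jexp k (k - r) j = 2 * jexp k r (- j)" for j
    using assms by (simp add: two_jexp of_nat_diff algebra_simps)
  hence "theta k (k - r) e = int_series (\<lambda>j. jexp k r (- j)) (\<lambda>j. sgn_pow e (- j))"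
    unfolding theta_def by (intro arg_cong2[of _ _ _ _ int_series] ext) (simp_all add: sgn_pow_def)
  thus ?thesis by (simp add: int_series_reflect theta_def)
qed

text \<open>
A residue class of the index of a theta series contributes a dilated theta series, once the quadratic exponent is
rewritten. The hypothesis is stated with a factor 2 in order to avoid halves.
\<close>

lemma theta_part:
  assumes "\<And>i. 2 * jexp k r (f i) = 2 * (int c + int d * jexp k' r' i)" 
    and "\<And>i. sgn_pow e (f i) = u * sgn_pow e' i"
    and "d > 0" "0 < r'" "r' < k'"
  shows "int_series (\<lambda>i. jexp k r (f i)) (\<lambda>i. sgn_pow e (f i)) = 
           fps_const u * fps_X ^ c * fps_dilate d (theta k' r' e')"
proof -
  have "jexp k r (f i) = int c + int d * jexp k' r' i" for i
    using assms(1)[of i] by simp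
  moreover have "jexp k' r' i \<ge> 0" for i using jexp_ge_abs[OF assms(4,5), of i] by simp
  moreover have "int_series g (\<lambda>i. u * h i) = fps_const u * int_series g h" for g h
    by (simp add: fps_eq_iff int_series_def sum_distrib_left)
  ultimately show ?thesis using assms(2,3)
    by (simp add: int_series_shift_dilate theta_def mult.assoc)
qed

lemma theta_split:
  assumes "m > 0" "finite R" "\<And>j. \<exists>!t. t \<in> R \<and> m dvd j - t" "0 < r" "r < k"
  shows "theta k r e = (\<Sum>t\<in>R. int_series (\<lambda>i. jexp k r (m * i + t)) (\<lambda>i. sgn_pow e (m * i + t)))"
  unfolding theta_def by (rule int_series_split) (use assms finite_jexp in auto)

lemma residue_3: "\<exists>!t. t \<in> {0, 1, -1} \<and> 3 dvd j - (t::int)"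
proof -
  have "3 dvd j \<or> 3 dvd j - 1 \<or> 3 dvd j + 1" by presburger
  moreover have "\<not> (3 dvd j \<and> 3 dvd j - 1)" "\<not> (3 dvd j \<and> 3 dvd j + 1)" "\<not> (3 dvd j - 1
        \<and> 3 dvd j + 1)"
    by presburger+
  ultimately show ?thesis by auto
qed

lemma residue_2: "\<exists>!t. t \<in> {0, 1} \<and> 2 dvd j - (t::int)"
  by (cases "even j") (auto intro!: ex1I[of _ "if even j then 0 else 1"])

lemma residue_2': "\<exists>!t. t \<in> {0, -1} \<and> 2 dvd j - (t::int)"
  by (cases "even j") (auto intro!: ex1I[of _ "if even j then 0 else -1"])

text \<open>
The series \<open>\<phi>(q) = \<Sum> q\<^bsup>j\<^sup>2\<^esup>\<close>, \<open>\<phi>(-q)\<close>, \<open>\<psi>(q) =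
\<Sum> q\<^bsup>2j\<^sup>2 - j\<^esup>\<close>, \<open>\<Sum> q\<^bsup>j(3j - 1)/2\<^esup>\<close> and \<open>\<Sum>
(-1)\<^sup>j q\<^bsup>3j\<^sup>2 - 2j\<^esup>\<close>, summed over all integers \<open>j\<close>. The last two occur
in the 3-dissections of \<open>\<psi>\<close> and of \<open>\<phi>(-q)\<close>.
\<close>

definition "phi = theta 2 1 1"
definition "phi_neg = theta 2 1 (-1)"
definition "psi = theta 4 1 1"
definition "pent = theta 3 1 1"
definition "omega_neg = theta 6 1 (-1)"

lemma jexp_values:
  "jexp 2 1 j = j * j" "jexp 4 1 j = 2 * j * j - j" "jexp 6 1 j = 3 * j * j - 2 * j"
  "jexp 4 3 j = 2 * j * j + j" "jexp 6 5 j = 3 * j * j + 2 * j" "2 * jexp 3 1 j = 3 * j * j - j"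
  "jexp 12 1 j = 6 * j * j - 5 * j" "jexp 12 5 j = 6 * j * j - j" "jexp 12 11 j = 6 * j * j + 5 * j"
  using two_jexp[of 2 1 j] two_jexp[of 4 1 j] two_jexp[of 6 1 j] two_jexp[of 4 3 j]
    two_jexp[of 6 5 j] two_jexp[of 3 1 j] two_jexp[of 12 1 j] two_jexp[of 12 5 j]
    two_jexp[of 12 11 j] by (simp_all add: algebra_simps)

text \<open>
Even \<open>j\<close> give \<open>\<phi>(q\<^sup>4)\<close>. Odd \<open>j\<close> are of the form \<open>4 i +
1\<close> or \<open>4 i - 1\<close>, and each of these two classes gives \<open>q \<psi>(q\<^sup>8)\<close>.
\<close>

lemma phi_type_2_dissection:
  assumes e: "e * e = 1"
  shows "theta 2 1 e = fps_dilate 4 phi + fps_const (2 * e) * fps_X * fps_dilate 8 psi"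
proof -
  have odd_e: "sgn_pow e (2 * i) = 1" "sgn_pow e (2 * i + 1) = e" for i
  proof -
    have "e = 1 \<or> e = -1" using e by (simp only: square_eq_1_iff)
    thus "sgn_pow e (2 * i) = 1" "sgn_pow e (2 * i + 1) = e" by (auto simp: sgn_pow_minus_1)
  qed
  have odd_e': "sgn_pow e (1 + i * 4) = e" "sgn_pow e (i * 4 - 1) = e" for i
    using odd_e(2)[of "2 * i"] odd_e(2)[of "2 * i - 1"] by (simp_all add: algebra_simps)
  define S where "S = int_series (\<lambda>i. jexp 2 1 (2 * i + 1)) (\<lambda>i. sgn_pow e (2 * i + 1))"
  have "inj (\<lambda>i::int. 2 * i + 1)" by (simp add: inj_def)
  hence "finite ((\<lambda>i. 2 * i + 1) -` {j. jexp 2 1 j = int n})" for n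
    by (intro finite_vimageI finite_jexp) auto
  hence fin: "finite {i. jexp 2 1 (2 * i + 1) = int n}" for n by (simp add: vimage_def)
  have "S = (\<Sum>t\<in>{0,-1}. int_series (\<lambda>i. jexp 2 1 (2 * (2 * i + t) + 1)) (\<lambda>i. sgn_pow e (2 *
        (2 * i + t) + 1)))"
    unfolding S_def using fin residue_2' by (intro int_series_split) auto
  also have "\<dots> = int_series (\<lambda>i. jexp 2 1 (2 * (2 * i + 0) + 1)) (\<lambda>i. sgn_pow e (2 * (2 * i + 0) + 1))
       + int_series (\<lambda>i. jexp 2 1 (2 * (2 * i + -1) + 1)) (\<lambda>i. sgn_pow e (2 * (2 * i + -1) + 1))"
    by (subst sum.insert) auto
  also have "int_series (\<lambda>i. jexp 2 1 (2 * (2 * i + 0) + 1)) (\<lambda>i. sgn_pow e (2 * (2 * i + 0) + 1)) =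
    fps_const e * fps_X ^ 1 * fps_dilate 8 (theta 4 3 1)"
    by (rule theta_part) (use odd_e odd_e' in \<open>simp_all add: jexp_values algebra_simps del: One_nat_def\<close>)
  also have "int_series (\<lambda>i. jexp 2 1 (2 * (2 * i + -1) + 1)) (\<lambda>i. sgn_pow e (2 * (2 * i + -1) + 1)) =
    fps_const e * fps_X ^ 1 * fps_dilate 8 (theta 4 1 1)"
    by (rule theta_part) (use odd_e odd_e' in \<open>simp_all add: jexp_values algebra_simps del: One_nat_def\<close>)
  also have "theta 4 3 1 = theta 4 1 1" using theta_reflect[of 1 4 1] by simp
  finally have S: "S = fps_const (2 * e) * fps_X * fps_dilate 8 psi"
    by (simp add: psi_def algebra_simps numeral_fps_const flip: fps_const_mult)
  have "theta 2 1 e = (\<Sum>t\<in>{0,1}. int_series (\<lambda>i. jexp 2 1 (2 * i + t)) (\<lambda>i. sgn_pow e (2 * i + t)))"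
    using residue_2 by (intro theta_split) auto
  also have "\<dots> = int_series (\<lambda>i. jexp 2 1 (2 * i + 0)) (\<lambda>i. sgn_pow e (2 * i + 0)) + S"
    by (simp add: S_def)
  also have "int_series (\<lambda>i. jexp 2 1 (2 * i + 0)) (\<lambda>i. sgn_pow e (2 * i + 0)) =
    fps_const 1 * fps_X ^ 0 * fps_dilate 4 (theta 2 1 1)"
    by (rule theta_part) (use odd_e odd_e' in \<open>simp_all add: jexp_values algebra_simps del: One_nat_def\<close>)
  finally show ?thesis by (simp add: S phi_def)
qed

lemma phi_2_dissection: "phi = fps_dilate 4 phi + 2 * fps_X * fps_dilate 8 psi"
  and phi_neg_2_dissection: "phi_neg = fps_dilate 4 phi - 2 * fps_X * fps_dilate 8 psi"
  using phi_type_2_dissection[of 1] phi_type_2_dissection[of "-1"]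
  by (simp_all add: phi_def phi_neg_def numeral_fps_const flip: fps_const_neg)

lemma phi_neg_3_dissection:
  "phi_neg = fps_dilate 9 phi_neg - 2 * fps_X * fps_dilate 3 omega_neg"
proof -
  let ?I = "\<lambda>t. int_series (\<lambda>i. jexp 2 1 (3 * i + t)) (\<lambda>i. sgn_pow (-1) (3 * i + t))"
  have "phi_neg = (\<Sum>t\<in>{0,1,-1}. ?I t)"
    unfolding phi_neg_def using residue_3 by (intro theta_split) auto
  also have "\<dots> = ?I 0 + ?I 1 + ?I (-1)" by simp
  also have "?I 0 = fps_const 1 * fps_X ^ 0 * fps_dilate 9 (theta 2 1 (-1))"
    by (rule theta_part) (simp_all add: jexp_values algebra_simps sgn_pow_minus_1 del: One_nat_def)
  also have "?I 1 = fps_const (-1) * fps_X ^ 1 * fps_dilate 3 (theta 6 5 (-1))"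
    by (rule theta_part) (simp_all add: jexp_values algebra_simps sgn_pow_minus_1 del: One_nat_def)
  also have "?I (-1) = fps_const (-1) * fps_X ^ 1 * fps_dilate 3 (theta 6 1 (-1))"
    by (rule theta_part) (simp_all add: jexp_values algebra_simps sgn_pow_minus_1 del: One_nat_def)
  also have "theta 6 5 (-1) = theta 6 1 (-1)" using theta_reflect[of 1 6 "-1"] by simp
  finally show ?thesis by (simp add: phi_neg_def omega_neg_def mult.assoc flip: fps_const_neg)
qed

text \<open>
In \<open>\<psi>\<close> the class \<open>j \<equiv> 1 (mod 3)\<close> gives \<open>q \<psi>(q\<^sup>9)\<close>. The
other two classes together are the even and odd part of the index of \<open>pent\<close>.
\<close>

lemma psi_3_dissection:
  "psi = fps_dilate 3 pent + fps_X * fps_dilate 9 psi"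
proof -
  let ?I = "\<lambda>t. int_series (\<lambda>i. jexp 4 1 (3 * i + t)) (\<lambda>i. sgn_pow 1 (3 * i + t))"
  let ?J = "\<lambda>t. int_series (\<lambda>i. jexp 3 1 (2 * i + t)) (\<lambda>i. sgn_pow 1 (2 * i + t))"
  have "pent = (\<Sum>t\<in>{0,1}. ?J t)"
    unfolding pent_def using residue_2 by (intro theta_split) auto
  also have "\<dots> = ?J 0 + ?J 1" by simp
  also have "?J 0 = fps_const 1 * fps_X ^ 0 * fps_dilate 1 (theta 12 5 1)"
    by (rule theta_part) (simp_all add: jexp_values algebra_simps del: One_nat_def)
  also have "?J 1 = fps_const 1 * fps_X ^ 1 * fps_dilate 1 (theta 12 11 1)"
    by (rule theta_part) (simp_all add: jexp_values algebra_simps del: One_nat_def)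
  finally have pent: "pent = theta 12 5 1 + fps_X * theta 12 11 1"
    by (simp add: fps_eq_iff fps_dilate_nth)
  have "psi = (\<Sum>t\<in>{0,1,-1}. ?I t)"
    unfolding psi_def using residue_3 by (intro theta_split) auto
  also have "\<dots> = ?I 0 + ?I 1 + ?I (-1)" by simp
  also have "?I 0 = fps_const 1 * fps_X ^ 0 * fps_dilate 3 (theta 12 5 1)"
    by (rule theta_part) (simp_all add: jexp_values algebra_simps del: One_nat_def)
  also have "?I 1 = fps_const 1 * fps_X ^ 1 * fps_dilate 9 (theta 4 3 1)"
    by (rule theta_part) (simp_all add: jexp_values algebra_simps del: One_nat_def)
  also have "?I (-1) = fps_const 1 * fps_X ^ 3 * fps_dilate 3 (theta 12 1 1)"
    by (rule theta_part) (simp_all add: jexp_values algebra_simps del: One_nat_def)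
  also have "theta 4 3 1 = theta 4 1 1" using theta_reflect[of 1 4 1] by simp
  also have "theta 12 1 1 = theta 12 11 1" using theta_reflect[of 1 12 1] by simp
  finally show ?thesis by (simp add: pent psi_def algebra_simps)
qed

section \<open>Theta series as products\<close>

text \<open>
The product \<open>E\<^sub>k = (q\<^sup>k; q\<^sup>k)\<^sub>\<infinity>\<close>.
\<close>

definition euler :: "nat \<Rightarrow> int fps" where
  "euler k = qprod (-1) ((\<lambda>i. k * i) ` {1..})"

lemma euler_dilate: "l > 0 \<Longrightarrow> fps_dilate l (euler k) = euler (l * k)"
  by (simp add: euler_def qprod_dilate image_image mult.assoc)

lemma euler_nth_0 [simp]: "euler k $ 0 = 1" by (simp add: euler_def)

lemma euler_nonzero [simp]: "euler k \<noteq> 0"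
  using euler_nth_0[of k] by fastforce

abbreviation "odds \<equiv> {n::nat. odd n}"

lemma range_odds: "range (\<lambda>i. 2 * i + 1) = odds" "range (\<lambda>i. Suc (2 * i)) = odds"
  by (auto elim!: oddE)

lemma qprod_odds: "qprod e {1..} = qprod e odds * qprod e ((\<lambda>i. 2 * i) ` {1..})"
proof -
  have "{1..} = odds \<union> (\<lambda>i. 2 * i) ` {1..}"
  proof (intro set_eqI iffI)
    fix n :: nat assume "n \<in> {1..}"
    thus "n \<in> odds \<union> (\<lambda>i. 2 * i) ` {1..}"
      by (cases "even n") (auto elim!: evenE oddE)
  qed (auto simp: Suc_le_eq odd_pos)
  moreover have "odds \<inter> (\<lambda>i. 2 * i) ` {1..} = {}" by auto
  ultimately show ?thesis by (metis qprod_Un)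
qed

lemma qprod_thirds: "qprod e {1..} = qprod e (range (\<lambda>i. 3 * i + 2)) * qprod e (range (\<lambda>i. 3 * i + 1)) *
   qprod e ((\<lambda>i. 3 * i) ` {1..})"
proof -
  have "{1..} = (range (\<lambda>i. 3 * i + 2) \<union> range (\<lambda>i. 3 * i + 1)) \<union> (\<lambda>i. 3 * i ::
        nat) ` {1..}"
  proof (intro set_eqI iffI)
    fix n :: nat assume n: "n \<in> {1..}"
    have "n = 3 * (n div 3) + n mod 3" "n mod 3 < 3" by simp_all
    then consider "n = 3 * (n div 3) + 2" | "n = 3 * (n div 3) + 1" | "n = 3 * (n div 3)" "n div 3 \<ge> 1"
      using n by (cases "n mod 3 = 0"; cases "n mod 3 = 1") force+
    thus "n \<in> (range (\<lambda>i. 3 * i + 2) \<union> range (\<lambda>i. 3 * i + 1)) \<union> (\<lambda>i. 3 * i)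
        ` {1..}"
      by cases (metis UNIV_I UnCI image_eqI, metis UNIV_I UnCI image_eqI, metis UnCI atLeast_iff image_eqI)
  qed auto
  moreover have "(range (\<lambda>i. 3 * i + 2) \<union> range (\<lambda>i. 3 * i + 1)) \<inter> (\<lambda>i. 3 * i
        :: nat) ` {1..} = {}"
    by (auto; presburger)
  moreover have "range (\<lambda>i. 3 * i + 2) \<inter> range (\<lambda>i. 3 * i + 1 :: nat) = {}" by (auto; presburger)
  ultimately show ?thesis by (metis qprod_Un)
qed

lemma qprod_odd_thirds: "qprod e odds = qprod e (range (\<lambda>i. 6 * i + 5)) * qprod e (range (\<lambda>i. 6 * i + 1)) *
   qprod e ((\<lambda>i. 3 * i) ` odds)"
proof -
  have "odds = (range (\<lambda>i. 6 * i + 5) \<union> range (\<lambda>i. 6 * i + 1)) \<union> (\<lambda>i. 3 * i ::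
        nat) ` odds"
  proof (intro set_eqI iffI)
    fix n :: nat assume n: "n \<in> odds"
    hence "odd n" by auto
    hence "n = 6 * (n div 6) + 5 \<or> n = 6 * (n div 6) + 1 \<or> n = 3 * (2 * (n div 6) + 1)" 
      by presburger
    then consider "n = 6 * (n div 6) + 5" | "n = 6 * (n div 6) + 1" | "n = 3 * (2 * (n div 6) + 1)" 
      by blast
    thus "n \<in> (range (\<lambda>i. 6 * i + 5) \<union> range (\<lambda>i. 6 * i + 1)) \<union> (\<lambda>i. 3 * i) ` odds"
    proof cases
      case 3
      have "2 * (n div 6) + 1 \<in> odds" by simp
      with 3 show ?thesis by blast
    qed (metis UNIV_I UnCI image_eqI)+
  next
    fix n :: nat assume "n \<in> (range (\<lambda>i. 6 * i + 5) \<union> range (\<lambda>i. 6 * i + 1)) \<union>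
        (\<lambda>i. 3 * i) ` odds"
    hence "odd n" by auto
    thus "n \<in> odds" by simp
  qed
  moreover have "(range (\<lambda>i. 6 * i + 5) \<union> range (\<lambda>i. 6 * i + 1)) \<inter> (\<lambda>i. 3 * i
        :: nat) ` odds = {}"
    by (auto; presburger)
  moreover have "range (\<lambda>i. 6 * i + 5) \<inter> range (\<lambda>i. 6 * i + 1 :: nat) = {}" by (auto; presburger)
  ultimately show ?thesis by (metis qprod_Un)
qed

lemma euler_1: "euler 1 = qprod (-1) {1..}" by (simp add: euler_def)

lemma euler_1_odds: "euler 1 = qprod (-1) odds * euler 2"
  unfolding euler_1 qprod_odds[of "-1"] by (simp add: euler_def)

text \<open>
The quotient \<open>E\<^sub>2 / E\<^sub>4\<close> is the product of \<open>1 - q\<^bsup>2i\<^esup>\<close> over the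
odd \<open>i\<close>, and each factor splits.
\<close>

lemma odds_minus_plus: "qprod (-1) odds * qprod 1 odds * euler 4 = euler 2"
proof -
  have "euler 2 = fps_dilate 2 (euler 1)" by (simp add: euler_dilate)
  also have "\<dots> = qprod (-1) ((\<lambda>i. 2 * i) ` odds) * euler 4"
    by (subst euler_1_odds) (simp add: qprod_dilate euler_dilate)
  finally show ?thesis by (simp add: qprod_minus_plus)
qed

lemma phi_product: "phi = euler 2 * (qprod 1 odds * qprod 1 odds)"
  unfolding phi_def by (subst jacobi_triple_product) (simp_all add: euler_def range_odds)

lemma phi_neg_product: "phi_neg = euler 2 * (qprod (-1) odds * qprod (-1) odds)"
  unfolding phi_neg_def by (subst jacobi_triple_product) (simp_all add: euler_def range_odds)

lemma phi_neg_euler: "phi_neg * euler 2 = euler 1 ^ 2"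
  by (simp only: phi_neg_product euler_1_odds power2_eq_square mult_ac)

lemma psi_product: "psi = euler 4 * qprod 1 odds"
proof -
  have "odds = range (\<lambda>i. 4 * i + 3) \<union> range (\<lambda>i. 4 * i + 1)"
  proof (intro set_eqI iffI)
    fix n :: nat assume n: "n \<in> odds"
    hence "odd n" by auto
    hence "n = 4 * (n div 4) + 3 \<or> n = 4 * (n div 4) + 1" by presburger
    then consider "n = 4 * (n div 4) + 3" | "n = 4 * (n div 4) + 1" by blast
    thus "n \<in> range (\<lambda>i. 4 * i + 3) \<union> range (\<lambda>i. 4 * i + 1)"
      by cases (metis UNIV_I UnCI image_eqI)+
  next
    fix n :: nat assume "n \<in> range (\<lambda>i. 4 * i + 3) \<union> range (\<lambda>i. 4 * i + 1)"
    hence "odd n" by auto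
    thus "n \<in> odds" by simp
  qed
  moreover have "range (\<lambda>i. 4 * i + 3) \<inter> range (\<lambda>i. 4 * i + 1 :: nat) = {}" by (auto; presburger)
  ultimately have "qprod 1 odds = qprod 1 (range (\<lambda>i. 4 * i + 3)) * qprod 1 (range (\<lambda>i. 4 * i + 1))"
    by (simp only: qprod_Un)
  thus ?thesis
    unfolding psi_def by (subst jacobi_triple_product) (simp_all add: euler_def)
qed

lemma psi_euler: "psi * euler 1 = euler 2 ^ 2"
proof -
  have "psi * euler 1 = (qprod (-1) odds * qprod 1 odds * euler 4) * euler 2"
    by (simp only: psi_product euler_1_odds mult_ac)
  thus ?thesis by (simp add: odds_minus_plus power2_eq_square)
qed

text \<open>
The product for \<open>pent\<close> runs over the exponents not divisible by 3, with plus signs; with \<open>g =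
\<Prod> (1 + q\<^sup>n) = E\<^sub>2 / E\<^sub>1\<close> it equals \<open>E\<^sub>3 g(q) / g(q\<^sup>3)\<close>.
\<close>

lemma pent_euler: "pent * (euler 1 * euler 6) = euler 2 * euler 3 ^ 2"
proof -
  define g where "g = qprod 1 {1..}"
  have g: "euler 1 * g = euler 2" unfolding g_def euler_1 qprod_minus_plus by (simp add: euler_def)
  have "fps_dilate 3 (euler 1 * g) = fps_dilate 3 (euler 2)" by (simp only: g)
  hence g3: "euler 3 * fps_dilate 3 g = euler 6" by (simp add: euler_dilate)
  have "pent = euler 3 * (qprod 1 (range (\<lambda>i. 3 * i + 2)) * qprod 1 (range (\<lambda>i. 3 * i + 1)))"
    unfolding pent_def by (subst jacobi_triple_product) (simp_all add: euler_def)
  moreover have "g = qprod 1 (range (\<lambda>i. 3 * i + 2)) * qprod 1 (range (\<lambda>i. 3 * i + 1)) * fps_dilate 3 g"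
    unfolding g_def by (subst qprod_thirds) (simp add: qprod_dilate)
  ultimately have "pent * fps_dilate 3 g = euler 3 * g" by algebra
  hence "pent * (euler 1 * euler 6) = euler 3 * euler 3 * (euler 1 * g)"
    unfolding g3[symmetric] by algebra
  thus ?thesis unfolding g by algebra
qed

text \<open>
The product for \<open>omega_neg\<close> runs over the exponents congruent to \<open>\<plusminus>1\<close> modulo 6.
With \<open>h = \<Prod> (1 - q\<^bsup>2n - 1\<^esup>) = E\<^sub>1 / E\<^sub>2\<close> it equals \<open>E\<^sub>6 h(q)
/ h(q\<^sup>3)\<close>.
\<close>

lemma omega_neg_euler: "omega_neg * (euler 2 * euler 3) = euler 1 * euler 6 ^ 2"
proof -
  define h where "h = qprod (-1) odds"
  have h: "euler 1 = h * euler 2" by (simp only: h_def euler_1_odds)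
  have "fps_dilate 3 (euler 1) = fps_dilate 3 (h * euler 2)" by (simp only: h)
  hence h3: "euler 3 = fps_dilate 3 h * euler 6" by (simp add: euler_dilate)
  have "omega_neg = euler 6 * (qprod (-1) (range (\<lambda>i. 6 * i + 5)) * qprod (-1) (range (\<lambda>i. 6 * i + 1)))"
    unfolding omega_neg_def by (subst jacobi_triple_product) (simp_all add: euler_def)
  moreover have "h = qprod (-1) (range (\<lambda>i. 6 * i + 5)) * qprod (-1) (range (\<lambda>i. 6 * i + 1)) *
        fps_dilate 3 h"
    unfolding h_def by (subst qprod_odd_thirds) (simp add: qprod_dilate)
  ultimately have "omega_neg * fps_dilate 3 h = euler 6 * h" by algebra
  hence "omega_neg * (euler 2 * euler 3) = euler 6 * euler 6 * (h * euler 2)"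
    unfolding h3 by algebra
  thus ?thesis unfolding h by algebra
qed

lemma phi_neg_mult_phi: "phi_neg * phi = fps_dilate 2 phi_neg ^ 2"
proof -
  have "fps_dilate 2 (phi_neg * euler 2) = fps_dilate 2 (euler 1 ^ 2)" by (simp only: phi_neg_euler)
  hence *: "fps_dilate 2 phi_neg * euler 4 = euler 2 ^ 2" by (simp add: euler_dilate)
  have "phi_neg * phi * euler 4 ^ 2 = (euler 2 * (qprod (-1) odds * qprod 1 odds * euler 4)) ^ 2"
    by (simp add: phi_neg_product phi_product power2_eq_square mult_ac)
  also have "\<dots> = (fps_dilate 2 phi_neg * euler 4) ^ 2"
    unfolding odds_minus_plus * by (simp add: power2_eq_square)
  finally have "phi_neg * phi * euler 4 ^ 2 = fps_dilate 2 phi_neg ^ 2 * euler 4 ^ 2"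
    by (simp add: power_mult_distrib)
  thus ?thesis by simp
qed

lemma psi_square: "psi ^ 2 = phi * fps_dilate 2 psi"
proof -
  have "fps_dilate 2 (psi * euler 1) = fps_dilate 2 (euler 2 ^ 2)" by (simp only: psi_euler)
  hence *: "fps_dilate 2 psi * euler 2 = euler 4 ^ 2" by (simp add: euler_dilate)
  have "phi * fps_dilate 2 psi = (fps_dilate 2 psi * euler 2) * qprod 1 odds ^ 2"
    by (simp add: phi_product power2_eq_square)
  thus ?thesis unfolding * by (simp add: psi_product power_mult_distrib)
qed

text \<open>
The reason why the cubic partitions are governed by theta series: the product of the two series is the reciprocal of
their generating function.
\<close>

lemma phi_neg_mult_psi: "phi_neg * psi = euler 1 * euler 2"
proof -
  have "(phi_neg * psi) * (euler 1 * euler 2) = (euler 1 * euler 2) * (euler 1 * euler 2)"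
    using phi_neg_euler psi_euler by algebra
  thus ?thesis by simp
qed

lemma omega_neg_mult_pent: "omega_neg * pent = fps_dilate 3 phi_neg * fps_dilate 3 psi"
proof -
  have "fps_dilate 3 (phi_neg * psi) = euler 3 * euler 6" by (simp add: phi_neg_mult_psi euler_dilate)
  moreover have "(omega_neg * pent) * (euler 1 * euler 2 * euler 3 * euler 6) =
    (euler 3 * euler 6) * (euler 1 * euler 2 * euler 3 * euler 6)"
    using pent_euler omega_neg_euler by algebra
  ultimately show ?thesis by simp
qed

text \<open>
Both sides are \<open>E\<^sub>2\<^sup>2 E\<^sub>3\<^sup>6 / (E\<^sub>1 E\<^sub>6\<^sup>3)\<close>.
\<close>

lemma pent_cube: "pent ^ 3 * phi_neg = fps_dilate 3 phi_neg ^ 3 * psi"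
proof -
  have "fps_dilate 3 (phi_neg * euler 2) = fps_dilate 3 (euler 1 ^ 2)" by (simp only: phi_neg_euler)
  hence a3: "fps_dilate 3 phi_neg * euler 6 = euler 3 ^ 2" by (simp add: euler_dilate)
  have "(pent ^ 3 * phi_neg) * (euler 1 * euler 1 * euler 1 * euler 6 ^ 3 * euler 2) =
     (pent * (euler 1 * euler 6)) ^ 3 * (phi_neg * euler 2)" by algebra
  also have "\<dots> = euler 2 ^ 3 * (euler 3 ^ 2) ^ 3 * euler 1 ^ 2"
    unfolding pent_euler phi_neg_euler by algebra
  also have "\<dots> = fps_dilate 3 phi_neg ^ 3 * euler 6 ^ 3 * euler 2 * euler 1 ^ 2 * (psi * euler 1)"
    unfolding a3[symmetric] psi_euler by algebra
  also have "\<dots> = (fps_dilate 3 phi_neg ^ 3 * psi) * (euler 1 * euler 1 * euler 1 * euler 6 ^ 3 * euler 2)" 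
    by algebra
  finally show ?thesis by simp
qed

section \<open>Differential equations in level 2\<close>

abbreviation qD :: "'a::comm_ring_1 fps \<Rightarrow> 'a fps" where "qD \<equiv> fps_XD"

lemma qD_nth: "qD f $ n = of_nat n * f $ n"
  by (cases n) (simp_all add: fps_XD_def)

lemma numeral_mult_nth [simp]: "(numeral k * f) $ n = numeral k * (f $ n :: 'a::comm_ring_1)"
  by (simp add: numeral_fps_const)

lemma of_nat_mult_nth [simp]: "(of_nat k * f) $ n = of_nat k * (f $ n :: 'a::comm_ring_1)"
  by (simp flip: fps_of_nat)

lemma numeral_cancel: "numeral k * f = numeral k * g \<Longrightarrow> f = (g :: int fps)"
  by simp

lemma qD_simps [simp]: "qD (f + g) = qD f + qD g" "qD (f - g) = qD f - qD g" "qD (- f) = - qD f"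
  "qD (numeral k) = 0" "qD 1 = 0" "qD 0 = 0" "qD (numeral k * f) = numeral k * qD f"
  by (simp_all add: fps_XD_def algebra_simps)

lemma qD_mult: "qD (f * g) = qD f * g + f * qD g"
  by (simp add: fps_XD_def algebra_simps)

lemma qD_power: "qD f = g * f \<Longrightarrow> qD (f ^ n) = of_nat n * g * f ^ n"
  by (induction n) (simp_all add: qD_mult algebra_simps)

lemma qD_dilate: "k > 0 \<Longrightarrow> qD (fps_dilate k f) = of_nat k * fps_dilate k (qD f)"
  by (auto simp: fps_eq_iff qD_nth fps_dilate_nth)

text \<open>
The logarithmic derivative \<open>\<theta>f / f\<close>, for a series with constant term 1.
\<close>

definition logder :: "int fps \<Rightarrow> int fps" where
  "logder f = qD f * fps_right_inverse f 1"

lemma qD_logder: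
  assumes "f $ 0 = 1"
  shows "qD f = logder f * f"
proof -
  have "f * fps_right_inverse f 1 = 1" by (rule fps_right_inverse) (use assms in simp)
  hence "fps_right_inverse f 1 * f = 1" by (simp add: mult.commute)
  thus ?thesis by (simp add: logder_def mult.assoc)
qed

lemma theta_nth_0 [simp]: "phi $ 0 = 1" "phi_neg $ 0 = 1" "psi $ 0 = 1" "pent $ 0 = 1"
proof -
  show "phi_neg $ 0 = 1" using arg_cong[OF phi_neg_euler, of "\<lambda>f. f $ 0"] by (simp add: fps_power_zeroth)
  show "psi $ 0 = 1" using arg_cong[OF psi_euler, of "\<lambda>f. f $ 0"] by (simp add: fps_power_zeroth)
  show "pent $ 0 = 1" using arg_cong[OF pent_euler, of "\<lambda>f. f $ 0"] by (simp add: fps_power_zeroth)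
  show "phi $ 0 = 1" by (simp add: phi_product)
qed

lemma theta_nonzero [simp]: "phi \<noteq> 0" "phi_neg \<noteq> 0" "psi \<noteq> 0" "pent \<noteq> 0"
  using theta_nth_0 by fastforce+

lemma fps_dilate_eq_0_iff [simp]: "k > 0 \<Longrightarrow> fps_dilate k f = 0 \<longleftrightarrow> f = 0"
proof
  assume k: "k > 0" and eq: "fps_dilate k f = 0"
  show "f = 0"
  proof (rule fps_ext)
    fix n show "f $ n = 0 $ n"
      using arg_cong[OF eq, of "\<lambda>g. g $ (k * n)"] k by (simp add: fps_dilate_nth)
  qed
qed (simp add: fps_eq_iff fps_dilate_nth)

text \<open>
The engine of the descent along \<open>q \<mapsto> q\<^sup>2\<close>: the coefficient at \<open>n\<close> is a
multiple of the one at \<open>n / 2\<close>, and the constant term vanishes because \<open>m \<noteq> 1\<close>.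
\<close>

lemma dilate_descent:
  fixes f :: "int fps"
  assumes "f = fps_const m * fps_dilate 2 f" "m \<noteq> 1"
  shows "f = 0"
proof (rule fps_ext)
  fix n
  have *: "f $ n = m * fps_dilate 2 f $ n" for n
    using arg_cong[OF assms(1), of "\<lambda>g. g $ n"] by simp
  show "f $ n = 0 $ n"
  proof (induction n rule: less_induct)
    case (less n)
    show ?case
    proof (cases "n = 0")
      case True
      thus ?thesis using *[of 0] assms(2) by simp
    next
      case False
      thus ?thesis using *[of n] less[of "n div 2"] by (simp add: fps_dilate_nth)
    qed
  qed
qed

text \<open>
One step of the arithmetic-geometric mean. The defect of the identity at \<open>q\<close> is \<open>-2\<close> times
the defect at \<open>q\<^sup>2\<close>, because \<open>\<phi>(q) + \<phi>(-q) = 2 \<phi>(q\<^sup>4)\<close> and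
\<open>\<phi>(q) \<phi>(-q) = \<phi>(-q\<^sup>2)\<^sup>2\<close>.
\<close>

lemma phi_squares: "phi_neg ^ 2 + phi ^ 2 = 2 * fps_dilate 2 phi ^ 2"
proof -
  define I where "I = phi_neg ^ 2 + phi ^ 2 - 2 * fps_dilate 2 phi ^ 2"
  have 1: "phi + phi_neg = 2 * fps_dilate 4 phi"
    using phi_2_dissection phi_neg_2_dissection by algebra
  have "I = 4 * fps_dilate 4 phi ^ 2 - 2 * fps_dilate 2 phi_neg ^ 2 - 2 * fps_dilate 2 phi ^ 2"
    unfolding I_def using 1 phi_neg_mult_phi by algebra
  also have "\<dots> = fps_const (-2) * fps_dilate 2 I"
    by (simp add: I_def fps_dilate_dilate algebra_simps numeral_fps_const flip: fps_const_neg)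
  finally have "I = fps_const (-2) * fps_dilate 2 I" .
  hence "I = 0" by (rule dilate_descent) simp
  thus ?thesis by (simp add: I_def)
qed

lemma psi_power_8: "16 * fps_X * psi ^ 8 = phi ^ 4 * (phi ^ 4 - phi_neg ^ 4)"
proof -
  have "fps_dilate 4 (psi ^ 2) = fps_dilate 4 (phi * fps_dilate 2 psi)"
    by (simp only: psi_square)
  hence 1: "fps_dilate 4 psi ^ 2 = fps_dilate 4 phi * fps_dilate 8 psi"
    by (simp add: fps_dilate_dilate)
  have "fps_dilate 2 (psi ^ 2) = fps_dilate 2 (phi * fps_dilate 2 psi)"
    by (simp only: psi_square)
  hence 2: "fps_dilate 2 psi ^ 2 = fps_dilate 2 phi * fps_dilate 4 psi"
    by (simp add: fps_dilate_dilate)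
  have "phi ^ 2 - phi_neg ^ 2 = 8 * fps_X * (fps_dilate 4 phi * fps_dilate 8 psi)"
    using phi_2_dissection phi_neg_2_dissection by algebra
  hence "phi ^ 4 - phi_neg ^ 4 = 16 * fps_X * (fps_dilate 2 phi * fps_dilate 4 psi) ^ 2"
    using phi_squares unfolding 1[symmetric] by algebra
  hence 3: "phi ^ 4 - phi_neg ^ 4 = 16 * fps_X * fps_dilate 2 psi ^ 4"
    unfolding 2[symmetric] by algebra
  show ?thesis unfolding 3 using psi_square by algebra
qed

abbreviation "alpha \<equiv> logder phi_neg"
abbreviation "gamma \<equiv> logder phi"

lemma qD_phis: "qD phi_neg = alpha * phi_neg" "qD phi = gamma * phi"
  by (simp_all add: qD_logder)

lemma alpha_dilate: "4 * fps_dilate 2 alpha = alpha + gamma"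
proof -
  have "qD (phi_neg * phi) = qD (fps_dilate 2 phi_neg ^ 2)" by (simp only: phi_neg_mult_phi)
  hence "(alpha + gamma) * (phi_neg * phi) = 4 * fps_dilate 2 alpha * (fps_dilate 2 phi_neg * fps_dilate 2 phi_neg)"
    by (simp add: qD_mult qD_dilate qD_phis power2_eq_square algebra_simps)
  hence "(alpha + gamma) * (phi_neg * phi) = 4 * fps_dilate 2 alpha * (phi_neg * phi)"
    by (simp add: phi_neg_mult_phi power2_eq_square)
  thus ?thesis by simp
qed

lemma gamma_dilate: "2 * (phi_neg ^ 2 + phi ^ 2) * fps_dilate 2 gamma = phi_neg ^ 2 * alpha + phi ^ 2 * gamma"
proof -
  have "qD (phi_neg ^ 2 + phi ^ 2) = qD (2 * fps_dilate 2 phi ^ 2)" by (simp only: phi_squares)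
  hence "2 * (phi_neg ^ 2 * alpha + phi ^ 2 * gamma) = 2 * (4 * fps_dilate 2 gamma * fps_dilate 2 phi ^ 2)"
    by (simp add: qD_mult qD_dilate qD_phis power2_eq_square algebra_simps)
  hence "phi_neg ^ 2 * alpha + phi ^ 2 * gamma = 4 * fps_dilate 2 gamma * fps_dilate 2 phi ^ 2"
    by (rule numeral_cancel)
  hence "phi_neg ^ 2 * alpha + phi ^ 2 * gamma = 2 * fps_dilate 2 gamma * (2 * fps_dilate 2 phi ^ 2)"
    by simp
  thus ?thesis unfolding phi_squares[symmetric] by algebra
qed

lemma subdegree_dilate: "k > 0 \<Longrightarrow> f \<noteq> 0 \<Longrightarrow> subdegree (fps_dilate k f) = k * subdegree f"
  by (intro subdegreeI) (auto simp: fps_dilate_nth elim!: dvdE)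

text \<open>
Let \<open>D = 4 (\<gamma> - \<alpha>)\<close> be the left-hand side and \<open>T\<close> the right-hand side.
Differentiating the two steps of the arithmetic-geometric mean shows that \<open>D / T\<close> is unchanged by
\<open>q \<mapsto> q\<^sup>2\<close>, so it is constant, and both series start with \<open>16 q\<close>. The proof
avoids the quotient: the difference \<open>W = D - T\<close> satisfies the same functional equation, which forces its
order to be 1 if it is not zero; but its coefficient at \<open>q\<close> vanishes.
\<close>

lemma jacobi_logder: "4 * (gamma - alpha) = phi ^ 4 - phi_neg ^ 4"
proof -
  define D where "D = 4 * (gamma - alpha)"
  define T where "T = phi ^ 4 - phi_neg ^ 4"
  define W where "W = D - T"
  have D2: "2 * (phi_neg ^ 2 + phi ^ 2) * fps_dilate 2 D = 2 * ((phi ^ 2 - phi_neg ^ 2) * (gamma - alpha))"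
  proof -
    have "2 * (phi_neg ^ 2 + phi ^ 2) * fps_dilate 2 D = 4 * (2 * (phi_neg ^ 2 + phi ^ 2) * fps_dilate 2 gamma)
        - 2 * (phi_neg ^ 2 + phi ^ 2) * (4 * fps_dilate 2 alpha)"
      by (simp add: D_def algebra_simps)
    thus ?thesis unfolding gamma_dilate alpha_dilate by algebra
  qed
  have T2: "4 * fps_dilate 2 T = (phi ^ 2 - phi_neg ^ 2) ^ 2"
  proof -
    have "4 * fps_dilate 2 T = (2 * fps_dilate 2 phi ^ 2) ^ 2 - 4 * (fps_dilate 2 phi_neg ^ 2) ^ 2"
      by (simp add: T_def algebra_simps flip: power_mult)
    thus ?thesis unfolding phi_squares[symmetric] phi_neg_mult_phi[symmetric] by algebra
  qed
  have "4 * (fps_dilate 2 D * T) = 4 * (fps_dilate 2 T * D)"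
    using D2 T2 unfolding T_def D_def[symmetric]
    unfolding D_def by algebra
  hence DT: "fps_dilate 2 D * T = fps_dilate 2 T * D" by simp
  hence WT: "fps_dilate 2 W * T = fps_dilate 2 T * W"
    by (simp add: W_def algebra_simps)
  have phi1: "phi $ 1 = 2" "phi_neg $ 1 = -2"
    by (subst phi_2_dissection, simp add: fps_dilate_nth mult.assoc fps_mult_nth_1 numeral_fps_const)
       (subst phi_neg_2_dissection, simp add: fps_dilate_nth mult.assoc fps_mult_nth_1 numeral_fps_const)
  have pow1: "(f ^ n) $ 1 = of_nat n * f $ 1" if "f $ 0 = 1" for f :: "int fps" and n
    using that by (induction n) (simp_all add: algebra_simps fps_power_zeroth)
  have T01: "T $ 0 = 0" "T $ 1 = 16" using pow1[of phi 4] pow1[of phi_neg 4] phi1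
    by (simp_all add: T_def fps_power_zeroth)
  have l0: "logder f $ 0 = 0" for f by (simp add: logder_def qD_nth)
  have "logder f $ 1 = f $ 1" if "f $ 0 = 1" for f
    using arg_cong[OF qD_logder[OF that], of "\<lambda>g. g $ 1"] that by (simp add: qD_nth l0)
  hence D01: "D $ 0 = 0" "D $ 1 = 16"
    using phi1 l0 by (simp_all add: D_def)
  have "W = 0"
  proof (rule ccontr)
    assume W: "W \<noteq> 0"
    have T: "T \<noteq> 0" "subdegree T = 1" using T01 by (auto intro!: subdegreeI)
    have "subdegree (fps_dilate 2 W * T) = subdegree (fps_dilate 2 T * W)" by (simp only: WT)
    hence "2 * subdegree W + 1 = 2 + subdegree W"
      using W T by (simp add: subdegree_dilate)
    hence "subdegree W = 1" by simp
    moreover have "W $ 1 = 0" using D01 T01 by (simp add: W_def)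
    ultimately show False using W by (metis nth_subdegree_nonzero)
  qed
  thus ?thesis by (simp add: W_def D_def T_def)
qed

text \<open>
The defect of this equation (one of Halphen's system) satisfies \<open>Y(q) = 4 Y(q\<^sup>2)\<close>. This uses that
the equations for \<open>\<phi>(-q)\<close> and for \<open>\<phi>(q)\<close> have the same defect, by the derivative
of the preceding identity.
\<close>

lemma halphen: "8 * qD alpha = 16 * alpha ^ 2 - phi ^ 4 * (phi ^ 4 - phi_neg ^ 4)"
proof -
  define Y where "Y = 8 * qD alpha - 16 * alpha ^ 2 + phi ^ 4 * (phi ^ 4 - phi_neg ^ 4)"
  have 1: "4 * (qD gamma - qD alpha) = 4 * (gamma * phi ^ 4 - alpha * phi_neg ^ 4)"
    using arg_cong[OF jacobi_logder, of qD] qD_power[OF qD_phis(1), of 4] qD_power[OF qD_phis(2), of 4]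
    unfolding qD_simps by (simp add: right_diff_distrib mult.assoc)
  have 2: "8 * fps_dilate 2 (qD alpha) = qD alpha + qD gamma"
    using arg_cong[OF alpha_dilate, of qD] by (simp add: qD_dilate)
  have 3: "16 * (fps_dilate 2 phi ^ 4 * (fps_dilate 2 phi ^ 4 - fps_dilate 2 phi_neg ^ 4)) =
      (phi ^ 4 - phi_neg ^ 4) ^ 2"
  proof -
    have "16 * (fps_dilate 2 phi ^ 4 * (fps_dilate 2 phi ^ 4 - fps_dilate 2 phi_neg ^ 4)) =
      (2 * fps_dilate 2 phi ^ 2) ^ 2 * ((2 * fps_dilate 2 phi ^ 2) ^ 2 - 4 * (fps_dilate 2 phi_neg ^ 2) ^ 2)"
      by algebra
    thus ?thesis unfolding phi_squares[symmetric] phi_neg_mult_phi[symmetric] by algebra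
  qed
  have Y2: "fps_dilate 2 Y = 8 * fps_dilate 2 (qD alpha) - 16 * fps_dilate 2 alpha ^ 2 +
      fps_dilate 2 phi ^ 4 * (fps_dilate 2 phi ^ 4 - fps_dilate 2 phi_neg ^ 4)"
    by (simp add: Y_def)
  have "16 * fps_dilate 2 Y = 16 * (8 * fps_dilate 2 (qD alpha)) - 16 * (4 * fps_dilate 2 alpha) ^ 2 +
     16 * (fps_dilate 2 phi ^ 4 * (fps_dilate 2 phi ^ 4 - fps_dilate 2 phi_neg ^ 4))"
    unfolding Y2 by algebra
  also have "\<dots> = 4 * Y"
    unfolding 3 2 alpha_dilate Y_def using 1 jacobi_logder by algebra
  finally have "4 * (4 * fps_dilate 2 Y) = 4 * Y" by simp
  hence "Y = fps_const 4 * fps_dilate 2 Y" by (simp add: numeral_fps_const)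
  hence "Y = 0" by (rule dilate_descent) simp
  thus ?thesis unfolding Y_def by algebra
qed

text \<open>
Forms for \<open>\<Gamma>\<^sub>0(2)\<close>: \<open>P\<close> and \<open>Q\<close> have weight 4 and \<open>A\<close>
has weight 2. In terms of the products, \<open>P = E\<^sub>1\<^sup>1\<^sup>6 / E\<^sub>2\<^sup>8\<close> and \<open>Q
= q E\<^sub>2\<^sup>1\<^sup>6 / E\<^sub>1\<^sup>8\<close>.
\<close>

definition "modP = phi_neg ^ 8"
definition "modQ = fps_X * psi ^ 8"
definition "modA = 2 * phi ^ 4 - phi_neg ^ 4"

lemma modQ_16: "16 * modQ = phi ^ 4 * (phi ^ 4 - phi_neg ^ 4)"
  using psi_power_8 by (simp add: modQ_def mult.assoc)

lemma modA_square: "modA ^ 2 = modP + 64 * modQ"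
  using modQ_16 unfolding modA_def modP_def by algebra

lemma qD_alpha: "qD alpha = 2 * alpha ^ 2 - 2 * modQ"
proof -
  have "8 * qD alpha = 8 * (2 * alpha ^ 2 - 2 * modQ)"
    using halphen modQ_16 by algebra
  thus ?thesis by (rule numeral_cancel)
qed

lemma qD_phi4: "qD (phi ^ 4) = 4 * gamma * phi ^ 4" "qD (phi_neg ^ 4) = 4 * alpha * phi_neg ^ 4"
  using qD_power[OF qD_phis(1), of 4] qD_power[OF qD_phis(2), of 4] by simp_all

lemma qD_modQ: "qD modQ = (8 * alpha + modA) * modQ"
proof -
  have "16 * qD modQ = qD (16 * modQ)" by simp
  also have "\<dots> = 4 * gamma * phi ^ 4 * (phi ^ 4 - phi_neg ^ 4) + phi ^ 4 * (4 * gamma * phi ^ 4 - 4 * alpha *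
        phi_neg ^ 4)"
    unfolding modQ_16 qD_mult qD_simps qD_phi4 by simp
  also have "\<dots> = 16 * ((8 * alpha + modA) * modQ)"
    using modQ_16 jacobi_logder unfolding modA_def by algebra
  finally show ?thesis by simp
qed

lemma qD_modA: "qD modA = 4 * alpha * modA + 32 * modQ"
proof -
  have "qD modA = 2 * (4 * gamma * phi ^ 4) - 4 * alpha * phi_neg ^ 4"
    unfolding modA_def qD_simps qD_phi4 by simp
  thus ?thesis using modQ_16 jacobi_logder unfolding modA_def by algebra
qed

section \<open>Cubic modular equations\<close>

text \<open>
In what follows the digit attached to a letter is the dilation factor; \<open>a\<close>, \<open>b\<close>,
\<open>v\<close> stand for \<open>\<phi>(-q)\<close>, \<open>\<psi>(q)\<close> and \<open>pent\<close>.
\<close>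

abbreviation "a3 \<equiv> fps_dilate 3 phi_neg"
abbreviation "b3 \<equiv> fps_dilate 3 psi"
abbreviation "a9 \<equiv> fps_dilate 9 phi_neg"
abbreviation "b9 \<equiv> fps_dilate 9 psi"
abbreviation "v3 \<equiv> fps_dilate 3 pent"

text \<open>
Elimination of \<open>omega_neg\<close>: after multiplication by \<open>v(q\<^sup>3)\<close> both dissections are
linear in the same two series \<open>v(q\<^sup>3)\<close> and \<open>q \<psi>(q\<^sup>9)\<close>.
\<close>

lemma phi_neg_3_dissection': "phi_neg * v3 = a9 * (v3 - 2 * fps_X * b9)"
proof -
  have "fps_dilate 3 (omega_neg * pent) = fps_dilate 3 (a3 * b3)" by (simp only: omega_neg_mult_pent)
  hence "fps_dilate 3 omega_neg * v3 = a9 * b9" by (simp add: fps_dilate_dilate)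
  thus ?thesis using phi_neg_3_dissection by algebra
qed

lemma pent_cube_dilate: "v3 ^ 3 * a3 = a9 ^ 3 * b3"
proof -
  have "fps_dilate 3 (pent ^ 3 * phi_neg) = fps_dilate 3 (a3 ^ 3 * psi)" by (simp only: pent_cube)
  thus ?thesis by (simp add: fps_dilate_dilate)
qed

text \<open>
Let \<open>R\<^sub>a\<close> and \<open>R\<^sub>b\<close> be the defects of the two equations. The 3-dissections
express \<open>\<phi>(-q)\<close> and \<open>\<psi>(q)\<close> through series in \<open>q\<^sup>3\<close>, and
substituting them writes each defect, up to a unit factor, as a linear combination of
\<open>R\<^sub>a(q\<^sup>3)\<close> and \<open>R\<^sub>b(q\<^sup>3)\<close>. So if both defects vanish up to order
\<open>N\<close> they vanish up to a higher order.
\<close>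

lemma cubic_modular_equations:
  "phi_neg ^ 3 * psi = a3 * (pent ^ 3 - 8 * fps_X * b3 ^ 3)"
  "psi ^ 4 = b3 * (pent ^ 3 + fps_X * b3 ^ 3)"
proof -
  let ?a = phi_neg and ?b = psi and ?X = "fps_X :: int fps"
  define Ra where "Ra = ?a ^ 3 * ?b - a3 * (pent ^ 3 - 8 * ?X * b3 ^ 3)"
  define Rb where "Rb = ?b ^ 4 - b3 * (pent ^ 3 + ?X * b3 ^ 3)"
  define Ra3 where "Ra3 = fps_dilate 3 Ra"
  define Rb3 where "Rb3 = fps_dilate 3 Rb"
  define u where "u = ?X * b9"
  have Ra3: "a3 ^ 3 * b3 = Ra3 + a9 * (v3 ^ 3 - 8 * u ^ 3)"
    unfolding Ra3_def Ra_def u_def by (simp add: fps_dilate_dilate power_mult_distrib mult_ac)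
  have Rb3: "b3 ^ 4 = Rb3 + b9 * (v3 ^ 3 + u ^ 3)"
    unfolding Rb3_def Rb_def u_def by (simp add: fps_dilate_dilate power_mult_distrib mult_ac)
  have av: "?a * v3 = a9 * (v3 - 2 * u)" unfolding u_def using phi_neg_3_dissection' by algebra
  have b: "?b = v3 + u" unfolding u_def by (rule psi_3_dissection)
  have 1: "a3 ^ 4 * v3 ^ 3 = a9 ^ 3 * (Ra3 + a9 * (v3 ^ 3 - 8 * u ^ 3))"
    unfolding Ra3[symmetric] using pent_cube_dilate by algebra
  have 2: "a3 * b3 ^ 3 * v3 ^ 3 = a9 ^ 3 * (Rb3 + b9 * (v3 ^ 3 + u ^ 3))"
    unfolding Rb3[symmetric] using pent_cube_dilate by algebra
  have "Ra * (?a * v3 ^ 4) = (?a * v3) ^ 4 * ?b - ?b * v3 * (a3 ^ 4 * v3 ^ 3) + 8 * ?X * (?a * v3) * (a3 * b3 ^ 3 * v3 ^ 3)"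
  proof -
    have "?a * pent ^ 3 = a3 ^ 3 * ?b" using pent_cube by (simp add: mult.commute)
    thus ?thesis unfolding Ra_def by algebra
  qed
  also have "\<dots> = Ra3 * (- ?b * v3 * a9 ^ 3) + Rb3 * (8 * ?X * a9 ^ 4 * (v3 - 2 * u))"
    unfolding 1 2 av using b u_def by algebra
  finally have A: "Ra * (?a * v3 ^ 4) = Ra3 * (- ?b * v3 * a9 ^ 3) + Rb3 * (8 * ?X * a9 ^ 4 * (v3 - 2 * u))" .
  have "Rb * (?a * v3) = (?a * v3) * ?b ^ 4 - v3 * ?b * (a3 ^ 3 * b3) - ?X * (?a * v3) * b3 ^ 4"
    unfolding Rb_def using pent_cube by algebra
  also have "\<dots> = Ra3 * (- v3 * ?b) + Rb3 * (- ?X * a9 * (v3 - 2 * u))"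
    unfolding Ra3 Rb3 av using b u_def by algebra
  finally have B: "Rb * (?a * v3) = Ra3 * (- v3 * ?b) + Rb3 * (- ?X * a9 * (v3 - 2 * u))" .
  have "agree N Ra 0 \<and> agree N Rb 0" for N
  proof (induction N)
    case 0
    show ?case by (simp add: agree_def Ra_def Rb_def fps_power_zeroth)
  next
    case (Suc N)
    have "agree (Suc N) (fps_dilate 3 f) 0" if "agree N f 0" for f :: "int fps"
      using that by (auto simp: agree_def fps_dilate_nth elim!: dvdE)
    hence R3: "agree (Suc N) Ra3 0" "agree (Suc N) Rb3 0" using Suc by (simp_all add: Ra3_def Rb3_def)
    have "agree (Suc N) (Ra * (?a * v3 ^ 4)) (0 * (- ?b * v3 * a9 ^ 3) + 0 * (8 * ?X * a9 ^ 4 * (v3 - 2 * u)))"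
      unfolding A by (intro agree_add agree_mult[OF R3(1) agree_refl] agree_mult[OF R3(2) agree_refl])
    hence "agree (Suc N) (Ra * (?a * v3 ^ 4)) (0 * (?a * v3 ^ 4))" by simp
    moreover have "agree (Suc N) (Rb * (?a * v3)) (0 * (- v3 * ?b) + 0 * (- ?X * a9 * (v3 - 2 * u)))"
      unfolding B by (intro agree_add agree_mult[OF R3(1) agree_refl] agree_mult[OF R3(2) agree_refl])
    hence "agree (Suc N) (Rb * (?a * v3)) (0 * (?a * v3))" by simp
    ultimately show ?case 
      using agree_cancel[of "Suc N" Ra "?a * v3 ^ 4" 0] agree_cancel[of "Suc N" Rb "?a * v3" 0] 
      by (simp add: fps_power_zeroth)
  qed
  hence "Ra = 0" "Rb = 0" by (auto intro: agree_all)
  thus "?a ^ 3 * ?b = a3 * (pent ^ 3 - 8 * ?X * b3 ^ 3)" "?b ^ 4 = b3 * (pent ^ 3 + ?X * b3 ^ 3)"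
    by (simp_all add: Ra_def Rb_def)
qed

abbreviation "mu \<equiv> pent ^ 3"
abbreviation "nu \<equiv> fps_X * b3 ^ 3"

text \<open>
The cubic modular equations parametrise everything by the two series \<open>\<mu> = v\<^sup>3\<close> and \<open>\<nu>
= q b(q\<^sup>3)\<^sup>3\<close>. Their quotient \<open>\<nu> / \<mu>\<close> is a Hauptmodul for
\<open>\<Gamma>\<^sub>0(6)\<close>, so identities of level 6 become polynomial identities in \<open>\<mu>\<close> and
\<open>\<nu>\<close>.
\<close>

lemma mu_nu: "mu ^ 3 * (mu - 8 * nu) = a3 ^ 8 * b3 * (mu + nu)"
proof -
  have "a3 * (mu ^ 3 * (mu - 8 * nu)) = a3 * (a3 ^ 8 * b3 * (mu + nu))"
    using pent_cube cubic_modular_equations by algebra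
  thus ?thesis by simp
qed

text \<open>
Used to extract square roots: \<open>A\<close> is known only through its square.
\<close>

lemma square_eq_const_term:
  fixes f g :: "int fps"
  assumes "f ^ 2 = g ^ 2" "f $ 0 = g $ 0" "g $ 0 \<noteq> 0"
  shows "f = g"
proof -
  have "(f - g) * (f + g) = 0" using assms(1) by algebra
  moreover have "(f + g) $ 0 \<noteq> 0" using assms by simp
  hence "f + g \<noteq> 0" by (metis fps_zero_nth)
  ultimately show ?thesis by simp
qed

text \<open>
The square of the left-hand side is \<open>\<mu> (\<mu> - 8\<nu>)\<^sup>3 + 64 \<nu> (\<mu> + \<nu>)\<^sup>3\<close>,
which happens to be a perfect square.
\<close>

lemma modA_cubic: "psi ^ 2 * modA = mu ^ 2 + 20 * mu * nu - 8 * nu ^ 2"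
proof (rule square_eq_const_term)
  have "mu ^ 2 * (phi_neg ^ 8 * psi ^ 4) = (mu * phi_neg) ^ 2 * phi_neg ^ 6 * psi ^ 4" by algebra
  also have "\<dots> = a3 ^ 6 * (phi_neg ^ 3 * psi) ^ 2 * psi ^ 4" unfolding pent_cube by algebra
  also have "\<dots> = (mu - 8 * nu) ^ 2 * (a3 ^ 8 * b3 * (mu + nu))"
    unfolding cubic_modular_equations by algebra
  also have "\<dots> = mu ^ 2 * (mu * (mu - 8 * nu) ^ 3)"
    unfolding mu_nu[symmetric] by algebra
  finally have 1: "phi_neg ^ 8 * psi ^ 4 = mu * (mu - 8 * nu) ^ 3"
    by (simp only: mult_cancel_left) simp
  have "(psi ^ 2 * modA) ^ 2 = psi ^ 4 * modA ^ 2" by algebra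
  also have "\<dots> = phi_neg ^ 8 * psi ^ 4 + 64 * fps_X * (psi ^ 4) ^ 3"
    unfolding modA_square modP_def modQ_def by algebra
  also have "\<dots> = (mu ^ 2 + 20 * mu * nu - 8 * nu ^ 2) ^ 2"
    unfolding 1 unfolding cubic_modular_equations(2) by algebra
  finally show "(psi ^ 2 * modA) ^ 2 = (mu ^ 2 + 20 * mu * nu - 8 * nu ^ 2) ^ 2" .
qed (simp_all add: fps_power_zeroth modA_def)

text \<open>
Here the square is \<open>\<mu>\<^sup>3 (\<mu> - 8\<nu>) + 64 \<nu>\<^sup>3 (\<mu> + \<nu>)\<close>, again a perfect
square.
\<close>

lemma modA_cubic_dilate: "psi ^ 2 * fps_dilate 3 modA = mu ^ 2 - 4 * mu * nu - 8 * nu ^ 2"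
proof (rule square_eq_const_term)
  have "fps_dilate 3 (modA ^ 2) = fps_dilate 3 (modP + 64 * modQ)" by (simp only: modA_square)
  hence "fps_dilate 3 modA ^ 2 = a3 ^ 8 + 64 * fps_X ^ 3 * b3 ^ 8"
    by (simp add: modP_def modQ_def mult_ac)
  hence "(psi ^ 2 * fps_dilate 3 modA) ^ 2 = psi ^ 4 * (a3 ^ 8 + 64 * fps_X ^ 3 * b3 ^ 8)"
    by (simp add: power_mult_distrib flip: power_mult)
  also have "\<dots> = a3 ^ 8 * b3 * (mu + nu) + 64 * nu ^ 3 * (mu + nu)"
    unfolding cubic_modular_equations(2) by algebra
  also have "\<dots> = (mu ^ 2 - 4 * mu * nu - 8 * nu ^ 2) ^ 2"
    unfolding mu_nu[symmetric] by algebra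
  finally show "(psi ^ 2 * fps_dilate 3 modA) ^ 2 = (mu ^ 2 - 4 * mu * nu - 8 * nu ^ 2) ^ 2" .
qed (simp_all add: fps_power_zeroth modA_def)

section \<open>Extraction of residue classes modulo 3\<close>

text \<open>
Extraction of the coefficients at the exponents \<open>3 n + r\<close>. It is linear over the series in
\<open>q\<^sup>3\<close>, so a dissection into powers of \<open>q\<close> times such series determines it.
\<close>

definition fps_section :: "nat \<Rightarrow> 'a::comm_ring_1 fps \<Rightarrow> 'a fps" where
  "fps_section r f = Abs_fps (\<lambda>n. f $ (3 * n + r))"

lemma fps_section_nth: "fps_section r f $ n = f $ (3 * n + r)"
  by (simp add: fps_section_def)

lemma fps_section_add: "fps_section r (f + g) = fps_section r f + fps_section r g"
  and fps_section_diff: "fps_section r (f - g) = fps_section r f - fps_section r g"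
  and fps_section_numeral: "fps_section r (numeral k * f) = numeral k * fps_section r f"
  and fps_section_of_int: "fps_section r (of_int j * f) = of_int j * fps_section r f"
  by (simp_all add: fps_eq_iff fps_section_nth flip: fps_of_int)

lemma fps_section_sum: "fps_section r (sum f A) = (\<Sum>i\<in>A. fps_section r (f i))"
  by (simp add: fps_eq_iff fps_section_nth fps_sum_nth)

lemma fps_section_X: 
  "fps_section (Suc r) (fps_X * f) = fps_section r f"
  "fps_section 0 (fps_X * f) = fps_X * fps_section 2 f"
proof -
  have "3 * n - Suc 0 = 3 * (n - Suc 0) + 2" if "n > 0" for n :: nat using that by simp
  thus "fps_section 0 (fps_X * f) = fps_X * fps_section 2 f"
    by (simp add: fps_eq_iff fps_section_nth)
qed (simp add: fps_eq_iff fps_section_nth)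

lemma fps_section_dilate_mult:
  assumes "r < 3"
  shows "fps_section r (fps_dilate 3 g * f) = g * fps_section r f"
proof (rule fps_ext)
  fix n
  have "fps_section r (fps_dilate 3 g * f) $ n =
      (\<Sum>i\<in>{i. i \<le> 3 * n + r \<and> 3 dvd i}. g $ (i div 3) * f $ (3 * n + r - i))"
    unfolding fps_section_nth fps_mult_nth
    by (rule sum.mono_neutral_cong_right) (auto simp: fps_dilate_nth)
  also have "\<dots> = (\<Sum>i=0..n. g $ i * f $ (3 * (n - i) + r))"
  proof (rule sum.reindex_bij_witness[of _ "\<lambda>i. 3 * i" "\<lambda>i. i div 3"])
    fix i assume i: "i \<in> {i. i \<le> 3 * n + r \<and> 3 dvd i}"
    then obtain j where j: "i = 3 * j" by auto
    hence "j \<le> n" using i assms by simp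
    thus "i div 3 \<in> {0..n}" "3 * (i div 3) = i"
      "g $ (i div 3) * f $ (3 * (n - i div 3) + r) = g $ (i div 3) * f $ (3 * n + r - i)"
      using j by (simp_all add: diff_mult_distrib2)
  qed auto
  also have "\<dots> = (g * fps_section r f) $ n"
    by (simp add: fps_mult_nth fps_section_nth)
  finally show "fps_section r (fps_dilate 3 g * f) $ n = (g * fps_section r f) $ n" .
qed

lemma fps_section_X_power:
  assumes "r < 3"
  shows "fps_section r (fps_X ^ j) = (if j mod 3 = r then fps_X ^ (j div 3) else 0)"
proof -
  have "3 * n + r = j \<longleftrightarrow> j mod 3 = r \<and> n = j div 3" for n using assms by auto
  thus ?thesis by (auto simp: fps_eq_iff fps_section_nth)
qed

text \<open>
By the dissections, \<open>v(q\<^sup>3)\<^sup>s a\<^sup>s b\<^sup>t\<close> is \<open>a(q\<^sup>9)\<^sup>s\<close>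
times the binary form \<open>(v - 2u)\<^sup>s (v + u)\<^sup>t\<close> evaluated at \<open>v(q\<^sup>3)\<close> and
\<open>u = q b(q\<^sup>9)\<close>. The exponent of \<open>u\<close> modulo 3 is the exponent of \<open>q\<close>
modulo 3, so the section picks every third coefficient of that form; the list \<open>cs\<close> contains these
coefficients.
\<close>

lemma section_theta_monomial:
  assumes "r < 3" and 
    expand: "\<And>u v :: int fps. (v - 2 * u) ^ s * (v + u) ^ t = (\<Sum>n\<le>s+t. of_int (cs ! n) * (v ^ (s + t -
        n) * u ^ n))"
  shows "pent ^ s * fps_section r (phi_neg ^ s * psi ^ t) =
    a3 ^ s * (\<Sum>n\<le>s+t. if n mod 3 = r then of_int (cs ! n) * (pent ^ (s + t - n) * (fps_X ^ (n div 3) * b3 ^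
        n)) else 0)"
proof -
  define u where "u = fps_X * b9"
  have "pent ^ s * fps_section r (phi_neg ^ s * psi ^ t) = fps_section r (fps_dilate 3 (pent ^ s) * (phi_neg ^ s * psi ^ t))"
    using assms(1) by (simp only: fps_section_dilate_mult)
  also have "fps_dilate 3 (pent ^ s) * (phi_neg ^ s * psi ^ t) = (phi_neg * v3) ^ s * psi ^ t"
    by (simp add: power_mult_distrib)
  also have "\<dots> = a9 ^ s * ((v3 - 2 * u) ^ s * (v3 + u) ^ t)"
    unfolding phi_neg_3_dissection' by (subst psi_3_dissection) (simp add: u_def power_mult_distrib mult.assoc)
  also have "\<dots> = fps_dilate 3 (a3 ^ s) * (\<Sum>n\<le>s+t. of_int (cs ! n) * (fps_dilate 3 (pent ^ (s + t - n)
        * b3 ^ n) * fps_X ^ n))"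
    unfolding expand by (simp add: fps_dilate_dilate u_def power_mult_distrib mult_ac)
  finally have "pent ^ s * fps_section r (phi_neg ^ s * psi ^ t) =
    fps_section r (fps_dilate 3 (a3 ^ s) * (\<Sum>n\<le>s+t. of_int (cs ! n) * (fps_dilate 3 (pent ^ (s + t - n) * b3
        ^ n) * fps_X ^ n)))" .
  also have "\<dots> = a3 ^ s * (\<Sum>n\<le>s+t. of_int (cs ! n) * (pent ^ (s + t - n) * b3 ^ n * fps_section r
        (fps_X ^ n)))"
    using assms(1) by (simp only: fps_section_dilate_mult fps_section_sum fps_section_of_int)
  also have "\<dots> = a3 ^ s * (\<Sum>n\<le>s+t. if n mod 3 = r then of_int (cs ! n) * (pent ^ (s + t - n) * (fps_X
        ^ (n div 3) * b3 ^ n)) else 0)"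
    using assms(1) by (intro arg_cong2[of _ _ _ _ "(*)"] refl sum.cong) (simp_all add: fps_section_X_power mult_ac)
  finally show ?thesis .
qed

text \<open>
The five instances that are needed. The lists are the coefficients of the expanded binary forms. In the first two
instances every third coefficient gives a form in \<open>\<mu>, \<nu>\<close> that splits into a part divisible by
\<open>(\<mu> - 8\<nu>) (\<mu> + \<nu>)\<close> and a single monomial with coefficient \<open>-3\<^sup>8\<close>; this
splitting becomes the Hecke relation.
\<close>

lemma section_13_5:
  "pent ^ 13 * fps_section 2 (phi_neg ^ 13 * psi ^ 5) = a3 ^ 13 * (pent * b3 ^ 2 * (192 * (mu - 8 * nu) * (mu + nu) ^
        2 * (mu ^ 2 + 20 * mu * nu - 8 * nu ^ 2) - 6561 * mu ^ 4 * nu))"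
proof -
  let ?cs = "[1, -21, 192, -978, 2865, -3873, -3042, 20904, -27456, -11440, 68640, -49920, -49920, 88320, -7680,
        -55296, 24576, 12288, -8192]"
  have expand: "(v - 2 * u) ^ 13 * (v + u) ^ 5 = (\<Sum>n\<le>13+5. of_int (?cs ! n) * (v ^ (13 + 5 - n) * u ^ n))"
    for u v :: "int fps"
    by (simp add: atMost_nat_numeral atMost_Suc) algebra
  have "(\<Sum>n\<le>13+5. if n mod 3 = 2 then of_int (?cs ! n) * (pent ^ (13 + 5 - n) * (fps_X ^ (n div 3) * b3 ^
        n)) else 0)
     = pent * b3 ^ 2 * (192 * (mu - 8 * nu) * (mu + nu) ^ 2 * (mu ^ 2 + 20 * mu * nu - 8 * nu ^ 2) - 6561 * mu ^ 4 * nu)"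
    by (simp add: atMost_nat_numeral atMost_Suc) algebra
  thus ?thesis
    using section_theta_monomial[OF _ expand, of 2] by (simp only:)
qed

lemma section_5_13:
  "pent ^ 5 * fps_section 1 (phi_neg ^ 5 * psi ^ 13) = a3 ^ 5 * (pent ^ 2 * b3 * (3 * (mu - 8 * nu) ^ 2 * (mu + nu) *
        (mu ^ 2 + 20 * mu * nu - 8 * nu ^ 2) - 6561 * mu * nu ^ 4))"
proof -
  let ?cs = "[1, 3, -12, -54, 15, 345, 390, -780, -2145, -715, 3432, 5226, 1521, -3873, -5730, -3912, -1536, -336, -32]"
  have expand: "(v - 2 * u) ^ 5 * (v + u) ^ 13 = (\<Sum>n\<le>5+13. of_int (?cs ! n) * (v ^ (5 + 13 - n) * u ^ n))"
    for u v :: "int fps"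
    by (simp add: atMost_nat_numeral atMost_Suc) algebra
  have "(\<Sum>n\<le>5+13. if n mod 3 = 1 then of_int (?cs ! n) * (pent ^ (5 + 13 - n) * (fps_X ^ (n div 3) * b3 ^
        n)) else 0)
     = pent ^ 2 * b3 * (3 * (mu - 8 * nu) ^ 2 * (mu + nu) * (mu ^ 2 + 20 * mu * nu - 8 * nu ^ 2) - 6561 * mu * nu ^ 4)"
    by (simp add: atMost_nat_numeral atMost_Suc) algebra
  thus ?thesis
    using section_theta_monomial[OF _ expand, of 1] by (simp only:)
qed

lemma section_5_7:
  "pent ^ 5 * fps_section 1 (phi_neg ^ 5 * psi ^ 7) = a3 ^ 5 * (pent ^ 2 * b3 * (-3 * mu ^ 3 + 45 * mu ^ 2 * nu + 99
        * mu * nu ^ 2 - 192 * nu ^ 3))"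
proof -
  let ?cs = "[1, -3, -9, 25, 45, -81, -147, 99, 270, 40, -192, -144, -32]"
  have expand: "(v - 2 * u) ^ 5 * (v + u) ^ 7 = (\<Sum>n\<le>5+7. of_int (?cs ! n) * (v ^ (5 + 7 - n) * u ^ n))"
    for u v :: "int fps"
    by (simp add: atMost_nat_numeral atMost_Suc) algebra
  have "(\<Sum>n\<le>5+7. if n mod 3 = 1 then of_int (?cs ! n) * (pent ^ (5 + 7 - n) * (fps_X ^ (n div 3) * b3 ^ n)) else 0)
     = pent ^ 2 * b3 * (-3 * mu ^ 3 + 45 * mu ^ 2 * nu + 99 * mu * nu ^ 2 - 192 * nu ^ 3)"
    by (simp add: atMost_nat_numeral atMost_Suc) algebra
  thus ?thesis
    using section_theta_monomial[OF _ expand, of 1] by (simp only:)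
qed

lemma section_6_6:
  "pent ^ 6 * fps_section 0 (phi_neg ^ 6 * psi ^ 6) = a3 ^ 6 * (mu ^ 4 + 40 * mu ^ 3 * nu + 141 * mu ^ 2 * nu ^ 2 -
        320 * mu * nu ^ 3 + 64 * nu ^ 4)"
proof -
  let ?cs = "[1, -6, 3, 40, -45, -126, 141, 252, -180, -320, 48, 192, 64]"
  have expand: "(v - 2 * u) ^ 6 * (v + u) ^ 6 = (\<Sum>n\<le>6+6. of_int (?cs ! n) * (v ^ (6 + 6 - n) * u ^ n))"
    for u v :: "int fps"
    by (simp add: atMost_nat_numeral atMost_Suc) algebra
  have "(\<Sum>n\<le>6+6. if n mod 3 = 0 then of_int (?cs ! n) * (pent ^ (6 + 6 - n) * (fps_X ^ (n div 3) * b3 ^ n)) else 0)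
     = mu ^ 4 + 40 * mu ^ 3 * nu + 141 * mu ^ 2 * nu ^ 2 - 320 * mu * nu ^ 3 + 64 * nu ^ 4"
    by (simp add: atMost_nat_numeral atMost_Suc) algebra
  thus ?thesis
    using section_theta_monomial[OF _ expand, of 0] by (simp only:)
qed

lemma section_7_5:
  "pent ^ 7 * fps_section 2 (phi_neg ^ 7 * psi ^ 5) = a3 ^ 7 * (pent * b3 ^ 2 * (24 * mu ^ 3 + 99 * mu ^ 2 * nu - 360
        * mu * nu ^ 2 - 192 * nu ^ 3))"
proof -
  let ?cs = "[1, -9, 24, 10, -135, 99, 294, -324, -360, 400, 288, -192, -128]"
  have expand: "(v - 2 * u) ^ 7 * (v + u) ^ 5 = (\<Sum>n\<le>7+5. of_int (?cs ! n) * (v ^ (7 + 5 - n) * u ^ n))"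
    for u v :: "int fps"
    by (simp add: atMost_nat_numeral atMost_Suc) algebra
  have "(\<Sum>n\<le>7+5. if n mod 3 = 2 then of_int (?cs ! n) * (pent ^ (7 + 5 - n) * (fps_X ^ (n div 3) * b3 ^ n)) else 0)
     = pent * b3 ^ 2 * (24 * mu ^ 3 + 99 * mu ^ 2 * nu - 360 * mu * nu ^ 2 - 192 * nu ^ 3)"
    by (simp add: atMost_nat_numeral atMost_Suc) algebra
  thus ?thesis
    using section_theta_monomial[OF _ expand, of 2] by (simp only:)
qed

section \<open>The action of the Hecke operator at 3\<close>

text \<open>
Up to a power of \<open>q\<close>, \<open>heckeF\<close> and \<open>heckeG\<close> are \<open>(\<eta>(z)
\<eta>(2z))\<^sup>5\<close> times the forms \<open>P\<close> and \<open>Q\<close> of weight 4, and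
\<open>heckeB\<close> is \<open>(\<eta>(z) \<eta>(2z))\<^sup>7\<close> times \<open>A\<close>: all three have weight
9.
\<close>

definition "heckeF = phi_neg ^ 13 * psi ^ 5"
definition "heckeG = fps_X * (phi_neg ^ 5 * psi ^ 13)"
definition "heckeB = (phi_neg * psi) ^ 7 * modA"

lemma heckeB_cubic: "heckeB = phi_neg ^ 7 * psi ^ 5 * (mu ^ 2 + 20 * mu * nu - 8 * nu ^ 2)"
  unfolding heckeB_def modA_cubic[symmetric] by algebra

lemma phi_neg_mu: "phi_neg * mu = a3 ^ 3 * psi"
  using pent_cube by (simp add: mult.commute)

text \<open>
Multiplied by \<open>\<mu>\<^sup>4\<close>, both sides become \<open>a(q\<^sup>3)\<^sup>1\<^sup>3
b(q\<^sup>3)\<^sup>2\<close> times a form of degree 5 in \<open>\<mu>\<close> and \<open>\<nu>\<close>.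
\<close>

lemma section_heckeF: "fps_section 2 heckeF = 192 * heckeB - 6561 * fps_X * fps_dilate 3 heckeF"
proof -
  let ?U = "fps_section 2 heckeF"
  let ?S = "mu ^ 2 + 20 * mu * nu - 8 * nu ^ 2"
  have "pent * (mu ^ 4 * ?U) = pent ^ 13 * ?U" by algebra
  also have "\<dots> = pent * (a3 ^ 13 * b3 ^ 2 * (192 * (mu - 8 * nu) * (mu + nu) ^ 2 * ?S - 6561 * mu ^ 4 * nu))"
    unfolding heckeF_def section_13_5 by algebra
  finally have 1: "mu ^ 4 * ?U = a3 ^ 13 * b3 ^ 2 * (192 * (mu - 8 * nu) * (mu + nu) ^ 2 * ?S - 6561 * mu ^ 4 * nu)"
    by (simp only: mult_cancel_left) simp
  have "mu ^ 4 * (phi_neg ^ 7 * psi ^ 5) = (phi_neg * mu) ^ 4 * phi_neg ^ 3 * psi ^ 5" by algebra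
  also have "\<dots> = a3 ^ 12 * (phi_neg ^ 3 * psi) * (psi ^ 4) ^ 2" unfolding phi_neg_mu by algebra
  also have "\<dots> = a3 ^ 13 * b3 ^ 2 * ((mu - 8 * nu) * (mu + nu) ^ 2)"
    unfolding cubic_modular_equations by algebra
  finally have 2: "mu ^ 4 * (phi_neg ^ 7 * psi ^ 5) = a3 ^ 13 * b3 ^ 2 * ((mu - 8 * nu) * (mu + nu) ^ 2)" .
  have 3: "fps_dilate 3 heckeF = a3 ^ 13 * b3 ^ 5" by (simp add: heckeF_def)
  have "mu ^ 4 * ?U = 192 * (mu ^ 4 * (phi_neg ^ 7 * psi ^ 5)) * ?S - 6561 * mu ^ 4 * fps_X * (a3 ^ 13 * b3 ^ 5)"
    unfolding 1 2 by algebra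
  also have "\<dots> = mu ^ 4 * (192 * heckeB - 6561 * fps_X * fps_dilate 3 heckeF)"
    unfolding heckeB_cubic 3 by algebra
  finally show ?thesis by (simp only: mult_cancel_left) simp
qed

lemma section_heckeG: "fps_section 2 heckeG = 3 * heckeB - 6561 * fps_X * fps_dilate 3 heckeG"
proof -
  let ?U = "fps_section 2 heckeG"
  let ?S = "mu ^ 2 + 20 * mu * nu - 8 * nu ^ 2"
  have U: "?U = fps_section 1 (phi_neg ^ 5 * psi ^ 13)"
    using fps_section_X(1)[of 1] by (simp add: heckeG_def numeral_2_eq_2)
  have "pent ^ 2 * (mu * ?U) = pent ^ 5 * ?U" by algebra
  also have "\<dots> = pent ^ 2 * (a3 ^ 5 * b3 * (3 * (mu - 8 * nu) ^ 2 * (mu + nu) * ?S - 6561 * mu * nu ^ 4))"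
    unfolding U section_5_13 by algebra
  finally have 1: "mu * ?U = a3 ^ 5 * b3 * (3 * (mu - 8 * nu) ^ 2 * (mu + nu) * ?S - 6561 * mu * nu ^ 4)"
    by (simp only: mult_cancel_left) simp
  have "mu * (phi_neg ^ 7 * psi ^ 5) = (phi_neg * mu) * phi_neg ^ 6 * psi ^ 5" by algebra
  also have "\<dots> = a3 ^ 3 * (phi_neg ^ 3 * psi) ^ 2 * (psi ^ 4)" unfolding phi_neg_mu by algebra
  also have "\<dots> = a3 ^ 5 * b3 * ((mu - 8 * nu) ^ 2 * (mu + nu))"
    unfolding cubic_modular_equations by algebra
  finally have 2: "mu * (phi_neg ^ 7 * psi ^ 5) = a3 ^ 5 * b3 * ((mu - 8 * nu) ^ 2 * (mu + nu))" .
  have 3: "fps_dilate 3 heckeG = fps_X ^ 3 * (a3 ^ 5 * b3 ^ 13)" by (simp add: heckeG_def)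
  have "mu * ?U = 3 * (mu * (phi_neg ^ 7 * psi ^ 5)) * ?S - 6561 * mu * fps_X * (fps_X ^ 3 * (a3 ^ 5 * b3 ^ 13))"
    unfolding 1 2 by algebra
  also have "\<dots> = mu * (3 * heckeB - 6561 * fps_X * fps_dilate 3 heckeG)"
    unfolding heckeB_cubic 3 by algebra
  finally show ?thesis by (simp only: mult_cancel_left) simp
qed

text \<open>
The series \<open>B\<close> itself is not a monomial in \<open>a\<close> and \<open>b\<close>, but \<open>a\<^sup>2
b\<^sup>2 A\<close> is a combination of \<open>b\<^sup>2\<close>, \<open>q a b\<close> and \<open>q\<^sup>2
a\<^sup>2\<close> with coefficients that are series in \<open>q\<^sup>3\<close>, so its section reduces to three
sections of monomials. Multiplied by \<open>\<mu>\<^sup>2 b\<^sup>2\<close>, all terms become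
\<open>a(q\<^sup>3)\<^sup>7 b(q\<^sup>3)\<close> times a form of degree 6 in \<open>\<mu>\<close> and
\<open>\<nu>\<close>.
\<close>

lemma section_heckeB: 
  "fps_section 1 heckeB = 17 * heckeF + 1088 * heckeG - 6561 * fps_X ^ 2 * fps_dilate 3 heckeB"
proof -
  let ?a = phi_neg and ?b = psi and ?X = "fps_X :: int fps"
  define U1 where "U1 = fps_section 1 (?a ^ 5 * ?b ^ 7)"
  define U0 where "U0 = fps_section 0 (?a ^ 6 * ?b ^ 6)"
  define U2 where "U2 = fps_section 2 (?a ^ 7 * ?b ^ 5)"
  have "heckeB = ?a ^ 5 * ?b ^ 5 * ((?a * mu) ^ 2 + 20 * (?a * mu) * ?a * nu - 8 * ?a ^ 2 * nu ^ 2)"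
    unfolding heckeB_cubic by algebra
  also have "\<dots> = a3 ^ 6 * (?a ^ 5 * ?b ^ 7) + 20 * (a3 ^ 3 * b3 ^ 3 * (?X * (?a ^ 6 * ?b ^ 6)))
      - 8 * (b3 ^ 6 * (?X * (?X * (?a ^ 7 * ?b ^ 5))))"
    unfolding phi_neg_mu by algebra
  also have "\<dots> = fps_dilate 3 (?a ^ 6) * (?a ^ 5 * ?b ^ 7) + 20 * (fps_dilate 3 (?a ^ 3 * ?b ^ 3) * (?X * (?a ^
        6 * ?b ^ 6)))
      - 8 * (fps_dilate 3 (?b ^ 6) * (?X * (?X * (?a ^ 7 * ?b ^ 5))))"
    by simp
  finally have B0: "heckeB = \<dots>" .
  have sec: "1 < (3::nat)" "fps_section 1 (?X * f) = fps_section 0 f" for f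
    using fps_section_X(1)[of 0 f] by simp_all
  have B: "fps_section 1 heckeB = ?a ^ 6 * U1 + 20 * (?a ^ 3 * ?b ^ 3 * U0) - 8 * (?b ^ 6 * (?X * U2))"
    unfolding B0 by (simp only: fps_section_add fps_section_diff fps_section_numeral
        fps_section_dilate_mult[OF sec(1)] sec(2) fps_section_X(2) U0_def U1_def U2_def)
  define G1 where "G1 = - 3 * mu ^ 3 + 45 * mu ^ 2 * nu + 99 * mu * nu ^ 2 - 192 * nu ^ 3"
  define G0 where "G0 = mu ^ 4 + 40 * mu ^ 3 * nu + 141 * mu ^ 2 * nu ^ 2 - 320 * mu * nu ^ 3 + 64 * nu ^ 4"
  define G2 where "G2 = 24 * mu ^ 3 + 99 * mu ^ 2 * nu - 360 * mu * nu ^ 2 - 192 * nu ^ 3"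
  have "pent ^ 2 * (mu * U1) = pent ^ 5 * U1" by algebra
  also have "\<dots> = pent ^ 2 * (a3 ^ 5 * b3 * G1)"
    unfolding U1_def section_5_7 G1_def by algebra
  finally have 1: "mu * U1 = a3 ^ 5 * b3 * G1" by (simp only: mult_cancel_left) simp
  have "mu ^ 2 * U0 = pent ^ 6 * U0" by algebra
  also have "\<dots> = a3 ^ 6 * G0" unfolding U0_def section_6_6 G0_def by (rule refl)
  finally have 0: "mu ^ 2 * U0 = a3 ^ 6 * G0" .
  have "pent * (mu ^ 2 * U2) = pent ^ 7 * U2" by algebra
  also have "\<dots> = pent * (a3 ^ 7 * b3 ^ 2 * G2)"
    unfolding U2_def section_7_5 G2_def by algebra
  finally have 2: "mu ^ 2 * U2 = a3 ^ 7 * b3 ^ 2 * G2" by (simp only: mult_cancel_left) simp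
  have "mu ^ 2 * ?b ^ 2 * fps_section 1 heckeB = (?a ^ 3 * ?b) ^ 2 * mu * (mu * U1)
     + 20 * (?a ^ 3 * ?b) * ?b ^ 4 * (mu ^ 2 * U0) - 8 * ?X * (?b ^ 4) ^ 2 * (mu ^ 2 * U2)"
    unfolding B by algebra
  also have "\<dots> = a3 ^ 7 * b3 * ((mu - 8 * nu) ^ 2 * mu * G1 + 20 * (mu - 8 * nu) * (mu + nu) * G0
      - 8 * nu * (mu + nu) ^ 2 * G2)"
    unfolding 0 1 2 cubic_modular_equations by algebra
  also have "\<dots> = a3 ^ 7 * b3 * (17 * mu * (mu - 8 * nu) ^ 4 * (mu + nu) + 1088 * nu * (mu - 8 * nu) * (mu + nu) ^ 4
      - 6561 * mu ^ 2 * nu ^ 2 * (mu ^ 2 - 4 * mu * nu - 8 * nu ^ 2))"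
    unfolding G0_def G1_def G2_def by algebra
  finally have L: "mu ^ 2 * ?b ^ 2 * fps_section 1 heckeB = \<dots>" .
  have "mu ^ 2 * ?b ^ 2 * heckeF = mu * (?a * mu) * ?a ^ 12 * ?b ^ 7"
    unfolding heckeF_def by algebra
  also have "\<dots> = mu * a3 ^ 3 * (?a ^ 3 * ?b) ^ 4 * ?b ^ 4" unfolding phi_neg_mu by algebra
  also have "\<dots> = a3 ^ 7 * b3 * (mu * (mu - 8 * nu) ^ 4 * (mu + nu))"
    unfolding cubic_modular_equations by algebra
  finally have F: "mu ^ 2 * ?b ^ 2 * heckeF = \<dots>" .
  have "mu ^ 2 * ?b ^ 2 * heckeG = ?X * (?a * mu) ^ 2 * ?a ^ 3 * ?b ^ 15"
    unfolding heckeG_def by algebra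
  also have "\<dots> = ?X * a3 ^ 6 * (?a ^ 3 * ?b) * (?b ^ 4) ^ 4" unfolding phi_neg_mu by algebra
  also have "\<dots> = a3 ^ 7 * b3 * (nu * (mu - 8 * nu) * (mu + nu) ^ 4)"
    unfolding cubic_modular_equations by algebra
  finally have G: "mu ^ 2 * ?b ^ 2 * heckeG = \<dots>" .
  have "mu ^ 2 * ?b ^ 2 * (?X ^ 2 * fps_dilate 3 heckeB) = mu ^ 2 * ?X ^ 2 * a3 ^ 7 * b3 ^ 7 * (?b ^ 2 * fps_dilate 3 modA)"
    unfolding heckeB_def by (simp add: power_mult_distrib mult_ac)
  also have "\<dots> = a3 ^ 7 * b3 * (mu ^ 2 * nu ^ 2 * (mu ^ 2 - 4 * mu * nu - 8 * nu ^ 2))"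
    unfolding modA_cubic_dilate by algebra
  finally have B3: "mu ^ 2 * ?b ^ 2 * (?X ^ 2 * fps_dilate 3 heckeB) = \<dots>" .
  have "mu ^ 2 * ?b ^ 2 * fps_section 1 heckeB = 17 * (mu ^ 2 * ?b ^ 2 * heckeF) + 1088 * (mu ^ 2 * ?b ^ 2 * heckeG)
     - 6561 * (mu ^ 2 * ?b ^ 2 * (?X ^ 2 * fps_dilate 3 heckeB))"
    unfolding L F G B3 by algebra
  also have "\<dots> = mu ^ 2 * ?b ^ 2 * (17 * heckeF + 1088 * heckeG - 6561 * ?X ^ 2 * fps_dilate 3 heckeB)"
    by algebra
  finally show ?thesis by (simp only: mult_cancel_left) simp
qed

text \<open>
The coefficients 9 and 4 are those for which \<open>9 F + 4 G\<close> describes \<open>p\<^sub>2(11 j + 7)\<close>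
modulo 11. For them the multiples of \<open>heckeF\<close> and \<open>heckeG\<close>, \<open>1740 \<cdot> 17 - 6561
\<cdot> 9\<close> and \<open>1740 \<cdot> 1088 - 6561 \<cdot> 4\<close>, are divisible by 11.
\<close>

theorem hecke_mod_11:
  "fps_section 1 (fps_section 2 (9 * heckeF + 4 * heckeG)) =
     11 * (169716 * heckeG - 2679 * heckeF) - 11416140 * fps_X ^ 2 * fps_dilate 3 heckeB"
proof -
  have "fps_section 1 (6561 * (fps_X * fps_dilate 3 f)) = 6561 * f" for f :: "int fps"
  proof -
    have "fps_section 0 (fps_dilate 3 f) = f" by (simp add: fps_eq_iff fps_section_nth fps_dilate_nth)
    thus ?thesis using fps_section_X(1)[of 0 "fps_dilate 3 f"] by (simp add: fps_section_numeral)
  qed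
  hence X: "fps_section 1 (6561 * fps_X * fps_dilate 3 f) = 6561 * f" for f :: "int fps"
    by (simp add: mult.assoc)
  have "fps_section 1 (fps_section 2 (9 * heckeF + 4 * heckeG)) = 
     9 * (192 * fps_section 1 heckeB - 6561 * heckeF) + 4 * (3 * fps_section 1 heckeB - 6561 * heckeG)"
    by (simp only: fps_section_add fps_section_numeral section_heckeF section_heckeG fps_section_diff X)
  thus ?thesis unfolding section_heckeB by algebra
qed

lemma hecke_coeff_mod_11:
  assumes "i mod 3 \<noteq> 2"
  shows "11 dvd (9 * heckeF + 4 * heckeG) $ (9 * i + 5)"
proof -
  have "(9 * heckeF + 4 * heckeG) $ (9 * i + 5) = fps_section 1 (fps_section 2 (9 * heckeF + 4 * heckeG)) $ i"
    by (simp add: fps_section_nth algebra_simps)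
  also have "\<dots> = 11 * (169716 * heckeG - 2679 * heckeF) $ i - 11416140 * (fps_X ^ 2 * fps_dilate 3 heckeB) $ i"
    unfolding hecke_mod_11 by (simp add: mult.assoc)
  also have "(fps_X ^ 2 * fps_dilate 3 heckeB) $ i = 0"
  proof -
    have "\<not> 3 dvd i - 2" if "i \<ge> 2" using assms that by presburger
    thus ?thesis by (simp add: fps_X_power_mult_nth fps_dilate_nth)
  qed
  finally show ?thesis by simp
qed

section \<open>Bol's identity\<close>

definition bol_coeff :: "int \<Rightarrow> nat \<Rightarrow> nat \<Rightarrow> int" where
  "bol_coeff k n j = int (n choose j) * (\<Prod>i\<in>{j..<n}. k + int i)"

lemma bol_coeff_step1:
  assumes "j < n"
  shows "bol_coeff k n j = int (n choose j) * (k + int j) * (\<Prod>i\<in>{Suc j..<n}. k + int i)"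
  using assms by (simp add: bol_coeff_def prod.atLeast_Suc_lessThan mult.assoc)

lemma choose_step: "int (n choose Suc j) * (int j + 1) = int (n choose j) * (int n - int j)" if "j \<le> n"
proof -
  have "Suc j * (n choose Suc j) = (n - j) * (n choose j)"
    using binomial_absorption[of j n] binomial_absorb_comp[of n j] by simp
  hence "int (Suc j * (n choose Suc j)) = int ((n - j) * (n choose j))" by (simp only:)
  thus ?thesis using that by (simp add: of_nat_diff algebra_simps)
qed

lemma bol_coeff_rec:
  assumes "j \<le> n"
  shows "bol_coeff k (Suc n) (Suc j) = bol_coeff k n (Suc j) * (int n + k + int (Suc j)) + bol_coeff k n j"
proof (cases "j = n")
  case False
  hence j: "j < n" using assms by simp
  define p where "p = (\<Prod>i\<in>{Suc j..<n}. k + int i)"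
  have "bol_coeff k (Suc n) (Suc j) = (int (n choose j) + int (n choose Suc j)) * (p * (k + int n))"
    using j by (simp add: bol_coeff_def p_def)
  moreover have "bol_coeff k n (Suc j) = int (n choose Suc j) * p" by (simp add: bol_coeff_def p_def)
  moreover have "bol_coeff k n j = int (n choose j) * (k + int j) * p"
    using bol_coeff_step1[OF j] by (simp add: p_def)
  moreover have "int (n choose Suc j) * (int j + 1) = int (n choose j) * (int n - int j)"
    using choose_step[OF assms] .
  ultimately show ?thesis by (simp add: algebra_simps) algebra
qed (simp add: bol_coeff_def)

lemma bol_coeff_rec0: "bol_coeff k (Suc n) 0 = bol_coeff k n 0 * (int n + k)"
  by (simp add: bol_coeff_def prod.atLeastLessThan_Suc algebra_simps)

lemma bol_coeff_shift:
  assumes "j \<le> n"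
  shows "bol_coeff k n j * (int n - int j) = bol_coeff k n (Suc j) * (int j + 1) * (k + int j)"
proof (cases "j = n")
  case False
  hence j: "j < n" using assms by simp
  show ?thesis unfolding bol_coeff_step1[OF j] using choose_step[OF assms]
    by (simp add: bol_coeff_def)
qed (simp add: bol_coeff_def)

lemma bol_coeff_Suc_eq_0: "bol_coeff k n (Suc n) = 0" by (simp add: bol_coeff_def)

lemma qD_sum: "qD (sum f A) = (\<Sum>i\<in>A. qD (f i))"
  by (induction A rule: infinite_finite_induct) simp_all

lemma qD_of_int_mult [simp]: "qD (of_int c * f) = of_int c * qD f"
  by (simp flip: fps_of_int)

lemma qD_of_int [simp]: "qD (of_int c) = 0"
  using qD_of_int_mult[of c 1] by simp

lemma qD_power_general: "qD (f ^ n) = of_nat n * f ^ (n - 1) * qD f"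
  by (induction n) (auto simp: qD_mult algebra_simps power_eq_if)

text \<open>
Here \<open>k\<close> is a weight and \<open>G\<^sub>j\<close> is a modular form of weight \<open>k + 2j\<close>. The
hypothesis says that \<open>\<theta>\<close> of it is modular up to the quasimodular term \<open>(k + 2j) \<phi>
G\<^sub>j\<close> and a multiple of \<open>G\<^sub>j\<^sub>-\<^sub>1\<close>. The latter is chosen so that in the
iterated derivative all contributions of \<open>Q\<close> cancel in pairs: those from \<open>\<theta>\<phi> =
\<phi>\<^sup>2 - 4Q\<close> at index \<open>j\<close> against those from \<open>G\<^sub>j\<^sub>+\<^sub>1\<close>. For
\<open>k = 1 - n\<close> the coefficients with \<open>j < n\<close> vanish, and \<open>\<theta>\<^sup>n G\<^sub>0 =
G\<^sub>n\<close> is modular; this is Bol's identity.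
\<close>

lemma bol_iterated_derivative:
  fixes \<phi> Q :: "int fps" and G :: "nat \<Rightarrow> int fps"
  assumes phi: "qD \<phi> = \<phi> ^ 2 - 4 * Q"
  assumes G: "\<And>j. j < n \<Longrightarrow> qD (G j) = G (Suc j) + of_int (k + 2 * int j) * \<phi> * G j
                 + 4 * Q * of_int (int j * (k + int j - 1)) * G (j - 1)"
  shows "(qD ^^ n) (G 0) = (\<Sum>j\<le>n. of_int (bol_coeff k n j) * (\<phi> ^ (n - j) * G j))"
  using G
proof (induction n)
  case (Suc n)
  define c where "c = bol_coeff k n"
  have cn: "c (Suc n) = 0" by (simp add: c_def bol_coeff_Suc_eq_0)
  have IH: "(qD ^^ n) (G 0) = (\<Sum>j\<le>n. of_int (c j) * (\<phi> ^ (n - j) * G j))"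
    unfolding c_def using Suc.prems by (intro Suc.IH) auto
  define R where "R = (\<lambda>j. of_int (c j * (int n + k + int j)) * (\<phi> ^ (Suc n - j) * G j))"
  define S where "S = (\<lambda>j. of_int (c j) * (\<phi> ^ (n - j) * G (Suc j)))"
  define T where "T = (\<lambda>j. 4 * Q * (of_int (c j * (int j * (k + int j - 1))) * (\<phi> ^ (n - j) * G (j - 1))))"
  define T' where "T' = (\<lambda>j. 4 * Q * (of_int (c j * (int n - int j)) * (\<phi> ^ (n - Suc j) * G j)))"
  have summand: "qD (of_int (c j) * (\<phi> ^ (n - j) * G j)) = R j + S j + T j - T' j" if j: "j \<le> n" for j
  proof -
    have "qD (of_int (c j) * (\<phi> ^ (n - j) * G j)) =
      of_int (c j) * (of_nat (n - j) * \<phi> ^ (n - j - 1) * (\<phi> ^ 2 - 4 * Q) * G j + \<phi> ^ (n - j) *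
        (G (Suc j) + of_int (k + 2 * int j) * \<phi> * G j + 4 * Q * of_int (int j * (k + int j - 1)) * G (j - 1)))"
      using j Suc.prems[of j] by (simp add: qD_mult qD_power_general phi)
    also have "of_nat (n - j) * \<phi> ^ (n - j - 1) * (\<phi> ^ 2 - 4 * Q) =
       of_int (int n - int j) * (\<phi> ^ (Suc n - j) - 4 * Q * \<phi> ^ (n - Suc j))"
    proof (cases "j = n")
      case False
      then obtain d where "n = Suc (j + d)" using j less_imp_Suc_add[of j n] by auto
      thus ?thesis by (simp add: algebra_simps power2_eq_square)
    qed simp
    also have "\<phi> ^ (Suc n - j) = \<phi> ^ (n - j) * \<phi>" using j by (simp add: Suc_diff_le)
    finally have *: "qD (of_int (c j) * (\<phi> ^ (n - j) * G j)) =
      of_int (c j) * (of_int (int n - int j) * (\<phi> ^ (n - j) * \<phi> - 4 * Q * \<phi> ^ (n - Suc j)) * G j +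
        \<phi> ^ (n - j) * (G (Suc j) + of_int (k + 2 * int j) * \<phi> * G j
          + 4 * Q * of_int (int j * (k + int j - 1)) * G (j - 1)))" .
    have **: "R j = of_int (c j * (int n + k + int j)) * (\<phi> ^ (n - j) * \<phi> * G j)"
      using j by (simp add: R_def Suc_diff_le mult_ac)
    show ?thesis unfolding * ** S_def T_def T'_def by (simp add: algebra_simps)
  qed
  have "(qD ^^ Suc n) (G 0) = (\<Sum>j\<le>n. R j + S j + T j - T' j)"
    unfolding funpow.simps comp_def IH qD_sum using summand by (intro sum.cong) auto
  also have "\<dots> = (\<Sum>j\<le>n. R j) + (\<Sum>j\<le>n. S j) + ((\<Sum>j\<le>n. T j) - (\<Sum>j\<le>n. T' j))"
    by (simp add: sum.distrib sum_subtractf)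
  also have "(\<Sum>j\<le>n. T j) = (\<Sum>j\<le>n. T' j)"
  proof -
    have "(\<Sum>j\<le>n. T j) = (\<Sum>j\<le>Suc n. T j)" by (simp add: T_def cn)
    also have "\<dots> = (\<Sum>j\<le>n. T (Suc j))" by (subst sum.atMost_Suc_shift) (simp add: T_def)
    also have "\<dots> = (\<Sum>j\<le>n. T' j)"
    proof (intro sum.cong refl)
      fix j assume "j \<in> {..n}"
      hence "c j * (int n - int j) = c (Suc j) * (int (Suc j) * (k + int (Suc j) - 1))"
        using bol_coeff_shift[of j n k] by (simp add: c_def mult_ac add_ac)
      thus "T (Suc j) = T' j" unfolding T_def T'_def by simp
    qed
    finally show ?thesis .
  qed
  also have "(\<Sum>j\<le>n. R j) = (\<Sum>j\<le>Suc n. R j)" by (simp add: R_def cn)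
  also have "\<dots> = R 0 + (\<Sum>j\<le>n. R (Suc j))" by (rule sum.atMost_Suc_shift)
  also have "R 0 + (\<Sum>j\<le>n. R (Suc j)) + (\<Sum>j\<le>n. S j) + ((\<Sum>j\<le>n. T' j) - (\<Sum>j\<le>n. T' j)) =
     R 0 + (\<Sum>j\<le>n. R (Suc j) + S j)" by (simp add: sum.distrib)
  also have "\<dots> = of_int (bol_coeff k (Suc n) 0) * (\<phi> ^ (Suc n - 0) * G 0) +
     (\<Sum>j\<le>n. of_int (bol_coeff k (Suc n) (Suc j)) * (\<phi> ^ (Suc n - Suc j) * G (Suc j)))"
  proof (intro arg_cong2[of _ _ _ _ "(+)"] sum.cong refl)
    show "R 0 = of_int (bol_coeff k (Suc n) 0) * (\<phi> ^ (Suc n - 0) * G 0)"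
      by (simp add: R_def c_def bol_coeff_rec0)
    fix j assume "j \<in> {..n}"
    thus "R (Suc j) + S j = of_int (bol_coeff k (Suc n) (Suc j)) * (\<phi> ^ (Suc n - Suc j) * G (Suc j))"
      by (simp add: R_def S_def c_def bol_coeff_rec algebra_simps)
  qed
  also have "\<dots> = (\<Sum>j\<le>Suc n. of_int (bol_coeff k (Suc n) j) * (\<phi> ^ (Suc n - j) * G j))"
    by (rule sum.atMost_Suc_shift [symmetric])
  finally show ?case .
qed (simp add: bol_coeff_def)

text \<open>
The form \<open>\<phi>(-q)\<^bsup>-20\<^esup> Q / P\<close> of weight \<open>-10\<close>. Without the factor \<open>Q
/ P\<close> of weight 0 its derivative would involve only \<open>\<alpha>\<close>; with it, \<open>A - 20
\<alpha>\<close> appears, which makes it possible to compare \<open>A\<close> with a form of weight 22.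
\<close>

definition bol_start :: "int fps" where
  "bol_start = fps_right_inverse phi_neg 1 ^ 28 * modQ"

lemma inverse_phi_neg: "phi_neg * fps_right_inverse phi_neg 1 = 1"
  by (rule fps_right_inverse) simp

lemma qD_bol_start: "qD bol_start = (modA - 20 * alpha) * bol_start"
proof -
  let ?i = "fps_right_inverse phi_neg 1"
  have "qD (phi_neg * ?i) = 0" by (simp add: inverse_phi_neg)
  hence "phi_neg * (alpha * ?i + qD ?i) = 0" by (simp add: qD_mult qD_phis algebra_simps)
  hence "qD ?i = - alpha * ?i" by (simp add: add_eq_0_iff)
  hence "qD (?i ^ 28) = of_nat 28 * - alpha * ?i ^ 28" by (rule qD_power)
  thus ?thesis unfolding bol_start_def qD_mult qD_modQ by (simp add: algebra_simps)
qed

text \<open>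
The modular factors \<open>G\<^sub>j / G\<^sub>0\<close> of weight \<open>2j\<close> that the recursion of Bol's
identity produces from \<open>bol_start\<close>. Since \<open>\<theta>A - 4\<alpha>A = 32 Q\<close> and
\<open>\<theta>Q - 8\<alpha>Q = A Q\<close>, they are polynomials in \<open>A\<close> and \<open>Q\<close>.
\<close>

definition bol_poly :: "nat \<Rightarrow> int fps" where
  "bol_poly = (\<lambda>j. [1,
      modA,
      modA ^ 2 + 72 * modQ,
      modA ^ 3 + 280 * modA * modQ,
      modA ^ 4 + 752 * modA ^ 2 * modQ + 15872 * modQ ^ 2,
      modA ^ 5 + 1744 * modA ^ 3 * modQ + 127104 * modA * modQ ^ 2,
      modA ^ 6 + 3768 * modA ^ 4 * modQ + 638976 * modA ^ 2 * modQ ^ 2 + 5971968 * modQ ^ 3,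
      modA ^ 7 + 7848 * modA ^ 5 * modQ + 2608512 * modA ^ 3 * modQ ^ 2 + 80034816 * modA * modQ ^ 3,
      modA ^ 8 + 16032 * modA ^ 6 * modQ + 9503232 * modA ^ 4 * modQ ^ 2 + 642121728 * modA ^ 2 * modQ ^ 3 +
        3229974528 * modQ ^ 4,
      modA ^ 9 + 32416 * modA ^ 7 * modQ + 32341248 * modA ^ 5 * modQ ^ 2 + 4035317760 * modA ^ 3 * modQ ^ 3 +
        64929005568 * modA * modQ ^ 4,
      modA ^ 10 + 65192 * modA ^ 8 * modQ + 105439232 * modA ^ 6 * modQ ^ 2 + 22000103424 * modA ^ 4 * modQ ^ 3 +
        758268297216 * modA ^ 2 * modQ ^ 4 + 2310286344192 * modQ ^ 5,
      modA ^ 11 + 130744 * modA ^ 9 * modQ + 334303488 * modA ^ 7 * modQ ^ 2 + 109538396160 * modA ^ 5 * modQ ^ 3 +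
        6768767434752 * modA ^ 3 * modQ ^ 4 + 64988049309696 * modA * modQ ^ 5] ! j)"

lemma bol_poly_step:
  assumes "j < 11"
  shows "qD (bol_poly j) + (modA - 20 * alpha) * bol_poly j =
    bol_poly (Suc j) + of_int (- 10 + 2 * int j) * (2 * alpha) * bol_poly j
       + 4 * modQ * of_int (int j * (- 10 + int j - 1)) * bol_poly (j - 1)"
proof -
  note qD_rules = qD_mult qD_power_general qD_modA qD_modQ
  have s0: "qD (bol_poly 0) + (modA - 20 * alpha) * bol_poly 0 = bol_poly (Suc 0) + of_int (- 10 + 2 * int 0) * (2 *
        alpha) * bol_poly 0 + 4 * modQ * of_int (int 0 * (- 10 + int 0 - 1)) * bol_poly (0 - 1)"
    by (simp add: bol_poly_def qD_rules, (algebra)?)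
  have s1: "qD (bol_poly 1) + (modA - 20 * alpha) * bol_poly 1 = bol_poly (Suc 1) + of_int (- 10 + 2 * int 1) * (2 *
        alpha) * bol_poly 1 + 4 * modQ * of_int (int 1 * (- 10 + int 1 - 1)) * bol_poly (1 - 1)"
    by (simp add: bol_poly_def qD_rules, (algebra)?)
  have s2: "qD (bol_poly 2) + (modA - 20 * alpha) * bol_poly 2 = bol_poly (Suc 2) + of_int (- 10 + 2 * int 2) * (2 *
        alpha) * bol_poly 2 + 4 * modQ * of_int (int 2 * (- 10 + int 2 - 1)) * bol_poly (2 - 1)"
    by (simp add: bol_poly_def qD_rules, (algebra)?)
  have s3: "qD (bol_poly 3) + (modA - 20 * alpha) * bol_poly 3 = bol_poly (Suc 3) + of_int (- 10 + 2 * int 3) * (2 *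
        alpha) * bol_poly 3 + 4 * modQ * of_int (int 3 * (- 10 + int 3 - 1)) * bol_poly (3 - 1)"
    by (simp add: bol_poly_def qD_rules, (algebra)?)
  have s4: "qD (bol_poly 4) + (modA - 20 * alpha) * bol_poly 4 = bol_poly (Suc 4) + of_int (- 10 + 2 * int 4) * (2 *
        alpha) * bol_poly 4 + 4 * modQ * of_int (int 4 * (- 10 + int 4 - 1)) * bol_poly (4 - 1)"
    by (simp add: bol_poly_def qD_rules, (algebra)?)
  have s5: "qD (bol_poly 5) + (modA - 20 * alpha) * bol_poly 5 = bol_poly (Suc 5) + of_int (- 10 + 2 * int 5) * (2 *
        alpha) * bol_poly 5 + 4 * modQ * of_int (int 5 * (- 10 + int 5 - 1)) * bol_poly (5 - 1)"
    by (simp add: bol_poly_def qD_rules, (algebra)?)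
  have s6: "qD (bol_poly 6) + (modA - 20 * alpha) * bol_poly 6 = bol_poly (Suc 6) + of_int (- 10 + 2 * int 6) * (2 *
        alpha) * bol_poly 6 + 4 * modQ * of_int (int 6 * (- 10 + int 6 - 1)) * bol_poly (6 - 1)"
    by (simp add: bol_poly_def qD_rules, (algebra)?)
  have s7: "qD (bol_poly 7) + (modA - 20 * alpha) * bol_poly 7 = bol_poly (Suc 7) + of_int (- 10 + 2 * int 7) * (2 *
        alpha) * bol_poly 7 + 4 * modQ * of_int (int 7 * (- 10 + int 7 - 1)) * bol_poly (7 - 1)"
    by (simp add: bol_poly_def qD_rules, (algebra)?)
  have s8: "qD (bol_poly 8) + (modA - 20 * alpha) * bol_poly 8 = bol_poly (Suc 8) + of_int (- 10 + 2 * int 8) * (2 *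
        alpha) * bol_poly 8 + 4 * modQ * of_int (int 8 * (- 10 + int 8 - 1)) * bol_poly (8 - 1)"
    by (simp add: bol_poly_def qD_rules, (algebra)?)
  have s9: "qD (bol_poly 9) + (modA - 20 * alpha) * bol_poly 9 = bol_poly (Suc 9) + of_int (- 10 + 2 * int 9) * (2 *
        alpha) * bol_poly 9 + 4 * modQ * of_int (int 9 * (- 10 + int 9 - 1)) * bol_poly (9 - 1)"
    by (simp add: bol_poly_def qD_rules, (algebra)?)
  have s10: "qD (bol_poly 10) + (modA - 20 * alpha) * bol_poly 10 = bol_poly (Suc 10) + of_int (- 10 + 2 * int 10) *
        (2 * alpha) * bol_poly 10 + 4 * modQ * of_int (int 10 * (- 10 + int 10 - 1)) * bol_poly (10 - 1)"
    by (simp add: bol_poly_def qD_rules, (algebra)?)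
  have "j = 0 \<or> j = 1 \<or> j = 2 \<or> j = 3 \<or> j = 4 \<or> j = 5 \<or> j = 6 \<or> j = 7 \<or> j = 8 \<or> j
        = 9 \<or> j = 10"
    using assms by arith
  thus ?thesis
    by (elim disjE) (simp_all only: s0 s1 s2 s3 s4 s5 s6 s7 s8 s9 s10)
qed

text \<open>
Bol's identity for weight \<open>-10\<close>: of the twelve coefficients only the last one does not contain the factor
\<open>-10 + 10\<close>.
\<close>

lemma eleventh_derivative_bol_start: "(qD ^^ 11) bol_start = bol_start * bol_poly 11"
proof -
  have phi: "qD (2 * alpha) = (2 * alpha) ^ 2 - 4 * modQ"
    unfolding qD_simps qD_alpha by algebra
  define G where "G = (\<lambda>j. bol_start * bol_poly j)"
  have "qD (G j) = G (Suc j) + of_int (- 10 + 2 * int j) * (2 * alpha) * G j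
                 + 4 * modQ * of_int (int j * (- 10 + int j - 1)) * G (j - 1)" if "j < 11" for j
  proof -
    have "qD (G j) = bol_start * (qD (bol_poly j) + (modA - 20 * alpha) * bol_poly j)"
      by (simp add: G_def qD_mult qD_bol_start algebra_simps)
    thus ?thesis unfolding bol_poly_step[OF that] G_def by (simp add: algebra_simps)
  qed
  hence "(qD ^^ 11) (G 0) = (\<Sum>j\<le>11. of_int (bol_coeff (-10) 11 j) * ((2 * alpha) ^ (11 - j) * G j))"
    by (rule bol_iterated_derivative[OF phi])
  also have "\<dots> = (\<Sum>j\<in>{11}. of_int (bol_coeff (-10) 11 j) * ((2 * alpha) ^ (11 - j) * G j))"
  proof (rule sum.mono_neutral_right)
    have "bol_coeff (-10) 11 j = 0" if "j \<le> 10" for j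
      using that unfolding bol_coeff_def by (auto intro!: bexI[of _ 10])
    thus "\<forall>j\<in>{..11} - {11}. of_int (bol_coeff (-10) 11 j) * ((2 * alpha) ^ (11 - j) * G j) = 0"
      by auto
  qed auto
  also have "\<dots> = G 11" by (simp add: bol_coeff_def)
  finally show ?thesis by (simp add: G_def bol_poly_def)
qed

section \<open>The generating function of the cubic partitions\<close>

definition cubic_gf :: "int fps" where
  "cubic_gf = Abs_fps (\<lambda>n. int (cubic_partitions n))"

lemma cubic_partitions_eq_upto: "n \<le> N \<Longrightarrow> cubic_partitions n = cubic_partitions_upto N n"
proof -
  have "cubic_partitions = (\<lambda>n. cubic_partitions_upto n n)"
    using theI'[OF ex1_cubic_partition_seq] is_cubic_partition_seq_upto
    unfolding cubic_partitions_def by (rule is_cubic_partition_seq_unique)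
  thus "n \<le> N \<Longrightarrow> cubic_partitions n = cubic_partitions_upto N n"
    using cubic_partitions_upto_stable[of n N] by metis
qed

lemma mult_geom_fps:
  assumes "d > 0"
  shows "Abs_fps (\<lambda>n. int (mult_geom d f n)) * (1 - fps_X ^ d) = Abs_fps (\<lambda>n. int (f n))"
proof -
  define g :: "int fps" where "g = Abs_fps (\<lambda>n. if d dvd n then 1 else 0)"
  have g: "g * (1 - fps_X ^ d) = 1"
  proof (rule fps_ext)
    fix n
    have "d dvd n - d \<longleftrightarrow> d dvd n" if "d \<le> n" using that by (simp add: dvd_minus_self)
    moreover have "n = 0" if "n < d" "d dvd n" using that by (auto dest: dvd_imp_le)
    ultimately show "(g * (1 - fps_X ^ d)) $ n = 1 $ n"
      using assms by (auto simp: g_def right_diff_distrib fps_X_power_mult_right_nth)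
  qed
  have "Abs_fps (\<lambda>n. int (mult_geom d f n)) = Abs_fps (\<lambda>n. int (f n)) * g"
    by (auto simp: fps_eq_iff g_def fps_mult_nth mult_geom_def atLeast0AtMost intro!: sum.cong)
  thus ?thesis by (simp add: mult.assoc g)
qed

text \<open>
Division by one more pair of factors \<open>(1 - q\<^sup>i) (1 - q\<^bsup>2i\<^esup>)\<close> is what the recursion
for the coefficients does.
\<close>

lemma cubic_partitions_upto_fps:
  "Abs_fps (\<lambda>n. int (cubic_partitions_upto N n)) *
     ((\<Prod>i=1..N. 1 - fps_X ^ i) * (\<Prod>i=1..N. 1 - fps_X ^ (2 * i))) = 1"
proof (induction N)
  case 0
  show ?case by (simp add: fps_eq_iff)
next
  case (Suc N)
  let ?f = "\<lambda>N. Abs_fps (\<lambda>n. int (cubic_partitions_upto N n))"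
  have e1: "?f (Suc N) * (1 - fps_X ^ (2 * Suc N)) * (1 - fps_X ^ Suc N) = ?f N"
    by (simp only: cubic_partitions_upto.simps mult_geom_fps zero_less_Suc nat_0_less_mult_iff zero_less_numeral simp_thms)
  have P: "(\<Prod>i=1..Suc N. g i) = (\<Prod>i=1..N. g i) * g (Suc N)" for g :: "nat \<Rightarrow> int fps"
    by simp
  have "?f (Suc N) * ((\<Prod>i=1..Suc N. 1 - fps_X ^ i) * (\<Prod>i=1..Suc N. 1 - fps_X ^ (2 * i))) =
    (?f (Suc N) * (1 - fps_X ^ (2 * Suc N)) * (1 - fps_X ^ Suc N)) *
      ((\<Prod>i=1..N. 1 - fps_X ^ i) * (\<Prod>i=1..N. 1 - fps_X ^ (2 * i)))"
    unfolding P by (simp only: mult_ac)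
  thus ?case unfolding e1 Suc.IH .
qed

lemma cubic_gf_euler: "cubic_gf * (euler 1 * euler 2) = 1"
proof (rule agree_all)
  fix N
  have e: "agree N (euler k) (\<Prod>i=1..N. 1 - fps_X ^ (k * i))" if "k > 0" for k
  proof -
    have "N \<le> k * N" using that by simp
    hence "agree N (euler k) (\<Prod>i\<in>(\<lambda>i. k * i) ` {1..} \<inter> {1..k * N}. 1 + fps_const (-1) * fps_X ^ i)"
      unfolding euler_def by (rule agree_qprod)
    also have "\<dots> = (\<Prod>i=1..N. 1 - fps_X ^ (k * i))"
      by (rule prod.reindex_bij_witness[of _ "\<lambda>i. k * i" "\<lambda>i. i div k"])
         (use that in \<open>auto simp flip: fps_const_neg\<close>)
    finally show ?thesis .
  qed
  have "agree N cubic_gf (Abs_fps (\<lambda>n. int (cubic_partitions_upto N n)))"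
    by (simp add: agree_def cubic_gf_def cubic_partitions_eq_upto)
  hence "agree N (cubic_gf * (euler 1 * euler 2)) (Abs_fps (\<lambda>n. int (cubic_partitions_upto N n)) *
     ((\<Prod>i=1..N. 1 - fps_X ^ (1 * i)) * (\<Prod>i=1..N. 1 - fps_X ^ (2 * i))))"
    by (intro agree_mult e) auto
  thus "agree N (cubic_gf * (euler 1 * euler 2)) 1"
    using cubic_partitions_upto_fps[of N] by simp
qed

lemma cubic_gf_theta: "cubic_gf * (phi_neg * psi) = 1"
  by (simp only: phi_neg_mult_psi cubic_gf_euler)

text \<open>
A theta series may be truncated to the indices with small exponents; this makes initial coefficients computable.
\<close>

lemma theta_agree:
  assumes r: "0 < r" "r < k" and m: "\<And>j. \<bar>j\<bar> > m \<Longrightarrow> jexp k r j > int N"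
  shows "agree N (theta k r e) (\<Sum>j\<in>{-m..m}. fps_const (sgn_pow e j) * fps_X ^ nat (jexp k r j))"
  unfolding agree_def
proof (intro allI impI)
  fix n assume n: "n \<le> N"
  have eq: "n = nat (jexp k r j) \<longleftrightarrow> jexp k r j = int n" for j
    using jexp_ge_abs[OF r, of j] by auto
  have "(\<Sum>j\<in>{-m..m}. fps_const (sgn_pow e j) * fps_X ^ nat (jexp k r j)) $ n =
     (\<Sum>j\<in>{-m..m}. if jexp k r j = int n then sgn_pow e j else 0)"
    by (simp add: fps_sum_nth eq if_distrib cong: if_cong)
  also have "\<dots> = (\<Sum>j\<in>{-m..m} \<inter> {j. jexp k r j = int n}. sgn_pow e j)"
    by (simp add: sum.If_cases)
  also have "{-m..m} \<inter> {j. jexp k r j = int n} = {j. jexp k r j = int n}"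
  proof -
    have "j \<in> {-m..m}" if "jexp k r j = int n" for j
    proof -
      have "\<not> \<bar>j\<bar> > m" using m[of j] n that by auto
      hence "j \<le> m" "- j \<le> m" by (simp_all add: abs_le_iff not_less)
      thus ?thesis by simp
    qed
    thus ?thesis by blast
  qed
  finally show "theta k r e $ n = (\<Sum>j\<in>{-m..m}. fps_const (sgn_pow e j) * fps_X ^ nat (jexp k r j)) $ n"
    by (simp add: theta_def int_series_def)
qed

section \<open>Initial coefficients\<close>

lemma phi_neg_agree: "agree 29 phi_neg (1 - 2 * fps_X + 2 * fps_X ^ 4 - 2 * fps_X ^ 9 + 2 * fps_X ^ 16 - 2 * fps_X ^ 25)"
proof -
  have "agree 29 phi_neg (\<Sum>j\<in>{-5..5}. fps_const (sgn_pow (-1) j) * fps_X ^ nat (jexp 2 1 j))"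
    unfolding phi_neg_def
  proof (rule theta_agree)
    fix j :: int assume "\<bar>j\<bar> > 5"
    hence "6 * 6 \<le> \<bar>j\<bar> * \<bar>j\<bar>" by (intro mult_mono) auto
    thus "jexp 2 1 j > int 29" by (simp add: jexp_values[unfolded One_nat_def])
  qed auto
  also have "{-5..5} = {-5,-4,-3,-2,-1,0,1,2,3,4,5::int}" by (simp add: set_eq_iff) presburger
  finally show ?thesis
    by (simp add: jexp_values[unfolded One_nat_def] sgn_pow_minus_1 algebra_simps flip: fps_const_neg)
qed

lemma psi_agree: "agree 29 psi (1 + fps_X + fps_X ^ 3 + fps_X ^ 6 + fps_X ^ 10 + fps_X ^ 15 + fps_X ^ 21 + fps_X ^ 28)"
proof -
  have "agree 29 psi (\<Sum>j\<in>{-5..5}. fps_const (sgn_pow 1 j) * fps_X ^ nat (jexp 4 1 j))"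
    unfolding psi_def
  proof (rule theta_agree)
    fix j :: int assume "\<bar>j\<bar> > 5"
    hence "6 * 6 \<le> \<bar>j\<bar> * \<bar>j\<bar>" by (intro mult_mono) auto
    moreover have "6 * \<bar>j\<bar> \<le> \<bar>j\<bar> * \<bar>j\<bar>" using \<open>\<bar>j\<bar> > 5\<close> by
        (intro mult_mono) auto
    ultimately show "jexp 4 1 j > int 29" by (simp add: jexp_values[unfolded One_nat_def])
  qed auto
  also have "{-5..5} = {-5,-4,-3,-2,-1,0,1,2,3,4,5::int}" by (simp add: set_eq_iff) presburger
  finally have "agree 29 psi (\<Sum>j\<in>{-5,-4,-3,-2,-1,0,1,2,3,4,5::int}. fps_const (sgn_pow 1 j) * fps_X ^ nat
        (jexp 4 1 j))" .
  thus ?thesis 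
    by (auto simp: jexp_values[unfolded One_nat_def] agree_def)
qed

text \<open>
The polynomial is the inverse of \<open>\<phi>(-q) \<psi>(q)\<close> up to degree 29. It is verified by multiplying
out, not computed.
\<close>

lemma cubic_gf_agree: "agree 29 cubic_gf (1 + fps_X + 3 * fps_X ^ 2 + 4 * fps_X ^ 3 + 9 * fps_X ^ 4 + 12 * fps_X ^ 5
        + 23 * fps_X ^ 6 + 31 * fps_X ^ 7 + 54 * fps_X ^ 8 + 73 * fps_X ^ 9 + 118 * fps_X ^ 10 + 159 * fps_X ^ 11 +
        246 * fps_X ^ 12 + 329 * fps_X ^ 13 + 489 * fps_X ^ 14 + 651 * fps_X ^ 15 + 940 * fps_X ^ 16 + 1242 * fps_X ^
        17 + 1751 * fps_X ^ 18 + 2298 * fps_X ^ 19 + 3177 * fps_X ^ 20 + 4142 * fps_X ^ 21 + 5630 * fps_X ^ 22 + 7293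
        * fps_X ^ 23 + 9776 * fps_X ^ 24 + 12584 * fps_X ^ 25 + 16659 * fps_X ^ 26 + 21320 * fps_X ^ 27 + 27922 *
        fps_X ^ 28 + 35532 * fps_X ^ 29)"
proof (rule agree_cancel)
  let ?p = "1 + fps_X + 3 * fps_X ^ 2 + 4 * fps_X ^ 3 + 9 * fps_X ^ 4 + 12 * fps_X ^ 5 + 23 * fps_X ^ 6 + 31 * fps_X
        ^ 7 + 54 * fps_X ^ 8 + 73 * fps_X ^ 9 + 118 * fps_X ^ 10 + 159 * fps_X ^ 11 + 246 * fps_X ^ 12 + 329 * fps_X
        ^ 13 + 489 * fps_X ^ 14 + 651 * fps_X ^ 15 + 940 * fps_X ^ 16 + 1242 * fps_X ^ 17 + 1751 * fps_X ^ 18 + 2298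
        * fps_X ^ 19 + 3177 * fps_X ^ 20 + 4142 * fps_X ^ 21 + 5630 * fps_X ^ 22 + 7293 * fps_X ^ 23 + 9776 * fps_X ^
        24 + 12584 * fps_X ^ 25 + 16659 * fps_X ^ 26 + 21320 * fps_X ^ 27 + 27922 * fps_X ^ 28 + 35532 * fps_X ^ 29
        :: int fps"
  let ?a = "1 - 2 * fps_X + 2 * fps_X ^ 4 - 2 * fps_X ^ 9 + 2 * fps_X ^ 16 - 2 * fps_X ^ 25 :: int fps"
  let ?b = "1 + fps_X + fps_X ^ 3 + fps_X ^ 6 + fps_X ^ 10 + fps_X ^ 15 + fps_X ^ 21 + fps_X ^ 28 :: int fps"
  have "agree 29 (?p * (phi_neg * psi)) (?p * (?a * ?b))"
    by (intro agree_mult agree_refl phi_neg_agree psi_agree)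
  \<comment> \<open>the product has degree 82; everything beyond degree 29 is collected in the second summand\<close>
  also have "?p * (?a * ?b) = 1 + fps_X ^ 30 * (-46092 - 12250 * fps_X + 75487 * fps_X ^ 2 + 51128 * fps_X ^ 3 +
        65624 * fps_X ^ 4 - 8775 * fps_X ^ 5 - 56490 * fps_X ^ 6 - 74141 * fps_X ^ 7 - 94031 * fps_X ^ 8 - 29994 *
        fps_X ^ 9 - 83604 * fps_X ^ 10 - 14619 * fps_X ^ 11 + 73447 * fps_X ^ 12 + 94961 * fps_X ^ 13 + 30325 * fps_X
        ^ 14 + 86630 * fps_X ^ 15 + 109531 * fps_X ^ 16 + 50387 * fps_X ^ 17 + 62683 * fps_X ^ 18 - 10962 * fps_X ^
        19 - 16062 * fps_X ^ 20 - 67041 * fps_X ^ 21 - 88026 * fps_X ^ 22 - 113580 * fps_X ^ 23 - 55567 * fps_X ^ 24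
        - 72710 * fps_X ^ 25 - 94244 * fps_X ^ 26 - 122270 * fps_X ^ 27 - 111216 * fps_X ^ 28 - 51974 * fps_X ^ 29 +
        25162 * fps_X ^ 30 + 30536 * fps_X ^ 31 - 52424 * fps_X ^ 32 - 68554 * fps_X ^ 33 - 88082 * fps_X ^ 34 -
        21972 * fps_X ^ 35 - 29070 * fps_X ^ 36 - 37316 * fps_X ^ 37 - 48854 * fps_X ^ 38 - 62362 * fps_X ^ 39 +
        11282 * fps_X ^ 40 + 13970 * fps_X ^ 41 + 17930 * fps_X ^ 42 + 22070 * fps_X ^ 43 - 64128 * fps_X ^ 44 -
        82324 * fps_X ^ 45 - 14586 * fps_X ^ 46 - 19552 * fps_X ^ 47 - 25168 * fps_X ^ 48 - 33318 * fps_X ^ 49 -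
        42640 * fps_X ^ 50 - 55844 * fps_X ^ 51 - 71064 * fps_X ^ 52)" by algebra
  also have "agree 29 \<dots> 1" by (auto simp: agree_def fps_X_power_mult_nth)
  finally show "agree 29 (cubic_gf * (phi_neg * psi)) (?p * (phi_neg * psi))"
    unfolding cubic_gf_theta by (rule agree_sym)
qed simp

lemma cubic_partitions_values:
  "cubic_partitions 7 = 31" "cubic_partitions 18 = 1751" "cubic_partitions 29 = 35532"
proof -
  have *: "int (cubic_partitions n) = (1 + fps_X + 3 * fps_X ^ 2 + 4 * fps_X ^ 3 + 9 * fps_X ^ 4 + 12 * fps_X ^ 5 +
        23 * fps_X ^ 6 + 31 * fps_X ^ 7 + 54 * fps_X ^ 8 + 73 * fps_X ^ 9 + 118 * fps_X ^ 10 + 159 * fps_X ^ 11 + 246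
        * fps_X ^ 12 + 329 * fps_X ^ 13 + 489 * fps_X ^ 14 + 651 * fps_X ^ 15 + 940 * fps_X ^ 16 + 1242 * fps_X ^ 17
        + 1751 * fps_X ^ 18 + 2298 * fps_X ^ 19 + 3177 * fps_X ^ 20 + 4142 * fps_X ^ 21 + 5630 * fps_X ^ 22 + 7293 *
        fps_X ^ 23 + 9776 * fps_X ^ 24 + 12584 * fps_X ^ 25 + 16659 * fps_X ^ 26 + 21320 * fps_X ^ 27 + 27922 * fps_X
        ^ 28 + 35532 * fps_X ^ 29) $ n" if "n \<le> 29" for n
    using cubic_gf_agree[unfolded agree_def, rule_format, OF that]
    by (simp only: cubic_gf_def fps_nth_Abs_fps)
  show "cubic_partitions 7 = 31" "cubic_partitions 18 = 1751" "cubic_partitions 29 = 35532"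
    using *[of 7] *[of 18] *[of 29] by simp_all
qed

lemma hecke_start_values:
  "(9 * heckeF + 4 * heckeG) $ 0 = 9" "(9 * heckeF + 4 * heckeG) $ 1 = -185" "(9 * heckeF + 4 * heckeG) $ 2 = 1740"
proof -
  have agree_2I: "agree 2 f g" if "f $ 0 = g $ 0" "f $ 1 = g $ 1" "f $ 2 = g $ 2" for f g :: "int fps"
    unfolding agree_def
  proof (intro allI impI)
    fix n :: nat assume "n \<le> 2"
    hence "n = 0 \<or> n = 1 \<or> n = 2" by arith
    thus "f $ n = g $ n" using that by auto
  qed
  have a: "agree 2 phi_neg (1 - 2 * fps_X)"
    by (rule agree_2I) (use phi_neg_agree in \<open>simp_all add: agree_def\<close>)
  have b: "agree 2 psi (1 + fps_X)"
    by (rule agree_2I) (use psi_agree in \<open>simp_all add: agree_def\<close>)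
  have pow: "agree N (f ^ n) (g ^ n)" if "agree N f g" for f g :: "int fps" and n N
    using that by (induction n) (auto intro: agree_mult)
  have "agree 2 (9 * heckeF + 4 * heckeG) (9 * ((1 - 2 * fps_X) ^ 13 * (1 + fps_X) ^ 5)
      + 4 * (fps_X * ((1 - 2 * fps_X) ^ 5 * (1 + fps_X) ^ 13)))"
    unfolding heckeF_def heckeG_def by (intro agree_add agree_mult agree_refl pow a b)
  also have "(1 - 2 * fps_X) ^ 13 * (1 + fps_X) ^ 5 = (1 - 21 * fps_X + 192 * fps_X ^ 2 - 978 * fps_X ^ 3 + 2865 *
        fps_X ^ 4 - 3873 * fps_X ^ 5 - 3042 * fps_X ^ 6 + 20904 * fps_X ^ 7 - 27456 * fps_X ^ 8 - 11440 * fps_X ^ 9 +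
        68640 * fps_X ^ 10 - 49920 * fps_X ^ 11 - 49920 * fps_X ^ 12 + 88320 * fps_X ^ 13 - 7680 * fps_X ^ 14 - 55296
        * fps_X ^ 15 + 24576 * fps_X ^ 16 + 12288 * fps_X ^ 17 - 8192 * fps_X ^ 18 :: int fps)" by algebra
  also have "(1 - 2 * fps_X) ^ 5 * (1 + fps_X) ^ 13 = (1 + 3 * fps_X - 12 * fps_X ^ 2 - 54 * fps_X ^ 3 + 15 * fps_X ^
        4 + 345 * fps_X ^ 5 + 390 * fps_X ^ 6 - 780 * fps_X ^ 7 - 2145 * fps_X ^ 8 - 715 * fps_X ^ 9 + 3432 * fps_X ^
        10 + 5226 * fps_X ^ 11 + 1521 * fps_X ^ 12 - 3873 * fps_X ^ 13 - 5730 * fps_X ^ 14 - 3912 * fps_X ^ 15 - 1536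
        * fps_X ^ 16 - 336 * fps_X ^ 17 - 32 * fps_X ^ 18 :: int fps)" by algebra
  finally have *: "agree 2 (9 * heckeF + 4 * heckeG) (9 * (1 - 21 * fps_X + 192 * fps_X ^ 2 - 978 * fps_X ^ 3 + 2865
        * fps_X ^ 4 - 3873 * fps_X ^ 5 - 3042 * fps_X ^ 6 + 20904 * fps_X ^ 7 - 27456 * fps_X ^ 8 - 11440 * fps_X ^ 9
        + 68640 * fps_X ^ 10 - 49920 * fps_X ^ 11 - 49920 * fps_X ^ 12 + 88320 * fps_X ^ 13 - 7680 * fps_X ^ 14 -
        55296 * fps_X ^ 15 + 24576 * fps_X ^ 16 + 12288 * fps_X ^ 17 - 8192 * fps_X ^ 18) + 4 * (fps_X * (1 + 3 *
        fps_X - 12 * fps_X ^ 2 - 54 * fps_X ^ 3 + 15 * fps_X ^ 4 + 345 * fps_X ^ 5 + 390 * fps_X ^ 6 - 780 * fps_X ^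
        7 - 2145 * fps_X ^ 8 - 715 * fps_X ^ 9 + 3432 * fps_X ^ 10 + 5226 * fps_X ^ 11 + 1521 * fps_X ^ 12 - 3873 *
        fps_X ^ 13 - 5730 * fps_X ^ 14 - 3912 * fps_X ^ 15 - 1536 * fps_X ^ 16 - 336 * fps_X ^ 17 - 32 * fps_X ^ 18)))" .
  show "(9 * heckeF + 4 * heckeG) $ 0 = 9" "(9 * heckeF + 4 * heckeG) $ 1 = -185" "(9 * heckeF + 4 * heckeG) $ 2 = 1740"
    by (rule trans[OF *[unfolded agree_def, rule_format]]; simp add: fps_numeral_nth)+
qed

section \<open>Power series modulo 11\<close>

type_synonym f11 = 11

text \<open>
The type \<open>11\<close> is the ring of integers modulo 11. Over it Fermat's theorem and the Frobenius map become
equations between power series.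
\<close>

definition red :: "int fps \<Rightarrow> f11 fps" where
  "red f = Abs_fps (\<lambda>n. of_int (f $ n))"

lemma red_nth [simp]: "red f $ n = of_int (f $ n)"
  by (simp add: red_def)

lemma red_hom [simp]:
  "red (f + g) = red f + red g" "red (f - g) = red f - red g" "red (- f) = - red f"
  "red (f * g) = red f * red g" "red 0 = 0" "red 1 = 1" "red fps_X = fps_X"
  "red (fps_const c) = fps_const (of_int c)" "red (qD f) = qD (red f)"
  by (simp_all add: fps_eq_iff fps_mult_nth qD_nth)

lemma red_power [simp]: "red (f ^ n) = red f ^ n"
  by (induction n) simp_all

lemma red_numeral [simp]: "red (numeral k) = numeral k"
  using red_hom(8)[of "numeral k"] by (simp add: numeral_fps_const)

lemma of_int_f11_eq_0: "(of_int c :: f11) = 0 \<longleftrightarrow> 11 dvd c"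
  by (simp add: of_int_eq_0_iff_char_dvd)

lemma fermat_f11: "(c :: f11) ^ 11 = c"
proof (cases c rule: bit1_cases)
  case (of_int z)
  hence "z = 0 \<or> z = 1 \<or> z = 2 \<or> z = 3 \<or> z = 4 \<or> z = 5 \<or> z = 6 \<or> z = 7 \<or> z = 8 \<or>
        z = 9 \<or> z = 10"
    by simp arith
  hence "z \<in> {0,1,2,3,4,5,6,7,8,9,10}" by blast
  hence "c \<in> of_int ` {0,1,2,3,4,5,6,7,8,9,10}" using of_int by blast
  thus ?thesis by auto
qed

lemma fermat_f11': "(c :: f11) = 0 \<or> c ^ 10 = 1"
proof (cases c rule: bit1_cases)
  case (of_int z)
  hence "z = 0 \<or> z = 1 \<or> z = 2 \<or> z = 3 \<or> z = 4 \<or> z = 5 \<or> z = 6 \<or> z = 7 \<or> z = 8 \<or>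
        z = 9 \<or> z = 10"
    by simp arith
  hence "z \<in> {0,1,2,3,4,5,6,7,8,9,10}" by blast
  hence "c \<in> of_int ` {0,1,2,3,4,5,6,7,8,9,10}" using of_int by blast
  thus ?thesis by auto
qed

lemma eleven_f11: "(11 :: f11 fps) = 0"
  by (simp add: numeral_fps_const)

text \<open>
The way in which congruences are established below: an exact identity between integral series, with an explicit
multiple of 11.
\<close>

lemma red_eqI: "f = g + 11 * h \<Longrightarrow> red f = red g"
  by (simp add: eleven_f11)

text \<open>
The Frobenius map on power series over a prime field. The proof peels off the constant term.
\<close>

lemma frobenius_f11: "(f :: f11 fps) ^ 11 = fps_dilate 11 f"
proof (rule agree_all)
  fix N show "agree N (f ^ 11) (fps_dilate 11 f)"
  proof (induction N arbitrary: f)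
    case 0
    show ?case by (simp add: agree_def fps_power_zeroth fermat_f11)
  next
    case (Suc N)
    define g where "g = fps_shift 1 f"
    define c where "c = fps_const (f $ 0)"
    have f: "f = c + fps_X * g"
      by (auto simp: fps_eq_iff g_def c_def)
    have add: "(x + y) ^ 11 = x ^ 11 + y ^ 11" for x y :: "f11 fps"
      by (rule freshmans_dream) simp_all
    have "agree (Suc N) (c + fps_X ^ 11 * g ^ 11) (c + fps_X ^ 11 * fps_dilate 11 g)"
      using agree_X_mult[OF Suc.IH[of g], of 11] by (intro agree_add agree_refl) (auto intro: agree_mono)
    also have "c + fps_X ^ 11 * fps_dilate 11 g = fps_dilate 11 f"
      unfolding f by (simp add: c_def)
    also have "c + fps_X ^ 11 * g ^ 11 = f ^ 11"
      unfolding f add by (simp add: c_def power_mult_distrib fermat_f11 fps_const_power)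
    finally show ?case .
  qed
qed

lemma qD_funpow_nth: "(qD ^^ k) f $ n = of_nat n ^ k * f $ n"
  by (induction k) (simp_all add: qD_nth)

lemma qD_eleven: "(qD ^^ 11) f = qD (f :: f11 fps)"
  by (simp add: fps_eq_iff qD_funpow_nth fermat_f11 qD_nth del: funpow.simps)

section \<open>The Hasse invariant modulo 11\<close>

definition "redA = red modA"
definition "redQ = red modQ"
definition "red_alpha = red alpha"

text \<open>
The form \<open>E\<close> of weight 10 is the Hasse invariant of level 2 modulo 11, and \<open>B\<close> of weight 12
is its derivative up to a factor, in the sense of Serre.
\<close>

definition "redE = redA ^ 5 + redA ^ 3 * redQ + 2 * redA * redQ ^ 2"
definition "redB = 9 * redA ^ 4 * redQ + 6 * redA ^ 2 * redQ ^ 2 - redQ ^ 3"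

lemma mod_11_ode:
  "qD redA = 4 * red_alpha * redA + 32 * redQ" "qD redQ = (8 * red_alpha + redA) * redQ" "qD red_alpha = 2 *
        red_alpha ^ 2 - 2 * redQ"
  by (simp_all add: redA_def redQ_def red_alpha_def qD_modA qD_modQ qD_alpha flip: red_hom(9))

lemma redA_nth_0 [simp]: "redA $ 0 = 1" and redQ_nth_0 [simp]: "redQ $ 0 = 0"
  by (simp_all add: redA_def redQ_def modA_def modQ_def fps_power_zeroth)

lemma qD_power_f11: "qD (f ^ n) = of_nat n * f ^ (n - 1) * qD (f :: f11 fps)"
  by (induction n) (auto simp: qD_mult algebra_simps power_eq_if)

definition "modE = modA ^ 5 + modA ^ 3 * modQ + 2 * modA * modQ ^ 2"
definition "modB = 9 * modA ^ 4 * modQ + 6 * modA ^ 2 * modQ ^ 2 - modQ ^ 3"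

lemma red_modE: "red modE = redE" and red_modB: "red modB = redB"
  by (simp_all add: modE_def modB_def redE_def redB_def redA_def redQ_def)

lemma qD_E: "qD redE = 2 * (redB - red_alpha * redE)"
proof -
  have "qD modE = 2 * (modB - alpha * modE) + 11 * (2 * alpha * modE + 13 * modA ^ 4 * modQ + 8 * modA ^ 2 * modQ ^ 2
        + 6 * modQ ^ 3)"
    unfolding modE_def modB_def by (simp add: qD_mult qD_power_general qD_modA qD_modQ, algebra)
  from red_eqI[OF this] show ?thesis
    by (simp add: red_modE red_modB red_alpha_def)
qed

lemma qD_B: "qD redB = 2 * red_alpha * redB - 2 * redE * redQ"
proof -
  have "qD modB = 2 * alpha * modB - 2 * modE * modQ + 11 * (2 * alpha * modB + modA ^ 5 * modQ + 106 * modA ^ 3 *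
        modQ ^ 2 + 35 * modA * modQ ^ 3)"
    unfolding modE_def modB_def by (simp add: qD_mult qD_power_general qD_modA qD_modQ, algebra)
  from red_eqI[OF this] show ?thesis
    by (simp add: red_modE red_modB red_alpha_def redQ_def)
qed

text \<open>
The equations for \<open>\<theta>E\<close> and \<open>\<theta>B\<close> are linear in \<open>E\<close> and
\<open>B\<close> and are also solved by \<open>1\<close> and \<open>\<alpha>\<close> in place of \<open>E\<close> and
\<open>B\<close>. The Wronskian \<open>W = B - \<alpha> E\<close> of the two solutions therefore satisfies
\<open>\<theta>W = 0\<close>, so it has only exponents divisible by 11, whereas \<open>\<theta>E = 2 W\<close> has
none of those.
\<close>

lemma alpha_E: "red_alpha * redE = redB"
proof -
  define W where "W = redB - red_alpha * redE"
  have W: "qD W = 0"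
    unfolding W_def by (simp add: qD_mult qD_B qD_E mod_11_ode algebra_simps power2_eq_square)
  have redE: "qD redE = 2 * W" by (simp add: qD_E W_def)
  have "W $ n = 0" for n
  proof (cases "(of_nat n :: f11) = 0")
    case True
    \<comment> \<open>halving modulo 11 is multiplication by 6\<close>
    have "2 * W $ n = 0" using arg_cong[OF redE, of "\<lambda>f. f $ n"] True by (simp add: qD_nth)
    hence "6 * (2 * W $ n) = 0" by (simp only: mult_zero_right)
    hence "(12 :: f11) * W $ n = 0" by (simp flip: mult.assoc)
    moreover have "(12 :: f11) = 1" by simp
    ultimately show ?thesis by (simp only: mult_1_left)
  next
    case False
    have "of_nat n * W $ n = 0" using arg_cong[OF W, of "\<lambda>f. f $ n"] by (simp add: qD_nth)
    hence "of_nat n ^ 10 * W $ n = 0"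
      using power_Suc2[of "of_nat n :: f11" 9] by (simp add: mult.assoc)
    thus ?thesis using fermat_f11'[of "of_nat n"] False by simp
  qed
  hence "W = 0" by (simp add: fps_eq_iff)
  thus ?thesis by (simp add: W_def)
qed

lemma fps_mult_X_cancel:
  assumes "fps_X * f = fps_X * (g :: 'a::comm_ring_1 fps)"
  shows "f = g"
proof (rule fps_ext)
  fix n show "f $ n = g $ n"
    using arg_cong[OF assms, of "\<lambda>h. h $ Suc n"] by simp
qed

lemma fps_mult_unit_cancel:
  assumes "h * f = h * g" "h $ 0 = (1 :: 'a::comm_ring_1)"
  shows "f = g"
  using agree_cancel[of _ f h g] assms by (metis agree_all agree_refl mult.commute)

text \<open>
Modulo 11 the eleventh derivative is the first one. So Bol's identity for \<open>bol_start\<close> equates the factor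
\<open>A - 20 \<alpha>\<close> of its first derivative with a form of weight 22, and reducing that form modulo 11
reveals \<open>E\<close> and \<open>B\<close>.
\<close>

lemma bol_relation: "redA - 20 * red_alpha = redA * redE ^ 2 - 20 * (redE * redB)"
proof -
  have "(qD ^^ 11) (red bol_start) = red ((qD ^^ 11) bol_start)"
    by (simp add: fps_eq_iff qD_funpow_nth del: funpow.simps)
  hence "qD (red bol_start) = red bol_start * red (bol_poly 11)"
    by (simp add: qD_eleven eleventh_derivative_bol_start del: funpow.simps)
  hence *: "red bol_start * (redA - 20 * red_alpha) = red bol_start * red (bol_poly 11)"
    by (simp add: qD_bol_start redA_def red_alpha_def mult.commute flip: red_hom(9))
  define h where "h = red (fps_right_inverse phi_neg 1 ^ 28 * psi ^ 8)"
  have h: "red bol_start = fps_X * h" "h $ 0 = 1"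
    by (simp_all add: bol_start_def h_def modQ_def fps_power_zeroth mult_ac)
  have "fps_X * (h * (redA - 20 * red_alpha)) = fps_X * (h * red (bol_poly 11))"
    using * by (simp add: h mult.assoc)
  hence "h * (redA - 20 * red_alpha) = h * red (bol_poly 11)" by (rule fps_mult_X_cancel)
  hence "redA - 20 * red_alpha = red (bol_poly 11)" using h(2) by (rule fps_mult_unit_cancel)
  also have "red (bol_poly 11) = red (modA * modE ^ 2 - 20 * (modE * modB))"
  proof (rule red_eqI)
    \<comment> \<open>the coefficients of the multiple of 11 come from comparing both sides over the integers\<close>
    show "bol_poly 11 = modA * modE ^ 2 - 20 * (modE * modB) + 11 * (11902 * modA ^ 9 * modQ + 30391253 * modA ^ 7 * modQ ^ 2
      + 9958036056 * modA ^ 5 * modQ ^ 3 + 615342494088 * modA ^ 3 * modQ ^ 4 + 5908004482696 * modA * modQ ^ 5)"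
      unfolding modE_def modB_def by (simp add: bol_poly_def, algebra)
  qed
  finally show ?thesis by (simp add: red_modE red_modB redA_def)
qed

text \<open>
Multiply the preceding relation for \<open>T = A - 20 \<alpha>\<close> out with \<open>B = \<alpha> E\<close>: it
becomes \<open>T = T E\<^sup>2\<close>. Since \<open>T\<close> and \<open>6 (E + 1)\<close> have constant term 1
modulo 11, both can be cancelled.
\<close>

lemma hasse_invariant: "redE = 1" and alpha_eq: "red_alpha = redB"
proof -
  define T where "T = redA - 20 * red_alpha"
  have "red_alpha $ 0 = 0" by (simp add: red_alpha_def logder_def qD_nth)
  hence T0: "T $ 0 = 1" by (simp add: T_def)
  have E0: "redE $ 0 = 1" by (simp add: redE_def fps_power_zeroth)
  have "T * redE ^ 2 = T * 1"
  proof -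
    have "T = redE * (redA * redE - 20 * redB)"
      unfolding T_def bol_relation by (simp add: algebra_simps power2_eq_square)
    also have "redA * redE - 20 * redB = T * redE"
      unfolding T_def alpha_E[symmetric] by (simp add: algebra_simps)
    finally show ?thesis by (simp add: power2_eq_square mult_ac)
  qed
  hence E2: "redE ^ 2 = 1" using T0 by (rule fps_mult_unit_cancel)
  hence "(redE + 1) * redE = (redE + 1) * 1" by (simp add: algebra_simps power2_eq_square)
  hence "(6 * (redE + 1)) * redE = (6 * (redE + 1)) * 1" by (simp only: mult.assoc)
  moreover have "(6 * (redE + 1)) $ 0 = 1" using E0 by simp
  ultimately show "redE = 1" by (rule fps_mult_unit_cancel)
  thus "red_alpha = redB" using alpha_E by simp
qed

section \<open>Forms of level 2 modulo 11\<close>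

text \<open>
Modulo 11, the forms of weight \<open>2d\<close>: linear combinations of the monomials of weight \<open>2d\<close> in
\<open>A\<close> and \<open>Q\<close>.
\<close>

definition modform11 :: "nat \<Rightarrow> f11 fps \<Rightarrow> bool" where
  "modform11 d F \<longleftrightarrow> (\<exists>c. F = (\<Sum>i\<le>d div 2. fps_const (c i) * (redA ^ (d - 2 * i) *
        redQ ^ i)))"

lemma form_monomial:
  assumes "i + 2 * j = d"
  shows "modform11 d (fps_const c * (redA ^ i * redQ ^ j))"
proof -
  have j: "j \<le> d div 2" "i = d - 2 * j" using assms by auto
  have "(\<Sum>l\<le>d div 2. fps_const (if l = j then c else 0) * (redA ^ (d - 2 * l) * redQ ^ l)) =
        (\<Sum>l\<in>{j}. fps_const (if l = j then c else 0) * (redA ^ (d - 2 * l) * redQ ^ l))"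
    by (rule sum.mono_neutral_right) (use j in auto)
  thus ?thesis unfolding modform11_def using j by (intro exI[of _ "\<lambda>l. if l = j then c else 0"]) simp
qed

lemma form_add: "modform11 d F \<Longrightarrow> modform11 d G \<Longrightarrow> modform11 d (F + G)"
  unfolding modform11_def
proof (elim exE)
  fix c c' assume "F = (\<Sum>i\<le>d div 2. fps_const (c i) * (redA ^ (d - 2 * i) * redQ ^ i))"
    "G = (\<Sum>i\<le>d div 2. fps_const (c' i) * (redA ^ (d - 2 * i) * redQ ^ i))"
  thus "\<exists>c. F + G = (\<Sum>i\<le>d div 2. fps_const (c i) * (redA ^ (d - 2 * i) * redQ ^ i))"
    by (intro exI[of _ "\<lambda>i. c i + c' i"]) (simp add: sum.distrib distrib_right flip: fps_const_add)
qed

lemma form_0: "modform11 d 0" unfolding modform11_def by (intro exI[of _ "\<lambda>_. 0"]) simp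

lemma form_sum: "(\<And>i. i \<in> S \<Longrightarrow> modform11 d (F i)) \<Longrightarrow> modform11 d (sum F S)"
  by (induction S rule: infinite_finite_induct) (auto intro: form_add form_0)

lemma form_mult:
  assumes "modform11 d F" "modform11 e G"
  shows "modform11 (d + e) (F * G)"
proof -
  obtain c c' where F: "F = (\<Sum>i\<le>d div 2. fps_const (c i) * (redA ^ (d - 2 * i) * redQ ^ i))"
    and G: "G = (\<Sum>i\<le>e div 2. fps_const (c' i) * (redA ^ (e - 2 * i) * redQ ^ i))"
    using assms unfolding modform11_def by blast
  have "F * G = (\<Sum>i\<le>d div 2. \<Sum>j\<le>e div 2. fps_const (c i * c' j) * (redA ^ (d - 2 * i + (e - 2 * j))
        * redQ ^ (i + j)))"
    unfolding F G sum_product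
    by (intro sum.cong refl) (simp only: power_add fps_const_mult[symmetric] mult_ac)
  moreover have "modform11 (d + e) (fps_const (c i * c' j) * (redA ^ (d - 2 * i + (e - 2 * j)) * redQ ^ (i + j)))"
    if "i \<le> d div 2" "j \<le> e div 2" for i j
    by (rule form_monomial) (use that in auto)
  ultimately show ?thesis by (auto intro!: form_sum)
qed

lemma form_A: "modform11 1 redA" and form_Q: "modform11 2 redQ" and form_const: "modform11 0 (fps_const c)"
  using form_monomial[of 1 0 1 1] form_monomial[of 0 1 2 1] form_monomial[of 0 0 0 c] by simp_all

lemma form_power: "modform11 d F \<Longrightarrow> modform11 (n * d) (F ^ n)"
  by (induction n) (use form_const[of 1] in \<open>auto intro: form_mult\<close>)

lemma form_scale: "modform11 d F \<Longrightarrow> modform11 d (fps_const c * F)"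
  using form_mult[OF form_const, of d F c] by simp

lemma form_numeral: "modform11 d F \<Longrightarrow> modform11 d (numeral k * F)"
  unfolding numeral_fps_const by (rule form_scale)

lemma form_of_nat: "modform11 d F \<Longrightarrow> modform11 d (of_nat k * F)"
  unfolding fps_of_nat[symmetric] by (rule form_scale)

lemma form_uminus: "modform11 d F \<Longrightarrow> modform11 d (- F)"
  using form_scale[of d F "-1"] by (simp flip: fps_const_neg)

lemma form_diff: "modform11 d F \<Longrightarrow> modform11 d G \<Longrightarrow> modform11 d (F - G)"
  using form_add[OF _ form_uminus, of d F G] by simp

text \<open>
Multiplication by \<open>E \<equiv> 1\<close> raises the weight by 10 without changing the series.
\<close>

lemma form_raise: "modform11 d F \<Longrightarrow> modform11 (d + 5) F"
proof -
  have m: "modform11 5 (redA ^ 5)" "modform11 5 (redA ^ 3 * redQ)" "modform11 5 (redA * redQ ^ 2)"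
    using form_monomial[of 5 0 5 1] form_monomial[of 3 1 5 1] form_monomial[of 1 2 5 1] by simp_all
  have "modform11 5 redE" unfolding redE_def
    using form_add[OF form_add[OF m(1,2)] form_numeral[OF m(3)], of "num.Bit0 num.One"] by (simp add: mult.assoc)
  thus "modform11 d F \<Longrightarrow> modform11 (d + 5) F" using form_mult[of d F 5 redE] by (simp add: hasse_invariant)
qed

lemma form_raise_mult:
  assumes "modform11 d F"
  shows "modform11 (d + 5 * n) F"
proof (induction n)
  case (Suc n)
  thus ?case using form_raise[of "d + 5 * n" F] by (simp add: algebra_simps)
qed (use assms in simp)

lemma form_alpha: "modform11 6 red_alpha"
proof -
  have m: "modform11 6 (redA ^ 4 * redQ)" "modform11 6 (redA ^ 2 * redQ ^ 2)" "modform11 6 (redQ ^ 3)"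
    using form_monomial[of 4 1 6 1] form_monomial[of 2 2 6 1] form_monomial[of 0 3 6 1] by simp_all
  show ?thesis unfolding alpha_eq redB_def
    using form_diff[OF form_add[OF form_numeral[OF m(1)] form_numeral[OF m(2)]] m(3)]
    by (simp add: mult.assoc)
qed

text \<open>
Since \<open>\<alpha>\<close> is modulo 11 a form of weight 12, derivatives of forms are again forms, of a weight that
is higher by 12.
\<close>

lemma form_qD:
  assumes "modform11 d F"
  shows "modform11 (d + 6) (qD F)"
proof -
  obtain c where F: "F = (\<Sum>i\<le>d div 2. fps_const (c i) * (redA ^ (d - 2 * i) * redQ ^ i))"
    using assms unfolding modform11_def by blast
  have qA: "modform11 7 (qD redA)"
  proof -
    have "modform11 7 (red_alpha * redA)" using form_mult[OF form_alpha form_A] by simp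
    moreover have "modform11 7 redQ" using form_raise[OF form_Q] by simp
    ultimately show ?thesis unfolding mod_11_ode mult.assoc by (intro form_add form_numeral)
  qed
  have qQ: "modform11 8 (qD redQ)"
  proof -
    have "modform11 8 (red_alpha * redQ)" using form_mult[OF form_alpha form_Q] by simp
    moreover have "modform11 8 (redA * redQ)" using form_raise[OF form_mult[OF form_A form_Q]] by simp
    moreover have "qD redQ = 8 * (red_alpha * redQ) + redA * redQ" by (simp add: mod_11_ode algebra_simps)
    ultimately show ?thesis by (auto intro: form_add form_numeral)
  qed
  have pow: "modform11 (n * e + 6) (qD (G ^ n))" if "modform11 e G" "modform11 (e + 6) (qD G)" for n e G
  proof (cases n)
    case (Suc l)
    have "modform11 (l * e + (e + 6)) (G ^ l * qD G)" by (intro form_mult form_power that)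
    hence "modform11 (n * e + 6) (G ^ l * qD G)" using Suc by (simp add: algebra_simps)
    thus ?thesis unfolding qD_power_f11 mult.assoc using Suc by (intro form_of_nat) simp
  qed (simp add: form_0)
  have "modform11 (d + 6) (qD (redA ^ (d - 2 * i) * redQ ^ i))" if "i \<le> d div 2" for i
  proof -
    have "modform11 ((d - 2 * i) * 1 + 6 + i * 2) (qD (redA ^ (d - 2 * i)) * redQ ^ i)"
      using qA by (intro form_mult form_power pow form_Q form_A) simp
    moreover have "modform11 ((d - 2 * i) * 1 + (i * 2 + 6)) (redA ^ (d - 2 * i) * qD (redQ ^ i))"
      using qQ by (intro form_mult form_power pow form_Q form_A) simp
    moreover have "(d - 2 * i) * 1 + 6 + i * 2 = d + 6" "(d - 2 * i) * 1 + (i * 2 + 6) = d + 6" using that by auto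
    ultimately show ?thesis unfolding qD_mult by (intro form_add) simp_all
  qed
  moreover have "qD (sum f S) = (\<Sum>i\<in>S. qD (f i))" for f :: "nat \<Rightarrow> f11 fps" and S
    by (induction S rule: infinite_finite_induct) simp_all
  ultimately show ?thesis unfolding F by (auto intro!: form_sum form_scale)
qed

text \<open>
The monomials \<open>A\<^bsup>d - 2i\<^esup> Q\<^sup>i = q\<^sup>i + \<dots>\<close> are in echelon form, so the
coefficients of a linear combination can be recovered from the first coefficients of the series; this takes the place
of Sturm's bound.
\<close>

lemma form_sturm:
  assumes "modform11 d F" "agree (d div 2) F 0"
  shows "F = 0"
proof -
  obtain c where F: "F = (\<Sum>i\<le>d div 2. fps_const (c i) * (redA ^ (d - 2 * i) * redQ ^ i))"
    using assms unfolding modform11_def by blast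
  define b where "b = red (psi ^ 8)"
  have b: "redQ = fps_X * b" "b $ 0 = 1" by (simp_all add: redQ_def modQ_def b_def fps_power_zeroth)
  have monomial_nth: "(redA ^ l * redQ ^ i) $ n = (if n < i then 0 else (redA ^ l * b ^ i) $ (n - i))" for l i n
  proof -
    have "redA ^ l * redQ ^ i = fps_X ^ i * (redA ^ l * b ^ i)" by (simp add: b power_mult_distrib mult_ac)
    thus ?thesis by (simp add: fps_X_power_mult_nth)
  qed
  have "c i = 0" if "i \<le> d div 2" for i
    using that
  proof (induction i rule: less_induct)
    case (less n)
    have "0 = F $ n" using assms(2) less.prems by (simp add: agree_def)
    also have "\<dots> = (\<Sum>i\<le>d div 2. c i * (redA ^ (d - 2 * i) * redQ ^ i) $ n)"
      by (simp add: F fps_sum_nth)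
    also have "\<dots> = (\<Sum>i\<in>{n}. c i * (redA ^ (d - 2 * i) * redQ ^ i) $ n)"
    proof (rule sum.mono_neutral_right)
      show "\<forall>i\<in>{..d div 2} - {n}. c i * (redA ^ (d - 2 * i) * redQ ^ i) $ n = 0"
      proof
        fix i assume i: "i \<in> {..d div 2} - {n}"
        show "c i * (redA ^ (d - 2 * i) * redQ ^ i) $ n = 0"
        proof (cases "i < n")
          case True
          thus ?thesis using less i by simp
        next
          case False
          hence "n < i" using i by simp
          thus ?thesis unfolding monomial_nth by simp
        qed
      qed
    qed (use less.prems in auto)
    also have "\<dots> = c n" unfolding monomial_nth sum.insert_remove by (simp add: fps_power_zeroth b(2))
    finally show ?case by simp
  qed
  thus ?thesis unfolding F by simp
qed

section \<open>The section of the generating function modulo 11\<close>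

text \<open>
The shift by \<open>q\<^sup>4\<close> moves the exponents \<open>11 j + 7\<close> to multiples of 11.
\<close>

definition "shifted_gf = fps_X ^ 4 * red cubic_gf"

lemma cubic_gf_nth_0: "cubic_gf $ 0 = 1"
  using arg_cong[OF cubic_gf_theta, of "\<lambda>f. f $ 0"] by simp

text \<open>
Over the rationals \<open>8 \<theta>C = (1 - 16 \<alpha> - A) C\<close>, because \<open>q\<^bsup>-1/8\<^esup>
C\<close> is modular of weight \<open>-1\<close>. Modulo 11 the inverse of 8 is 7, and the shift by
\<open>q\<^sup>4\<close> cancels the constant \<open>7\<close>, since \<open>4 \<equiv> -1/8\<close>.
\<close>

lemma qD_shifted_gf: "qD shifted_gf = (4 * redA - 2 * red_alpha) * shifted_gf"
proof -
  have "qD (cubic_gf * (phi_neg * psi)) = 0" by (simp add: cubic_gf_theta)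
  hence "(qD cubic_gf * psi + cubic_gf * (alpha * psi) + cubic_gf * qD psi) * phi_neg = 0"
    by (simp add: qD_mult qD_phis algebra_simps)
  hence 1: "qD cubic_gf * psi + cubic_gf * (alpha * psi) + cubic_gf * qD psi = 0" by simp
  have "qD modQ = fps_X * (psi ^ 8 + 8 * psi ^ 7 * qD psi)"
  proof -
    have "qD fps_X = (fps_X :: int fps)" by (simp add: fps_XD_def)
    moreover have "qD (psi ^ 8) = 8 * psi ^ 7 * qD psi"
      using qD_power_general[of psi 8] by simp
    ultimately show ?thesis by (simp add: modQ_def qD_mult algebra_simps)
  qed
  hence "fps_X * (psi ^ 8 + 8 * psi ^ 7 * qD psi) = fps_X * ((8 * alpha + modA) * psi ^ 8)"
    using qD_modQ by (simp add: modQ_def algebra_simps)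
  hence "psi ^ 8 + 8 * psi ^ 7 * qD psi = (8 * alpha + modA) * psi ^ 8" by (rule fps_mult_X_cancel)
  hence "psi ^ 7 * (psi + 8 * qD psi) = psi ^ 7 * ((8 * alpha + modA) * psi)" by algebra
  hence 2: "psi + 8 * qD psi = (8 * alpha + modA) * psi" by (simp only: mult_cancel_left) simp
  have "psi * (8 * qD cubic_gf) = psi * ((1 - 16 * alpha - modA) * cubic_gf)"
    using 1 2 by algebra
  hence 3: "8 * qD cubic_gf = (1 - 16 * alpha - modA) * cubic_gf" by (simp only: mult_cancel_left) simp
  have "qD cubic_gf = (7 + 4 * modA - 2 * alpha) * cubic_gf + 11 * (- 10 * alpha * cubic_gf - modA * cubic_gf - 5 *
        qD cubic_gf)"
    using 3 by algebra
  from red_eqI[OF this] have e1: "qD (red cubic_gf) = (7 + 4 * redA - 2 * red_alpha) * red cubic_gf"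
    by (simp add: redA_def red_alpha_def)
  have e2: "qD (fps_X ^ 4) = (4 * fps_X ^ 4 :: f11 fps)"
    by (simp add: fps_eq_iff qD_nth)
  have "qD shifted_gf = (4 * redA - 2 * red_alpha) * shifted_gf + 11 * shifted_gf"
    unfolding shifted_gf_def qD_mult e1 e2 by (simp add: algebra_simps)
  thus ?thesis by (simp add: eleven_f11)
qed

lemma form_qD_shifted_gf:
  assumes "modform11 d F"
  shows "\<exists>G. modform11 (d + 6) G \<and> qD (shifted_gf * F) = shifted_gf * G"
proof (intro exI conjI)
  have "modform11 (d + 6) (redA * F)" using form_raise[OF form_mult[OF form_A assms]] by (simp add: add.commute)
  moreover have "modform11 (d + 6) (red_alpha * F)" using form_mult[OF form_alpha assms] by (simp add: add.commute)
  ultimately show "modform11 (d + 6) (4 * (redA * F) - 2 * (red_alpha * F) + qD F)"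
    by (intro form_add form_diff form_numeral form_qD assms)
  show "qD (shifted_gf * F) = shifted_gf * (4 * (redA * F) - 2 * (red_alpha * F) + qD F)"
    by (simp add: qD_mult qD_shifted_gf algebra_simps)
qed

lemma form_iterated_qD_shifted_gf: "\<exists>G. modform11 (n * 6) G \<and> (qD ^^ n) shifted_gf = shifted_gf * G"
proof (induction n)
  case 0
  show ?case using form_const[of 1] by (intro exI[of _ 1]) simp
next
  case (Suc n)
  then obtain G where "modform11 (n * 6) G" "(qD ^^ n) shifted_gf = shifted_gf * G" by blast
  thus ?case using form_qD_shifted_gf[of "n * 6" G] by (simp add: add.commute)
qed

definition "heckeH = 9 * heckeF + 4 * heckeG"

text \<open>
By Frobenius \<open>H(q\<^sup>1\<^sup>1) = H(q)\<^sup>1\<^sup>1\<close>, and multiplication by \<open>1 = C \<phi>(-q)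
\<psi>(q)\<close> turns the eleventh powers \<open>\<phi>(-q)\<^bsup>143\<^esup> \<psi>(q)\<^bsup>55\<^esup>\<close>
and \<open>\<phi>(-q)\<^bsup>55\<^esup> \<psi>(q)\<^bsup>143\<^esup>\<close> into \<open>C\<close> times monomials in
\<open>P = \<phi>(-q)\<^sup>8\<close> and \<open>Q\<close>. These have weight 100, which is raised to 120.
\<close>

lemma heckeH_power: 
  "\<exists>G. modform11 60 G \<and> fps_X ^ 11 * fps_dilate 11 (red heckeH) = shifted_gf * G"
proof (intro exI conjI)
  define P where "P = redA ^ 2 - 64 * redQ"
  have P: "P = red phi_neg ^ 8"
    using arg_cong[OF modA_square, of red] by (simp add: P_def redA_def redQ_def modP_def)
  have redQ: "redQ = fps_X * red psi ^ 8" by (simp add: redQ_def modQ_def)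
  have "modform11 2 P" unfolding P_def
    using form_power[OF form_A, of 2] by (intro form_diff form_numeral form_Q) simp
  hence "modform11 50 (P ^ 18 * redQ ^ 7)" "modform11 50 (P ^ 7 * redQ ^ 18)"
    using form_mult[OF form_power[of 2 P 18] form_power[OF form_Q, of 7]]
      form_mult[OF form_power[of 2 P 7] form_power[OF form_Q, of 18]] by simp_all
  hence "modform11 50 (9 * (P ^ 18 * redQ ^ 7) + 4 * (P ^ 7 * redQ ^ 18))"
    by (intro form_add form_numeral)
  thus "modform11 60 (9 * (P ^ 18 * redQ ^ 7) + 4 * (P ^ 7 * redQ ^ 18))"
    using form_raise_mult[of 50 _ 2] by simp
  define a b C where "a = red phi_neg" and "b = red psi" and "C = red cubic_gf"
  have C: "C * (a * b) = 1"
    using arg_cong[OF cubic_gf_theta, of red] by (simp add: a_def b_def C_def)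
  have nine: "(9 :: f11 fps) ^ 11 = 9" "(4 :: f11 fps) ^ 11 = 4"
    by (simp_all add: numeral_fps_const fps_const_power)
  have "fps_dilate 11 (red heckeH) = (9 * (a ^ 13 * b ^ 5) + 4 * (fps_X * (a ^ 5 * b ^ 13))) ^ 11"
    by (simp only: frobenius_f11) (simp add: heckeH_def heckeF_def heckeG_def a_def b_def)
  also have "\<dots> = (9 * (a ^ 13 * b ^ 5)) ^ 11 + (4 * (fps_X * (a ^ 5 * b ^ 13))) ^ 11"
    by (rule freshmans_dream) simp_all
  also have "\<dots> = 9 * (a ^ 143 * b ^ 55) + 4 * (fps_X ^ 11 * (a ^ 55 * b ^ 143))"
    by (simp only: power_mult_distrib nine power_mult[symmetric]) simp
  finally have "fps_X ^ 11 * fps_dilate 11 (red heckeH) =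
    (C * (a * b)) * (fps_X ^ 11 * (9 * (a ^ 143 * b ^ 55) + 4 * (fps_X ^ 11 * (a ^ 55 * b ^ 143))))"
    by (simp add: C)
  also have "\<dots> = (fps_X ^ 4 * C) * (9 * ((a ^ 8) ^ 18 * (fps_X * b ^ 8) ^ 7) + 4 * ((a ^ 8) ^ 7 * (fps_X * b ^
        8) ^ 18))"
  proof -
    have pw: "a ^ 144 = a * a ^ 143" "a ^ 56 = a * a ^ 55" "b ^ 144 = b * b ^ 143" "b ^ 56 = b * b ^ 55"
      using power_Suc[of a 143] power_Suc[of a 55] power_Suc[of b 143] power_Suc[of b 55] by simp_all
    have x: "fps_X ^ 11 = (fps_X ^ 4 * fps_X ^ 7 :: f11 fps)" "fps_X ^ 18 = (fps_X ^ 7 * fps_X ^ 11 :: f11 fps)"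
      by (simp_all flip: power_add)
    have "(fps_X ^ 4 * C) * (9 * ((a ^ 8) ^ 18 * (fps_X * b ^ 8) ^ 7) + 4 * ((a ^ 8) ^ 7 * (fps_X * b ^ 8) ^ 18))
      = (fps_X ^ 4 * C) * (9 * (a ^ 144 * (fps_X ^ 7 * b ^ 56)) + 4 * (a ^ 56 * (fps_X ^ 18 * b ^ 144)))"
      by (simp add: power_mult_distrib flip: power_mult)
    also have "\<dots> = (C * (a * b)) * ((fps_X ^ 4 * fps_X ^ 7) * (9 * (a ^ 143 * b ^ 55) + 4 * (fps_X ^ 11 * (a ^
        55 * b ^ 143))))"
      unfolding pw x(2) by (simp only: distrib_left mult_ac)
    finally show ?thesis by (simp only: x(1))
  qed
  finally show "fps_X ^ 11 * fps_dilate 11 (red heckeH) = shifted_gf * (9 * (P ^ 18 * redQ ^ 7) + 4 * (P ^ 7 * redQ ^ 18))"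
    by (simp only: P redQ shifted_gf_def a_def b_def C_def)
qed

text \<open>
Both sides are \<open>f\<close> times forms of weight 120 and have only exponents divisible by 11. The difference is
\<open>f = q\<^sup>4 + \<dots>\<close> times a form that is zero as soon as its coefficients up to degree 30 are, so
it suffices to compare the coefficients up to degree 34, that is, at 11, 22 and 33.
\<close>

theorem projection_shifted_gf: "shifted_gf - (qD ^^ 10) shifted_gf = fps_X ^ 11 * fps_dilate 11 (red heckeH)"
proof -
  obtain G1 where G1: "modform11 60 G1" "(qD ^^ 10) shifted_gf = shifted_gf * G1"
    using form_iterated_qD_shifted_gf[of 10] by auto
  obtain G2 where G2: "modform11 60 G2" "fps_X ^ 11 * fps_dilate 11 (red heckeH) = shifted_gf * G2"
    using heckeH_power by auto
  have "modform11 60 1" using form_raise_mult[OF form_const[of 1], of 12] by simp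
  hence D: "modform11 60 (1 - G1 - G2)" by (intro form_diff G1 G2)
  have H: "heckeH $ 0 = 9" "heckeH $ 1 = -185" "heckeH $ 2 = 1740"
    unfolding heckeH_def by (fact hecke_start_values)+
  define L where "L = shifted_gf - (qD ^^ 10) shifted_gf - fps_X ^ 11 * fps_dilate 11 (red heckeH)"
  have L: "L = shifted_gf * (1 - G1 - G2)" unfolding L_def G1 G2 by (simp add: algebra_simps)
  have L0: "L $ n = 0" if n: "n \<le> 34" for n
  proof (cases "11 dvd n")
    case False
    hence "(of_nat n :: f11) \<noteq> 0" by (simp add: of_nat_eq_0_iff_char_dvd)
    hence "(of_nat n :: f11) ^ 10 = 1" using fermat_f11' by blast
    thus ?thesis using False
      by (auto simp: L_def qD_funpow_nth fps_X_power_mult_nth fps_dilate_nth dvd_minus_self simp del: funpow.simps)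
  next
    case True
    hence z: "(of_nat n :: f11) = 0" by (simp add: of_nat_eq_0_iff_char_dvd)
    obtain m where m: "n = 11 * m" using True by auto
    hence "m = 0 \<or> m = 1 \<or> m = 2 \<or> m = 3" using n by arith
    thus ?thesis
    proof (elim disjE)
      assume "m = 0"
      thus ?thesis using m by (simp add: L_def qD_funpow_nth shifted_gf_def fps_X_power_mult_nth del: funpow.simps)
    next
      assume "m = 1"
      thus ?thesis using m z H cubic_partitions_values
        by (simp add: L_def qD_funpow_nth shifted_gf_def fps_X_power_mult_nth fps_dilate_nth cubic_gf_def del:
        funpow.simps One_nat_def)
    next
      assume "m = 2"
      thus ?thesis using m z H cubic_partitions_values
        by (simp add: L_def qD_funpow_nth shifted_gf_def fps_X_power_mult_nth fps_dilate_nth cubic_gf_def del: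
        funpow.simps One_nat_def)
    next
      assume "m = 3"
      thus ?thesis using m z H cubic_partitions_values
        by (simp add: L_def qD_funpow_nth shifted_gf_def fps_X_power_mult_nth fps_dilate_nth cubic_gf_def del:
        funpow.simps One_nat_def)
    qed
  qed
  have "agree 30 ((1 - G1 - G2) * red cubic_gf) (0 * red cubic_gf)"
    unfolding agree_def
  proof (intro allI impI)
    fix n :: nat assume "n \<le> 30"
    hence "L $ (n + 4) = 0" by (intro L0) simp
    moreover have "L = fps_X ^ 4 * ((1 - G1 - G2) * red cubic_gf)"
      by (simp add: L shifted_gf_def mult_ac)
    ultimately show "((1 - G1 - G2) * red cubic_gf) $ n = (0 * red cubic_gf) $ n"
      by (simp add: fps_X_power_mult_nth)
  qed
  hence "agree 30 (1 - G1 - G2) 0" by (rule agree_cancel) (simp add: cubic_gf_nth_0)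
  hence "1 - G1 - G2 = 0" using form_sturm[OF D] by simp
  hence "L = 0" using L by simp
  thus ?thesis by (simp add: L_def)
qed

lemma cubic_partitions_mod_11:
  "[int (cubic_partitions (11 * j + 7)) = heckeH $ j] (mod 11)"
proof -
  have z: "(of_nat (11 * j + 11) :: f11) = 0" by (subst of_nat_eq_0_iff_char_dvd) simp
  have "of_int (int (cubic_partitions (11 * j + 7))) = shifted_gf $ (11 * j + 11)"
    by (simp add: shifted_gf_def fps_X_power_mult_nth cubic_gf_def add.commute)
  also have "\<dots> = (shifted_gf - (qD ^^ 10) shifted_gf) $ (11 * j + 11)"
    using z by (simp only: fps_sub_nth qD_funpow_nth) simp
  also have "\<dots> = of_int (heckeH $ j)"
    unfolding projection_shifted_gf by (simp add: fps_X_power_mult_nth fps_dilate_nth)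
  finally have "(of_int (int (cubic_partitions (11 * j + 7)) - heckeH $ j) :: f11) = 0"
    by simp
  hence "11 dvd int (cubic_partitions (11 * j + 7)) - heckeH $ j" by (simp only: of_int_f11_eq_0)
  thus ?thesis by (simp add: cong_iff_dvd_diff)
qed

theorem theorem2p1:
  fixes n t :: nat
  assumes "t \<in> {62, 161}"
  shows "[cubic_partitions (297 * n + t) = 0] (mod 11)"
proof -
  obtain i where i: "297 * n + t = 11 * (9 * i + 5) + 7" "i mod 3 \<noteq> 2"
  proof
    show "297 * n + t = 11 * (9 * (3 * n + (t - 62) div 99) + 5) + 7" "(3 * n + (t - 62) div 99) mod 3 \<noteq> 2"
      using assms by auto
  qed
  have "[int (cubic_partitions (297 * n + t)) = heckeH $ (9 * i + 5)] (mod 11)"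
    unfolding i(1) by (rule cubic_partitions_mod_11)
  moreover have "11 dvd heckeH $ (9 * i + 5)"
    unfolding heckeH_def by (rule hecke_coeff_mod_11) (rule i(2))
  ultimately have "11 dvd int (cubic_partitions (297 * n + t))"
    by (meson cong_dvd_iff)
  hence "11 dvd cubic_partitions (297 * n + t)" by presburger
  thus ?thesis by (simp add: cong_0_iff)
qed

end
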